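(* Let $(G,V,\|\cdot\|)$ be a sub-Finsler Lie group with polyhedral norm $\|\cdot\|$, and let $\mathfrak g$ be the Lie algebra of $G$. (i) For each normal curve $\gamma:[0,1]\to G$ there exists $\delta'>0$ such that for each interval $I\subseteq[0,1]$ with $|I|\le\delta'$, the control of $\gamma|_I$ takes value in one face. (ii) More quantitatively, fix a norm $N$ on $\mathfrak g$ and a norm $N^*$ on the dual vector space $\mathfrak g^*$, and for $r>0$ set $$M(r):=\max\{N(\mathrm{Ad}_g\,\mathrm{ad}_XY) : g\in\bar B(1_G,r),\ X,Y\in\mathfrak g,\ N(X)=N(Y)=1\}.$$ Then there exists $\delta>0$ with the following property: for every $r>0$, for each normal curve $\gamma:[0,1]\to G$ with $\gamma(0)=1_G$ and speed $r$, for each covector $\lambda$ associated to $\gamma$, and for every interval $I\subseteq[0,1]$ with $|I|\le\frac{\delta}{N^*(\lambda)M(r)}$, the control of $\gamma|_I$ takes values in one face.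
   Context: A polarization of a Lie group $G$ is a linear subspace $V$ of its Lie algebra $\mathfrak g$; it is bracket-generating if the Lie algebra generated by $V$ is $\mathfrak g$. A sub-Finsler Lie group is a triple $(G,V,\|\cdot\|)$ with $G$ a Lie group, $V$ a bracket-generating polarization and $\|\cdot\|$ a norm on $V$. For an interval $I$, an absolutely continuous curve $\gamma:I\to G$ is horizontal if $\dot\gamma(t)\in \mathrm dL_{\gamma(t)}V$ for a.e. $t$ ($L$ = left translation); its control is $u(t)=\mathrm dL_{\gamma(t)}^{-1}\dot\gamma(t)\in V$. It has speed $r$ if $\|u(t)\|=r$ for a.e. $t$. The distance is $d(g,h)=\inf\int_0^1\|u(t)\|\,\mathrm dt$ over horizontal curves $\gamma:[0,1]\to G$ from $g$ to $h$ (with $u$ the control of $\gamma$), and $\bar B(1_G,r)$ is the closed $d$-ball of radius $r$ centered at the identity $1_G$. The energy is $\mathrm E:V\to\mathbb R$, $\mathrm E(v)=\frac12\|v\|^2$. The subdifferential of $\mathrm E$ at $w\in V$ is $\partial_w\mathrm E=\{\eta\in V^*:\eta(v-w)\le \mathrm E(v)-\mathrm E(w)\ \forall v\in V\}$. A horizontal curve $\gamma:I\to G$ with control $u\in L^2(I,V)$ is a normal curve if there exists $\lambda\in\mathfrak g^*$ with $\lambda\circ\mathrm{Ad}_{\gamma(t)}|_V\in\partial_{u(t)}\mathrm E$ for a.e. $t\in I$; each such $\lambda$ is called a covector associated to $\gamma$. (Normal curves have constant speed.) A norm on $V$ is polyhedral if its closed unit ball is the convex hull of finitely many points. For $r>0$,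 a face of the sphere of radius $r$ in $V$ is a set of the form $\{v\in K:\eta(v)=\max_{w\in K}\eta(w)\}$, where $K=\{v\in V:\|v\|\le r\}$ and $\eta\in V^*\setminus\{0\}$. A measurable function $u:I\to V$ on an interval $I$ takes value(s) in a face if there exist $r>0$ and a face $A$ of the sphere of radius $r$ such that $u(t)\in A$ for a.e. $t\in I$. The size $|I|$ of an interval $I$ with endpoints $a,b$ is $|a-b|$. If $M(r)=0$, the quotient $\frac{\delta}{N^*(\lambda)M(r)}$ is read as $+\infty$.
   Formalization: In (i) the normal curve is assumed non-constant: a constant curve (control 0) is normal with covector 0, but 0 lies in no face of a sphere of radius r>0, so the claim fails for it; 0-dimensional G, where all curves are constant, is excluded. *)

theory Defs
  imports "HOL-Analysis.Analysis" "HOL-Algebra.Group"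
begin

section \<open>Smooth manifolds\<close>

primrec Ck_on :: "nat \<Rightarrow> 'a::real_normed_vector set \<Rightarrow> ('a \<Rightarrow> 'b::real_normed_vector) \<Rightarrow> bool" where
  "Ck_on 0 S f \<longleftrightarrow> continuous_on S f"
| "Ck_on (Suc k) S f \<longleftrightarrow>
     (\<forall>x\<in>S. f differentiable (at x)) \<and> (\<forall>v. Ck_on k S (\<lambda>x. frechet_derivative f (at x) v))"

text \<open>Only used for open subsets of finite-dimensional spaces.\<close>

definition smooth_on :: "'a::real_normed_vector set \<Rightarrow> ('a \<Rightarrow> 'b::real_normed_vector) \<Rightarrow> bool" where
  "smooth_on S f \<longleftrightarrow> (\<forall>k. Ck_on k S f)"

text \<open>A chart is a pair of its domain and its coordinate map.\<close>

type_synonym ('m, 'e) chart = "'m set \<times> ('m \<Rightarrow> 'e)"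

definition chart_inv :: "('m, 'e) chart \<Rightarrow> 'e \<Rightarrow> 'm" where
  "chart_inv c = inv_into (fst c) (snd c)"

definition smooth_atlas :: "('m::topological_space, 'e::euclidean_space) chart set \<Rightarrow> bool" where
  "smooth_atlas A \<longleftrightarrow>
     (\<forall>c\<in>A. open (fst c) \<and> open (snd c ` fst c) \<and>
             homeomorphism (fst c) (snd c ` fst c) (snd c) (chart_inv c)) \<and>
     \<Union> (fst ` A) = UNIV \<and>
     (\<forall>c\<in>A. \<forall>d\<in>A. smooth_on (snd c ` (fst c \<inter> fst d)) (snd d \<circ> chart_inv c))"

definition product_atlas ::
  "('m, 'e) chart set \<Rightarrow> ('n, 'f) chart set \<Rightarrow> ('m \<times> 'n, 'e \<times> 'f) chart set" where
  "product_atlas A B = {(fst c \<times> fst d, map_prod (snd c) (snd d)) | c d. c \<in> A \<and> d \<in> B}"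

definition smooth_map ::
  "('m::topological_space, 'e::euclidean_space) chart set \<Rightarrow>
   ('n::topological_space, 'f::euclidean_space) chart set \<Rightarrow> ('m \<Rightarrow> 'n) \<Rightarrow> bool" where
  "smooth_map A B f \<longleftrightarrow> continuous_on UNIV f \<and>
     (\<forall>c\<in>A. \<forall>d\<in>B. smooth_on (snd c ` (fst c \<inter> f -` fst d)) (snd d \<circ> f \<circ> chart_inv c))"

text \<open>
  Tangent vectors at a point p are represented by their coordinate vectors in one chart
  chosen at p, once and for all.  So the type 'e stands for every tangent space, a vector field is
  a function from the manifold to 'e, and the differential of a map f at p is the
  derivative of f read in the preferred charts at p and at f p.
\<close>

definition chart_at :: "('m, 'e) chart set \<Rightarrow> 'm \<Rightarrow> ('m, 'e) chart" where
  "chart_at A p = (SOME c. c \<in> A \<and> p \<in> fst c)"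

definition differential ::
  "('m, 'e::euclidean_space) chart set \<Rightarrow> ('n, 'f::euclidean_space) chart set \<Rightarrow>
   ('m \<Rightarrow> 'n) \<Rightarrow> 'm \<Rightarrow> 'e \<Rightarrow> 'f" where
  "differential A B f p =
     frechet_derivative (snd (chart_at B (f p)) \<circ> f \<circ> chart_inv (chart_at A p))
       (at (snd (chart_at A p) p))"

text \<open>
  The coordinate expression of a vector field Z in a chart c: since the vector Z q is
  given in the preferred chart at q, it has to be transported to c.
\<close>

definition field_in_chart ::
  "('m, 'e::euclidean_space) chart set \<Rightarrow> ('m, 'e) chart \<Rightarrow> ('m \<Rightarrow> 'e) \<Rightarrow> 'e \<Rightarrow> 'e" where
  "field_in_chart A c Z x =
     (let q = chart_inv c x
      in frechet_derivative (snd c \<circ> chart_inv (chart_at A q)) (at (snd (chart_at A q) q)) (Z q))"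

text \<open>
  The bracket ZW - WZ of vector fields, given in coordinates at p by
  DW(Z) - DZ(W).
\<close>

definition field_bracket ::
  "('m, 'e::euclidean_space) chart set \<Rightarrow> ('m \<Rightarrow> 'e) \<Rightarrow> ('m \<Rightarrow> 'e) \<Rightarrow> 'm \<Rightarrow> 'e" where
  "field_bracket A Z W p =
     (let c = chart_at A p; x = snd c p; z = field_in_chart A c Z; w = field_in_chart A c W
      in frechet_derivative w (at x) (z x) - frechet_derivative z (at x) (w x))"

section \<open>Lie groups\<close>

locale lie_group = group G
  for G :: "('g::{t2_space, second_countable_topology}, 'b) monoid_scheme" (structure) +
  fixes A :: "('g, 'e::euclidean_space) chart set"
  assumes carrier_UNIV: "carrier G = UNIV"
    and atlas: "smooth_atlas A"
    and smooth_mult: "smooth_map (product_atlas A A) A (\<lambda>(g, h). g \<otimes> h)"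
    and smooth_inv: "smooth_map A A (\<lambda>g. inv g)"

text \<open>The Lie algebra of G is the tangent space at the identity, hence is carried by 'e.\<close>

definition dL :: "('g, 'b) monoid_scheme \<Rightarrow> ('g, 'e::euclidean_space) chart set \<Rightarrow> 'g \<Rightarrow> 'e \<Rightarrow> 'e" where
  "dL G A g = differential A A (\<lambda>h. g \<otimes>\<^bsub>G\<^esub> h) \<one>\<^bsub>G\<^esub>"

definition Ad :: "('g, 'b) monoid_scheme \<Rightarrow> ('g, 'e::euclidean_space) chart set \<Rightarrow> 'g \<Rightarrow> 'e \<Rightarrow> 'e" where
  "Ad G A g = differential A A (\<lambda>h. g \<otimes>\<^bsub>G\<^esub> h \<otimes>\<^bsub>G\<^esub> inv\<^bsub>G\<^esub> g) \<one>\<^bsub>G\<^esub>"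

definition left_invariant_field ::
  "('g, 'b) monoid_scheme \<Rightarrow> ('g, 'e::euclidean_space) chart set \<Rightarrow> 'e \<Rightarrow> 'g \<Rightarrow> 'e" where
  "left_invariant_field G A X g = dL G A g X"

definition ad ::
  "('g, 'b) monoid_scheme \<Rightarrow> ('g, 'e::euclidean_space) chart set \<Rightarrow> 'e \<Rightarrow> 'e \<Rightarrow> 'e" where
  "ad G A X Y =
     field_bracket A (left_invariant_field G A X) (left_invariant_field G A Y) \<one>\<^bsub>G\<^esub>"

definition generated_lie_algebra ::
  "('g, 'b) monoid_scheme \<Rightarrow> ('g, 'e::euclidean_space) chart set \<Rightarrow> 'e set \<Rightarrow> 'e set" where
  "generated_lie_algebra G A V =
     \<Inter> {S. subspace S \<and> (\<forall>X\<in>S. \<forall>Y\<in>S. ad G A X Y \<in> S) \<and> V \<subseteq> S}"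

definition bracket_generating ::
  "('g, 'b) monoid_scheme \<Rightarrow> ('g, 'e::euclidean_space) chart set \<Rightarrow> 'e set \<Rightarrow> bool" where
  "bracket_generating G A V \<longleftrightarrow> generated_lie_algebra G A V = UNIV"

section \<open>Norms on subspaces\<close>

text \<open>Values outside V are irrelevant.\<close>

definition norm_on :: "'v::real_vector set \<Rightarrow> ('v \<Rightarrow> real) \<Rightarrow> bool" where
  "norm_on V \<nu> \<longleftrightarrow>
     (\<forall>v\<in>V. 0 \<le> \<nu> v \<and> (\<nu> v = 0 \<longleftrightarrow> v = 0)) \<and>
     (\<forall>v\<in>V. \<forall>c. \<nu> (c *\<^sub>R v) = \<bar>c\<bar> * \<nu> v) \<and>
     (\<forall>v\<in>V. \<forall>w\<in>V. \<nu> (v + w) \<le> \<nu> v + \<nu> w)"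

definition polyhedral :: "'e::euclidean_space set \<Rightarrow> ('e \<Rightarrow> real) \<Rightarrow> bool" where
  "polyhedral V \<nu> \<longleftrightarrow> polytope {v \<in> V. \<nu> v \<le> 1}"

text \<open>Linear functionals on V; two of them that agree on V are not distinguished.\<close>

definition dual_of :: "'e::real_vector set \<Rightarrow> ('e \<Rightarrow> real) set" where
  "dual_of V = {\<eta>. (\<forall>v\<in>V. \<forall>w\<in>V. \<eta> (v + w) = \<eta> v + \<eta> w) \<and> (\<forall>v\<in>V. \<forall>c. \<eta> (c *\<^sub>R v) = c * \<eta> v)}"

definition energy :: "('e \<Rightarrow> real) \<Rightarrow> 'e \<Rightarrow> real" where
  "energy \<nu> v = (\<nu> v)\<^sup>2 / 2"

definition energy_subdifferential ::
  "'e::real_vector set \<Rightarrow> ('e \<Rightarrow> real) \<Rightarrow> 'e \<Rightarrow> ('e \<Rightarrow> real) set" where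
  "energy_subdifferential V \<nu> w =
     {\<eta> \<in> dual_of V. \<forall>v\<in>V. \<eta> (v - w) \<le> energy \<nu> v - energy \<nu> w}"

definition face_of_sphere ::
  "'e::real_vector set \<Rightarrow> ('e \<Rightarrow> real) \<Rightarrow> real \<Rightarrow> 'e set \<Rightarrow> bool" where
  "face_of_sphere V \<nu> r F \<longleftrightarrow>
     (let K = {v \<in> V. \<nu> v \<le> r}
      in \<exists>\<eta>\<in>dual_of V. (\<exists>v\<in>V. \<eta> v \<noteq> 0) \<and> F = {v \<in> K. \<forall>w\<in>K. \<eta> w \<le> \<eta> v})"

text \<open>
  Since r is positive, the zero control takes values in no face.  Constant curves, which are
  normal with covector 0, therefore have to be excluded where this is claimed of normal curves.
\<close>

definition takes_values_in_face ::
  "'e::real_vector set \<Rightarrow> ('e \<Rightarrow> real) \<Rightarrow> real set \<Rightarrow> (real \<Rightarrow> 'e) \<Rightarrow> bool" where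
  "takes_values_in_face V \<nu> I u \<longleftrightarrow>
     (\<exists>r>0. \<exists>F. face_of_sphere V \<nu> r F \<and> (AE t in lebesgue_on I. u t \<in> F))"

section \<open>Sub-Finsler Lie groups\<close>

definition sub_finsler_lie_group ::
  "('g::{t2_space, second_countable_topology}, 'b) monoid_scheme \<Rightarrow>
   ('g, 'e::euclidean_space) chart set \<Rightarrow> 'e set \<Rightarrow> ('e \<Rightarrow> real) \<Rightarrow> bool" where
  "sub_finsler_lie_group G A V \<nu> \<longleftrightarrow>
     lie_group G A \<and> subspace V \<and> bracket_generating G A V \<and> norm_on V \<nu>"

definition abs_continuous_on :: "real \<Rightarrow> real \<Rightarrow> (real \<Rightarrow> 'a::real_normed_vector) \<Rightarrow> bool" where
  "abs_continuous_on c d f \<longleftrightarrow>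
     (\<forall>\<epsilon>>0. \<exists>\<delta>>0. \<forall>(n::nat) a b.
        (\<forall>i<n. c \<le> a i \<and> a i \<le> b i \<and> b i \<le> d) \<and>
        (\<forall>i<n. \<forall>j<n. i \<noteq> j \<longrightarrow> {a i<..<b i} \<inter> {a j<..<b j} = {}) \<and>
        (\<Sum>i<n. b i - a i) < \<delta> \<longrightarrow>
        (\<Sum>i<n. norm (f (b i) - f (a i))) < \<epsilon>)"

definition abs_continuous_curve ::
  "('m::topological_space, 'e::euclidean_space) chart set \<Rightarrow> real set \<Rightarrow> (real \<Rightarrow> 'm) \<Rightarrow> bool" where
  "abs_continuous_curve A I \<gamma> \<longleftrightarrow> continuous_on I \<gamma> \<and>
     (\<forall>\<phi>\<in>A. \<forall>c d. c \<le> d \<and> {c..d} \<subseteq> I \<and> \<gamma> ` {c..d} \<subseteq> fst \<phi> \<longrightarrow>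
        abs_continuous_on c d (snd \<phi> \<circ> \<gamma>))"

definition has_velocity ::
  "('m, 'e::euclidean_space) chart set \<Rightarrow> (real \<Rightarrow> 'm) \<Rightarrow> 'e \<Rightarrow> real \<Rightarrow> real set \<Rightarrow> bool" where
  "has_velocity A \<gamma> w t I \<longleftrightarrow>
     ((snd (chart_at A (\<gamma> t)) \<circ> \<gamma>) has_vector_derivative w) (at t within I)"

text \<open>
  The curve is horizontal on I with control u.  The control is only determined almost
  everywhere; u is any (Lebesgue measurable) representative of it.
\<close>

definition horizontal_curve ::
  "('g::topological_space, 'b) monoid_scheme \<Rightarrow> ('g, 'e::euclidean_space) chart set \<Rightarrow> 'e set \<Rightarrow>
   real set \<Rightarrow> (real \<Rightarrow> 'g) \<Rightarrow> (real \<Rightarrow> 'e) \<Rightarrow> bool" where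
  "horizontal_curve G A V I \<gamma> u \<longleftrightarrow>
     abs_continuous_curve A I \<gamma> \<and> u \<in> borel_measurable (lebesgue_on I) \<and>
     (AE t in lebesgue_on I. u t \<in> V \<and> has_velocity A \<gamma> (dL G A (\<gamma> t) (u t)) t I)"

definition has_speed :: "('e \<Rightarrow> real) \<Rightarrow> real set \<Rightarrow> (real \<Rightarrow> 'e) \<Rightarrow> real \<Rightarrow> bool" where
  "has_speed \<nu> I u r \<longleftrightarrow> (AE t in lebesgue_on I. \<nu> (u t) = r)"

text \<open>The distance is infinite if no horizontal curve joins the points (G need not be connected).\<close>

definition sf_dist ::
  "('g::topological_space, 'b) monoid_scheme \<Rightarrow> ('g, 'e::euclidean_space) chart set \<Rightarrow> 'e set \<Rightarrow>
   ('e \<Rightarrow> real) \<Rightarrow> 'g \<Rightarrow> 'g \<Rightarrow> ennreal" where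
  "sf_dist G A V \<nu> g h =
     Inf {\<integral>\<^sup>+ t. ennreal (\<nu> (u t)) \<partial>lebesgue_on {0..1} | \<gamma> u.
            horizontal_curve G A V {0..1} \<gamma> u \<and> \<gamma> 0 = g \<and> \<gamma> 1 = h}"

definition sf_cball ::
  "('g::topological_space, 'b) monoid_scheme \<Rightarrow> ('g, 'e::euclidean_space) chart set \<Rightarrow> 'e set \<Rightarrow>
   ('e \<Rightarrow> real) \<Rightarrow> 'g \<Rightarrow> real \<Rightarrow> 'g set" where
  "sf_cball G A V \<nu> g r = {h. sf_dist G A V \<nu> g h \<le> ennreal r}"

definition is_covector ::
  "('g::topological_space, 'b) monoid_scheme \<Rightarrow> ('g, 'e::euclidean_space) chart set \<Rightarrow> 'e set \<Rightarrow>
   ('e \<Rightarrow> real) \<Rightarrow> real set \<Rightarrow> (real \<Rightarrow> 'g) \<Rightarrow> (real \<Rightarrow> 'e) \<Rightarrow> ('e \<Rightarrow>\<^sub>L real) \<Rightarrow> bool" where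
  "is_covector G A V \<nu> I \<gamma> u \<xi> \<longleftrightarrow>
     (AE t in lebesgue_on I.
        (\<lambda>v. blinfun_apply \<xi> (Ad G A (\<gamma> t) v)) \<in> energy_subdifferential V \<nu> (u t))"

definition normal_curve ::
  "('g::topological_space, 'b) monoid_scheme \<Rightarrow> ('g, 'e::euclidean_space) chart set \<Rightarrow> 'e set \<Rightarrow>
   ('e \<Rightarrow> real) \<Rightarrow> real set \<Rightarrow> (real \<Rightarrow> 'g) \<Rightarrow> (real \<Rightarrow> 'e) \<Rightarrow> bool" where
  "normal_curve G A V \<nu> I \<gamma> u \<longleftrightarrow>
     horizontal_curve G A V I \<gamma> u \<and> integrable (lebesgue_on I) (\<lambda>t. (\<nu> (u t))\<^sup>2) \<and>
     (\<exists>\<xi>. is_covector G A V \<nu> I \<gamma> u \<xi>)"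

text \<open>
  The maximum M(r), written as a supremum (it is attained because closed balls are compact).
\<close>

definition M_bound ::
  "('g::topological_space, 'b) monoid_scheme \<Rightarrow> ('g, 'e::euclidean_space) chart set \<Rightarrow> 'e set \<Rightarrow>
   ('e \<Rightarrow> real) \<Rightarrow> ('e \<Rightarrow> real) \<Rightarrow> real \<Rightarrow> real" where
  "M_bound G A V \<nu> N r =
     Sup {N (Ad G A g (ad G A X Y)) | g X Y.
            g \<in> sf_cball G A V \<nu> \<one>\<^bsub>G\<^esub> r \<and> N X = 1 \<and> N Y = 1}"

definition interval_with_endpoints :: "real \<Rightarrow> real \<Rightarrow> real set \<Rightarrow> bool" where
  "interval_with_endpoints a b I \<longleftrightarrow> a \<le> b \<and> {a<..<b} \<subseteq> I \<and> I \<subseteq> {a..b}"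

end

theory Submission
  imports Defs
begin

text \<open>
  Let \<open>\<xi>\<close> be a covector of a normal curve \<open>\<gamma>\<close> with control \<open>u\<close>, and write
  \<open>\<eta>\<^sub>t Y = \<xi> (Ad\<^sub>\<gamma>\<^sub>t Y)\<close>.  For almost every \<open>t\<close> the control \<open>u t\<close> maximises \<open>\<eta>\<^sub>t\<close> on the sphere
  of radius \<open>r = \<nu> (u t)\<close>, so \<open>u t\<close> lies in the face exposed by \<open>\<eta>\<^sub>t\<close>.  The face can only
  change when \<open>\<eta>\<^sub>t\<close> moves, and \<open>\<eta>\<^sub>t Y\<close> has derivative \<open>\<xi> (Ad\<^sub>\<gamma>\<^sub>t [u t, Y])\<close>: on the ball of
  radius \<open>r\<close> this is at most a constant times \<open>N' \<xi> * M r * r\<close>.  A short time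
  interval therefore gives a small set of functionals, and it remains to find one face that serves
  for all of them.

  That is a statement about the unit ball, which has finitely many vertices
  (\<open>polyhedral_common_face_gap\<close>).  Call a vertex active for a functional if the functional is
  maximal there.  If a set of functionals of dual norm \<open>r\<close> varies by at most \<open>\<epsilon> r\<close> on the vertices,
  then all vertices that are active for some of them are almost active for each of them.  For any
  fixed set of vertices, compactness of the dual ball shows that a functional for which they are all
  almost active exists only if one exists for which they are all active; since there are finitely many
  sets of vertices, one \<open>\<epsilon>\<close> serves for all.  The face exposed by the functional so obtained contains
  all the controls.  Both \<open>\<epsilon> r\<close> and the bound on the derivative are proportional to \<open>r\<close>, which makes
  the length of the interval in the quantitative part depend on \<open>r\<close> through \<open>M r\<close> only.

  Three more facts enter.
  The derivative of \<open>\<eta>\<^sub>t\<close> rests on the differential of \<open>Ad\<close> at the identity being \<open>ad\<close>, where \<open>ad\<close>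
  is the bracket of left invariant fields (\<open>Ad_has_derivative_at_one\<close>); it comes from the symmetry
  of the second derivative of the multiplication.
  The supremum \<open>M r\<close> is finite: by Gronwall's inequality the operator \<open>Ad\<^sub>\<gamma>\<^sub>t\<close> is bounded in terms of the
  length of \<open>\<gamma>\<close> (\<open>Ad_bounded_on_sf_cball\<close>).
  In the first part, a positive radius common to all times is needed, that is,
  a normal curve has constant speed (\<open>normal_curve_constant_speed\<close>): the speed is the dual norm of \<open>\<eta>\<^sub>t\<close>,
  and the functions \<open>s \<mapsto> \<eta>\<^sub>s (u t)\<close>, which have derivative \<open>\<xi> (Ad\<^sub>\<gamma>\<^sub>t [u t, u t]) = 0\<close> at \<open>t\<close>, support it
  from below.
\<close>

section \<open>Absolutely continuous functions of a real variable\<close>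

lemma negligible_outer_open:
  fixes N :: "'a::euclidean_space set"
  assumes "negligible N" "e > 0"
  obtains T where "open T" "N \<subseteq> T" "T \<in> lmeasurable" "measure lebesgue T < e"
proof -
  have N: "N \<in> null_sets lebesgue"
    using assms(1) by (simp add: negligible_iff_null_sets)
  then obtain T where T: "open T" "N \<subseteq> T" "T - N \<in> lmeasurable" "emeasure lebesgue (T - N) < ennreal e"
    using sets_lebesgue_outer_open assms(2) by (metis null_setsD2)
  have eq: "T = (T - N) \<union> N" using T(2) by blast
  have "T \<in> lmeasurable"
    using T(3) N by (metis eq fmeasurable.Un fmeasurableI_null_sets)
  moreover have "emeasure lebesgue T = emeasure lebesgue (T - N)"
    using N T(3) by (metis eq emeasure_Un_null_set fmeasurableD)
  then have "measure lebesgue T = measure lebesgue (T - N)"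
    by (simp add: measure_def)
  moreover have "measure lebesgue (T - N) < e"
    using T(3,4) assms(2) by (simp add: emeasure_eq_measure2 ennreal_less_iff)
  ultimately show ?thesis using T that by auto
qed

lemma sum_length_disjoint_intervals_le:
  fixes l r :: "'i \<Rightarrow> real"
  assumes "finite I" "\<And>i. i \<in> I \<Longrightarrow> l i \<le> r i"
    and "disjoint_family_on (\<lambda>i. {l i<..<r i}) I"
    and "\<And>i. i \<in> I \<Longrightarrow> {l i<..<r i} \<subseteq> T" and "T \<in> lmeasurable"
  shows "(\<Sum>i\<in>I. r i - l i) \<le> measure lebesgue T"
proof -
  have "(\<Sum>i\<in>I. r i - l i) = (\<Sum>i\<in>I. measure lebesgue {l i<..<r i})"
    using assms(2) by (intro sum.cong) auto
  also have "\<dots> = measure lebesgue (\<Union>i\<in>I. {l i<..<r i})"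
    using assms(1,3) by (intro measure_finite_Union[symmetric]) (auto simp: emeasure_lborel_Ioo assms(2))
  also have "\<dots> \<le> measure lebesgue T"
    using assms(1,4,5) by (intro measure_mono_fmeasurable) auto
  finally show ?thesis .
qed

text \<open>
  Tagged divisions are sets of intervals, so the defining property is needed for families that are
  indexed by an arbitrary finite set.
\<close>

lemma abs_continuous_on_finite_family:
  assumes "abs_continuous_on a b f" "e > 0"
  obtains d where "d > 0"
    "\<And>(I::'i set) l r. \<lbrakk>finite I; \<And>i. i \<in> I \<Longrightarrow> a \<le> l i \<and> l i \<le> r i \<and> r i \<le> b;
        disjoint_family_on (\<lambda>i. {l i<..<r i}) I; (\<Sum>i\<in>I. r i - l i) < d\<rbrakk> \<Longrightarrow>
      (\<Sum>i\<in>I. norm (f (r i) - f (l i))) < e"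
proof -
  obtain d where d0: "d > 0" and d: "\<forall>(n::nat) l r.
        (\<forall>i<n. a \<le> l i \<and> l i \<le> r i \<and> r i \<le> b) \<and>
        (\<forall>i<n. \<forall>j<n. i \<noteq> j \<longrightarrow> {l i<..<r i} \<inter> {l j<..<r j} = {}) \<and>
        (\<Sum>i<n. r i - l i) < d \<longrightarrow>
        (\<Sum>i<n. norm (f (r i) - f (l i))) < e"
    using assms(1)[unfolded abs_continuous_on_def, THEN spec, THEN mp, OF assms(2)] by blast
  show thesis
  proof (rule that[OF d0])
    fix I :: "'i set" and l r
    assume I: "finite I" "\<And>i. i \<in> I \<Longrightarrow> a \<le> l i \<and> l i \<le> r i \<and> r i \<le> b"
      "disjoint_family_on (\<lambda>i. {l i<..<r i}) I" "(\<Sum>i\<in>I. r i - l i) < d"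
    obtain h where h: "bij_betw h {..<card I} I"
      using I(1) ex_bij_betw_nat_finite by (metis atLeast0LessThan)
    have mem: "h i \<in> I" if "i < card I" for i
      using h that by (auto dest: bij_betwE)
    have re: "(\<Sum>i\<in>I. F i) = (\<Sum>i<card I. F (h i))" for F :: "'i \<Rightarrow> real"
      using sum.reindex_bij_betw[OF h] by metis
    have "{l (h i)<..<r (h i)} \<inter> {l (h j)<..<r (h j)} = {}"
      if "i < card I" "j < card I" "i \<noteq> j" for i j
    proof -
      have "h i \<noteq> h j" using h that by (auto simp: bij_betw_def inj_on_def)
      then show ?thesis using I(3) mem that unfolding disjoint_family_on_def by blast
    qed
    moreover have "(\<Sum>i<card I. r (h i) - l (h i)) < d"
      using I(4) by (simp add: re)
    ultimately show "(\<Sum>i\<in>I. norm (f (r i) - f (l i))) < e"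
      unfolding re using d[THEN spec[of _ "card I"], THEN spec[of _ "\<lambda>i. l (h i)"],
          THEN spec[of _ "\<lambda>i. r (h i)"]] I(2) mem by simp
  qed
qed

text \<open>
  The fundamental theorem of calculus in the form of an inequality.  Take a tagged division that is
  fine for the integral of \<open>k\<close>, for the derivative of \<open>f\<close> at tags outside \<open>N\<close>, and for an open set of
  small measure around \<open>N\<close> at the other tags.  The increments over intervals with a tag outside \<open>N\<close>
  are bounded by a Riemann sum of \<open>k\<close>; the other intervals have small total length, and absolute
  continuity bounds the increments over them.
\<close>

lemma abs_continuous_increment_le_integral:
  fixes f :: "real \<Rightarrow> 'a::real_normed_vector" and k :: "real \<Rightarrow> real"
  assumes "a \<le> b" and ac: "abs_continuous_on a b f" and N: "negligible N"
    and k: "(k has_integral K) {a..b}" and k0: "\<And>t. t \<in> {a..b} \<Longrightarrow> 0 \<le> k t"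
    and der: "\<And>t. t \<in> {a..b} - N \<Longrightarrow> \<exists>w. (f has_vector_derivative w) (at t within {a..b}) \<and> norm w \<le> k t"
  shows "norm (f b - f a) \<le> K"
proof (rule field_le_epsilon)
  fix e0 :: real assume "e0 > 0"
  define e where "e = e0 / (b - a + 2)"
  have e: "e > 0" using \<open>e0 > 0\<close> \<open>a \<le> b\<close> by (simp add: e_def)
  obtain \<delta> where \<delta>: "\<delta> > 0"
    "\<And>(I::(real \<times> real set) set) l r. \<lbrakk>finite I; \<And>i. i \<in> I \<Longrightarrow> a \<le> l i \<and> l i \<le> r i \<and> r i \<le> b;
        disjoint_family_on (\<lambda>i. {l i<..<r i}) I; (\<Sum>i\<in>I. r i - l i) < \<delta>\<rbrakk> \<Longrightarrow>
      (\<Sum>i\<in>I. norm (f (r i) - f (l i))) < e"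
    by (rule abs_continuous_on_finite_family[OF ac e]) blast
  obtain T where T: "open T" "N \<subseteq> T" "T \<in> lmeasurable" "measure lebesgue T < \<delta>"
    using negligible_outer_open[OF N \<delta>(1)] by blast
  obtain g1 where g1: "gauge g1" "\<And>D. D tagged_division_of {a..b} \<Longrightarrow> g1 fine D \<Longrightarrow>
      norm ((\<Sum>(x,J)\<in>D. measure lborel J *\<^sub>R k x) - K) < e"
    using k e unfolding has_integral_real by metis
  have "\<exists>d>0. t \<in> {a..b} - N \<longrightarrow> (\<forall>y\<in>{a..b}. \<bar>y - t\<bar> < d \<longrightarrow> norm (f y - f t) \<le> (k t + e) * \<bar>y - t\<bar>)" for t
  proof (cases "t \<in> {a..b} - N")
    case True
    then obtain w where w: "(f has_vector_derivative w) (at t within {a..b})" "norm w \<le> k t"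
      using der by blast
    then obtain d where d: "d > 0" "\<And>y. y \<in> {a..b} \<Longrightarrow> norm (y - t) < d \<Longrightarrow>
        norm (f y - f t - (y - t) *\<^sub>R w) \<le> e * norm (y - t)"
      using e unfolding has_vector_derivative_def has_derivative_within_alt by blast
    have "norm (f y - f t) \<le> (k t + e) * \<bar>y - t\<bar>" if "y \<in> {a..b}" "\<bar>y - t\<bar> < d" for y
    proof -
      have "norm (f y - f t) \<le> norm (f y - f t - (y - t) *\<^sub>R w) + norm ((y - t) *\<^sub>R w)"
        by (metis diff_add_cancel norm_triangle_ineq)
      also have "\<dots> \<le> e * \<bar>y - t\<bar> + \<bar>y - t\<bar> * k t"
        using d(2)[of y] that w(2) by (simp add: add_mono mult_left_mono)
      finally show ?thesis by (simp add: algebra_simps)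
    qed
    then show ?thesis using d(1) by blast
  qed (use zero_less_one in blast)
  then obtain d where d: "\<And>t. d t > 0" "\<And>t y. t \<in> {a..b} - N \<Longrightarrow> y \<in> {a..b} \<Longrightarrow>
      \<bar>y - t\<bar> < d t \<Longrightarrow> norm (f y - f t) \<le> (k t + e) * \<bar>y - t\<bar>"
    by metis
  define g2 where "g2 t = (if t \<in> N then T else ball t (d t))" for t
  have "gauge g2"
    using T(1,2) d(1) by (auto simp: gauge_def g2_def)
  then have "gauge (\<lambda>t. g1 t \<inter> g2 t)" using g1(1) by blast
  then obtain D where D: "D tagged_division_of {a..b}" "(\<lambda>t. g1 t \<inter> g2 t) fine D"
    using fine_division_exists_real by blast
  then have fine: "g1 fine D" "g2 fine D" by (auto simp: fine_Int)
  have finD: "finite D" using D(1) by blast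
  have iv: "\<exists>u v. J = {u..v} \<and> u \<le> v \<and> Inf J = u \<and> Sup J = v \<and> measure lborel J = v - u \<and> t \<in> {u..v}
              \<and> a \<le> u \<and> v \<le> b"
    if "(t, J) \<in> D" for t J
  proof -
    have "t \<in> J" "J \<subseteq> {a..b}" and "\<exists>u v. J = cbox u v"
      using tagged_division_ofD[OF D(1)] that by blast+
    then obtain u v where J: "J = {u..v}" "u \<le> v" by fastforce
    then show ?thesis using \<open>J \<subseteq> {a..b}\<close> \<open>t \<in> J\<close> by auto
  qed
  define Bad where "Bad = {p \<in> D. fst p \<in> N}"
  define lo hi where "lo p = Inf (snd p)" and "hi p = Sup (snd p)" for p :: "real \<times> real set"
  have lohi: "a \<le> lo p \<and> lo p \<le> hi p \<and> hi p \<le> b \<and> {lo p<..<hi p} = interior (snd p)" if "p \<in> D" for p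
  proof -
    obtain u v where "snd p = {u..v}" "u \<le> v" "a \<le> u" "v \<le> b"
      using iv[of "fst p" "snd p"] \<open>p \<in> D\<close> by auto
    then show ?thesis by (simp add: lo_def hi_def)
  qed
  have disj: "disjoint_family_on (\<lambda>p. {lo p<..<hi p}) D"
    unfolding disjoint_family_on_def
  proof (intro ballI impI)
    fix p q assume "p \<in> D" "q \<in> D" "p \<noteq> q"
    then show "{lo p<..<hi p} \<inter> {lo q<..<hi q} = {}"
      using tagged_division_ofD(5)[OF D(1), of "fst p" "snd p" "fst q" "snd q"] lohi by auto
  qed
  \<comment> \<open>Intervals tagged in the null set have small total length, so absolute continuity
    controls the increments over them.\<close>
  have "(\<Sum>p\<in>Bad. norm (f (hi p) - f (lo p))) < e"
  proof (rule \<delta>(2))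
    show "finite Bad" using finD by (simp add: Bad_def)
    show "a \<le> lo p \<and> lo p \<le> hi p \<and> hi p \<le> b" if "p \<in> Bad" for p
      using lohi that by (auto simp: Bad_def)
    show dB: "disjoint_family_on (\<lambda>i. {lo i<..<hi i}) Bad"
      using disj by (rule disjoint_family_on_mono[rotated]) (auto simp: Bad_def)
    have "{lo p<..<hi p} \<subseteq> T" if "p \<in> Bad" for p
    proof -
      have p: "p \<in> D" "fst p \<in> N" using that by (auto simp: Bad_def)
      then have "snd p \<subseteq> g2 (fst p)"
        using fine(2) unfolding fine_def by (cases p) auto
      then have "interior (snd p) \<subseteq> T"
        using p(2) interior_subset[of "snd p"] by (simp add: g2_def)
      then show ?thesis using lohi[OF p(1)] by metis
    qed
    then have "(\<Sum>p\<in>Bad. hi p - lo p) \<le> measure lebesgue T"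
      using dB lohi finD T(3) by (intro sum_length_disjoint_intervals_le) (auto simp: Bad_def)
    then show "(\<Sum>p\<in>Bad. hi p - lo p) < \<delta>" using T(4) by simp
  qed
  moreover have good: "norm (f (hi p) - f (lo p)) \<le> measure lborel (snd p) * k (fst p) + e * (hi p - lo p)"
    if "p \<in> D - Bad" for p
  proof -
    obtain t J where p: "p = (t, J)" by force
    then have tJ: "(t, J) \<in> D" "t \<notin> N" using that by (auto simp: Bad_def)
    then obtain u v where uv: "J = {u..v}" "u \<le> v" "Inf J = u" "Sup J = v" "measure lborel J = v - u" "t \<in> {u..v}"
      "a \<le> u" "v \<le> b"
      using iv by blast
    have "J \<subseteq> ball t (d t)"
      using fine(2)[unfolded fine_def, rule_format, OF tJ(1)] tJ(2) by (simp add: g2_def)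
    then have "\<bar>u - t\<bar> < d t" "\<bar>v - t\<bar> < d t"
      using uv(1,2) by (auto simp: subset_iff dist_real_def abs_minus_commute)
    then have "norm (f u - f t) \<le> (k t + e) * (t - u)" "norm (f v - f t) \<le> (k t + e) * (v - t)"
      using d(2)[of t u] d(2)[of t v] uv tJ(2) by auto
    moreover have "norm (f v - f u) \<le> norm (f v - f t) + norm (f u - f t)"
      using norm_triangle_ineq4[of "f v - f t" "f u - f t"] by simp
    ultimately have "norm (f v - f u) \<le> (k t + e) * (v - u)"
      by (simp add: algebra_simps)
    then show ?thesis using uv p by (simp add: lo_def hi_def algebra_simps)
  qed
  have "(\<Sum>p\<in>D. hi p - lo p) = b - a"
    using additive_tagged_division_1[OF \<open>a \<le> b\<close> D(1), of "\<lambda>x. x"] by (simp add: lo_def hi_def case_prod_unfold)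
  have s1: "(\<Sum>p\<in>D - Bad. norm (f (hi p) - f (lo p))) \<le> (\<Sum>p\<in>D - Bad. measure lborel (snd p) * k (fst p) + e * (hi p - lo p))"
    by (intro sum_mono good)
  have s2: "(\<Sum>p\<in>D - Bad. measure lborel (snd p) * k (fst p) + e * (hi p - lo p))
      \<le> (\<Sum>p\<in>D. measure lborel (snd p) * k (fst p) + e * (hi p - lo p))"
  proof (intro sum_mono2 finD)
    fix p assume "p \<in> D - (D - Bad)"
    then have "p \<in> D" by auto
    then have "fst p \<in> {a..b}"
      using iv[of "fst p" "snd p"] by auto
    then show "0 \<le> measure lborel (snd p) * k (fst p) + e * (hi p - lo p)"
      using lohi[OF \<open>p \<in> D\<close>] k0 e by simp
  qed auto
  have s3: "(\<Sum>p\<in>D. measure lborel (snd p) * k (fst p) + e * (hi p - lo p))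
      = (\<Sum>(x,J)\<in>D. measure lborel J *\<^sub>R k x) + e * (b - a)"
    by (simp add: sum.distrib case_prod_unfold flip: sum_distrib_left \<open>(\<Sum>p\<in>D. hi p - lo p) = b - a\<close>)
  have "(\<Sum>(x,J)\<in>D. measure lborel J *\<^sub>R k x) < K + e"
    using g1(2)[OF D(1) fine(1)] unfolding real_norm_def by linarith
  with s1 s2 s3 have "(\<Sum>p\<in>D - Bad. norm (f (hi p) - f (lo p))) \<le> K + e + e * (b - a)"
    by linarith
  moreover have "(\<Sum>p\<in>D. norm (f (hi p) - f (lo p))) =
      (\<Sum>p\<in>D - Bad. norm (f (hi p) - f (lo p))) + (\<Sum>p\<in>Bad. norm (f (hi p) - f (lo p)))"
    using finD by (intro sum.subset_diff) (auto simp: Bad_def)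
  moreover have "norm (f b - f a) \<le> (\<Sum>p\<in>D. norm (f (hi p) - f (lo p)))"
    using additive_tagged_division_1[OF \<open>a \<le> b\<close> D(1), of f] norm_sum[of "\<lambda>p. f (hi p) - f (lo p)" D]
    by (simp add: lo_def hi_def case_prod_unfold)
  ultimately have "norm (f b - f a) \<le> K + e * (b - a + 2)"
    by (simp add: algebra_simps)
  then show "norm (f b - f a) \<le> K + e0" using \<open>a \<le> b\<close> by (simp add: e_def)
qed

text \<open>
  Curves in a manifold are absolutely continuous in charts, hence on short intervals.
\<close>

definition locally_abs_continuous_on :: "real \<Rightarrow> real \<Rightarrow> (real \<Rightarrow> 'a::real_normed_vector) \<Rightarrow> bool" where
  "locally_abs_continuous_on a b f \<longleftrightarrow> (\<forall>t\<in>{a..b}. \<exists>d>0. \<forall>x y.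
     a \<le> x \<and> x \<le> t \<and> t \<le> y \<and> y \<le> b \<and> y - x < d \<longrightarrow> abs_continuous_on x y f)"

text \<open>
  Covers both a change of the function, where \<open>m\<close> is the identity, and a curve that stops at
  a time \<open>\<tau>\<close>, where \<open>m t = min t \<tau>\<close>.
\<close>

lemma abs_continuous_on_transfer:
  assumes "abs_continuous_on a b f" "L \<ge> 0"
    and m: "\<And>s t. \<lbrakk>c \<le> s; s \<le> t; t \<le> d\<rbrakk> \<Longrightarrow> a \<le> m s \<and> m s \<le> m t \<and> m t \<le> b \<and> m t - m s \<le> t - s"
    and le: "\<And>s t. \<lbrakk>c \<le> s; s \<le> t; t \<le> d\<rbrakk> \<Longrightarrow> norm (h t - h s) \<le> L * norm (f (m t) - f (m s))"
  shows "abs_continuous_on c d h"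
  unfolding abs_continuous_on_def
proof (intro allI impI)
  fix \<epsilon> :: real assume "\<epsilon> > 0"
  then have "\<epsilon> / (L + 1) > 0" using \<open>L \<ge> 0\<close> by simp
  then obtain \<delta> where \<delta>: "\<delta> > 0" "\<forall>(n::nat) l r.
        (\<forall>i<n. a \<le> l i \<and> l i \<le> r i \<and> r i \<le> b) \<and>
        (\<forall>i<n. \<forall>j<n. i \<noteq> j \<longrightarrow> {l i<..<r i} \<inter> {l j<..<r j} = {}) \<and>
        (\<Sum>i<n. r i - l i) < \<delta> \<longrightarrow>
        (\<Sum>i<n. norm (f (r i) - f (l i))) < \<epsilon> / (L + 1)"
    using assms(1)[unfolded abs_continuous_on_def, THEN spec, THEN mp] by blast
  show "\<exists>\<delta>>0. \<forall>(n::nat) l r.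
        (\<forall>i<n. c \<le> l i \<and> l i \<le> r i \<and> r i \<le> d) \<and>
        (\<forall>i<n. \<forall>j<n. i \<noteq> j \<longrightarrow> {l i<..<r i} \<inter> {l j<..<r j} = {}) \<and>
        (\<Sum>i<n. r i - l i) < \<delta> \<longrightarrow>
        (\<Sum>i<n. norm (h (r i) - h (l i))) < \<epsilon>"
  proof (intro exI conjI allI impI, rule \<delta>(1), elim conjE)
    fix n :: nat and l r
    assume lr: "\<forall>i<n. c \<le> l i \<and> l i \<le> r i \<and> r i \<le> d"
      and dis: "\<forall>i<n. \<forall>j<n. i \<noteq> j \<longrightarrow> {l i<..<r i} \<inter> {l j<..<r j} = {}" and len: "(\<Sum>i<n. r i - l i) < \<delta>"
    have 1: "\<forall>i<n. a \<le> m (l i) \<and> m (l i) \<le> m (r i) \<and> m (r i) \<le> b"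
      using lr m by blast
    have 2: "{m (l i)<..<m (r i)} \<inter> {m (l j)<..<m (r j)} = {}" if ij: "i < n" "j < n" "i \<noteq> j" for i j
    proof -
      have "{l i<..<r i} \<inter> {l j<..<r j} = {}" using dis ij by blast
      then have "min (r i) (r j) \<le> max (l i) (l j)"
        unfolding Int_greaterThanLessThan by simp
      then consider "l i = r i" | "l j = r j" | "r i \<le> l j" | "r j \<le> l i"
        using lr ij by (fastforce simp: min_def max_def split: if_splits)
      then show ?thesis
      proof cases
        case 3
        then have "m (r i) \<le> m (l j)" using lr ij m[of "r i" "l j"] by force
        then show ?thesis by auto
      next
        case 4
        then have "m (r j) \<le> m (l i)" using lr ij m[of "r j" "l i"] by force
        then show ?thesis by auto
      qed auto
    qed
    have "(\<Sum>i<n. m (r i) - m (l i)) \<le> (\<Sum>i<n. r i - l i)"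
      using lr m by (intro sum_mono) blast
    then have 3: "(\<Sum>i<n. m (r i) - m (l i)) < \<delta>" using len by simp
    define S where "S = (\<Sum>i<n. norm (f (m (r i)) - f (m (l i))))"
    have S: "S < \<epsilon> / (L + 1)"
      unfolding S_def using 1 2 3
      by (intro \<delta>(2)[THEN spec[of _ n], THEN spec[of _ "\<lambda>i. m (l i)"], THEN spec[of _ "\<lambda>i. m (r i)"], THEN mp]) simp
    have "S \<ge> 0" unfolding S_def by (intro sum_nonneg) auto
    have "(\<Sum>i<n. norm (h (r i) - h (l i))) \<le> (\<Sum>i<n. L * norm (f (m (r i)) - f (m (l i))))"
      using lr le by (intro sum_mono) auto
    also have "\<dots> = L * S" by (simp add: S_def sum_distrib_left)
    also have "\<dots> \<le> (L + 1) * S" using \<open>S \<ge> 0\<close> by (simp add: algebra_simps)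
    also have "\<dots> < \<epsilon>" using S \<open>L \<ge> 0\<close> by (simp add: field_simps)
    finally show "(\<Sum>i<n. norm (h (r i) - h (l i))) < \<epsilon>" .
  qed
qed

lemma abs_continuous_on_comparison:
  assumes "abs_continuous_on a b f" "L \<ge> 0"
    and "\<And>s t. a \<le> s \<Longrightarrow> s \<le> t \<Longrightarrow> t \<le> b \<Longrightarrow> norm (h t - h s) \<le> L * norm (f t - f s)"
  shows "abs_continuous_on a b h"
  by (rule abs_continuous_on_transfer[OF assms(1,2), where m = "\<lambda>t. t"]) (use assms(3) in auto)

lemma abs_continuous_on_stopped:
  assumes "abs_continuous_on (min c t) (min d t) g"
  shows "abs_continuous_on c d (\<lambda>s. g (min s t))"
  by (rule abs_continuous_on_transfer[OF assms, where L = 1 and m = "\<lambda>s. min s t"]) (auto simp: min_def)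

lemma abs_continuous_on_add:
  assumes "abs_continuous_on a b f" "abs_continuous_on a b g"
  shows "abs_continuous_on a b (\<lambda>t. f t + g t)"
  unfolding abs_continuous_on_def
proof (intro allI impI)
  fix \<epsilon> :: real assume "\<epsilon> > 0"
  then have e2: "\<epsilon> / 2 > 0" by simp
  obtain \<delta>1 where \<delta>1: "\<delta>1 > 0" "\<forall>(n::nat) l r.
        (\<forall>i<n. a \<le> l i \<and> l i \<le> r i \<and> r i \<le> b) \<and>
        (\<forall>i<n. \<forall>j<n. i \<noteq> j \<longrightarrow> {l i<..<r i} \<inter> {l j<..<r j} = {}) \<and>
        (\<Sum>i<n. r i - l i) < \<delta>1 \<longrightarrow>
        (\<Sum>i<n. norm (f (r i) - f (l i))) < \<epsilon> / 2"
    using assms(1)[unfolded abs_continuous_on_def, THEN spec, THEN mp, OF e2] by blast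
  obtain \<delta>2 where \<delta>2: "\<delta>2 > 0" "\<forall>(n::nat) l r.
        (\<forall>i<n. a \<le> l i \<and> l i \<le> r i \<and> r i \<le> b) \<and>
        (\<forall>i<n. \<forall>j<n. i \<noteq> j \<longrightarrow> {l i<..<r i} \<inter> {l j<..<r j} = {}) \<and>
        (\<Sum>i<n. r i - l i) < \<delta>2 \<longrightarrow>
        (\<Sum>i<n. norm (g (r i) - g (l i))) < \<epsilon> / 2"
    using assms(2)[unfolded abs_continuous_on_def, THEN spec, THEN mp, OF e2] by blast
  have d: "min \<delta>1 \<delta>2 > 0" using \<delta>1(1) \<delta>2(1) by simp
  show "\<exists>\<delta>>0. \<forall>(n::nat) l r.
        (\<forall>i<n. a \<le> l i \<and> l i \<le> r i \<and> r i \<le> b) \<and>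
        (\<forall>i<n. \<forall>j<n. i \<noteq> j \<longrightarrow> {l i<..<r i} \<inter> {l j<..<r j} = {}) \<and>
        (\<Sum>i<n. r i - l i) < \<delta> \<longrightarrow>
        (\<Sum>i<n. norm (f (r i) + g (r i) - (f (l i) + g (l i)))) < \<epsilon>"
  proof (intro exI conjI allI impI, rule d, elim conjE)
    fix n :: nat and l r
    assume lr: "\<forall>i<n. a \<le> l i \<and> l i \<le> r i \<and> r i \<le> b"
      and h: "\<forall>i<n. \<forall>j<n. i \<noteq> j \<longrightarrow> {l i<..<r i} \<inter> {l j<..<r j} = {}" "(\<Sum>i<n. r i - l i) < min \<delta>1 \<delta>2"
    have h2: "(\<Sum>i<n. r i - l i) < \<delta>1" "(\<Sum>i<n. r i - l i) < \<delta>2" using h(2) by auto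
    have "(\<Sum>i<n. norm (f (r i) - f (l i))) < \<epsilon> / 2" "(\<Sum>i<n. norm (g (r i) - g (l i))) < \<epsilon> / 2"
      using \<delta>1(2) \<delta>2(2) lr h(1) h2 by blast+
    moreover have "(\<Sum>i<n. norm (f (r i) + g (r i) - (f (l i) + g (l i))))
       \<le> (\<Sum>i<n. norm (f (r i) - f (l i)) + norm (g (r i) - g (l i)))"
      by (intro sum_mono) (simp add: norm_diff_triangle_ineq)
    ultimately show "(\<Sum>i<n. norm (f (r i) + g (r i) - (f (l i) + g (l i)))) < \<epsilon>"
      by (simp add: sum.distrib)
  qed
qed

lemma abs_continuous_on_const: "abs_continuous_on a b (\<lambda>t. w)"
  unfolding abs_continuous_on_def by (auto intro: exI[of _ 1])

lemma abs_continuous_on_imp_continuous_on: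
  assumes "abs_continuous_on a b f"
  shows "continuous_on {a..b} f"
  unfolding continuous_on_iff
proof (intro ballI allI impI)
  fix t \<epsilon> :: real assume t: "t \<in> {a..b}" and "\<epsilon> > 0"
  obtain d where d: "d > 0"
    "\<And>(I::unit set) l r. \<lbrakk>finite I; \<And>i. i \<in> I \<Longrightarrow> a \<le> l i \<and> l i \<le> r i \<and> r i \<le> b;
        disjoint_family_on (\<lambda>i. {l i<..<r i}) I; (\<Sum>i\<in>I. r i - l i) < d\<rbrakk> \<Longrightarrow>
      (\<Sum>i\<in>I. norm (f (r i) - f (l i))) < \<epsilon>"
    by (rule abs_continuous_on_finite_family[OF assms \<open>\<epsilon> > 0\<close>]) blast
  have "dist (f s) (f t) < \<epsilon>" if "s \<in> {a..b}" "dist s t < d" for s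
  proof -
    have "norm (f (max s t) - f (min s t)) < \<epsilon>"
      using d(2)[of "{()}" "\<lambda>_. min s t" "\<lambda>_. max s t"] that t
      by (auto simp: dist_real_def disjoint_family_on_def)
    then show ?thesis
      by (cases "s \<le> t") (auto simp: dist_norm norm_minus_commute)
  qed
  then show "\<exists>d>0. \<forall>s\<in>{a..b}. dist s t < d \<longrightarrow> dist (f s) (f t) < \<epsilon>" using d(1) by blast
qed

lemma locally_abs_continuous_on_add:
  assumes "locally_abs_continuous_on a b f" "locally_abs_continuous_on a b g"
  shows "locally_abs_continuous_on a b (\<lambda>t. f t + g t)"
  unfolding locally_abs_continuous_on_def
proof
  fix t assume t: "t \<in> {a..b}"
  obtain d where d: "d > 0" "\<And>x y. a \<le> x \<and> x \<le> t \<and> t \<le> y \<and> y \<le> b \<and> y - x < d \<Longrightarrow> abs_continuous_on x y f"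
    using assms(1) t unfolding locally_abs_continuous_on_def by blast
  obtain d' where d': "d' > 0" "\<And>x y. a \<le> x \<and> x \<le> t \<and> t \<le> y \<and> y \<le> b \<and> y - x < d' \<Longrightarrow> abs_continuous_on x y g"
    using assms(2) t unfolding locally_abs_continuous_on_def by blast
  show "\<exists>d>0. \<forall>x y. a \<le> x \<and> x \<le> t \<and> t \<le> y \<and> y \<le> b \<and> y - x < d \<longrightarrow> abs_continuous_on x y (\<lambda>t. f t + g t)"
    using d d' by (intro exI[of _ "min d d'"]) (auto intro: abs_continuous_on_add)
qed

lemma locally_abs_continuous_on_sum:
  assumes "finite I" "\<And>i. i \<in> I \<Longrightarrow> locally_abs_continuous_on a b (f i)"
  shows "locally_abs_continuous_on a b (\<lambda>t. \<Sum>i\<in>I. f i t)"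
  using assms
proof (induction I rule: finite_induct)
  case empty
  then show ?case
    by (auto simp: locally_abs_continuous_on_def abs_continuous_on_const intro!: exI[of _ 1])
next
  case (insert i I)
  then show ?case by (simp add: locally_abs_continuous_on_add)
qed

lemma locally_abs_continuous_on_comparison:
  assumes "locally_abs_continuous_on a b f" "L \<ge> 0"
    and le: "\<And>s t. a \<le> s \<Longrightarrow> s \<le> t \<Longrightarrow> t \<le> b \<Longrightarrow> norm (h t - h s) \<le> L * norm (f t - f s)"
  shows "locally_abs_continuous_on a b h"
  unfolding locally_abs_continuous_on_def
proof
  fix t assume t: "t \<in> {a..b}"
  obtain d where d: "d > 0" "\<And>x y. a \<le> x \<and> x \<le> t \<and> t \<le> y \<and> y \<le> b \<and> y - x < d \<Longrightarrow> abs_continuous_on x y f"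
    using assms(1) t unfolding locally_abs_continuous_on_def by blast
  show "\<exists>d>0. \<forall>x y. a \<le> x \<and> x \<le> t \<and> t \<le> y \<and> y \<le> b \<and> y - x < d \<longrightarrow> abs_continuous_on x y h"
    using d le by (intro exI[of _ d]) (auto intro!: abs_continuous_on_comparison[OF d(2) \<open>L \<ge> 0\<close>])
qed

lemma locally_abs_continuous_on_imp_continuous_on:
  assumes "locally_abs_continuous_on a b f"
  shows "continuous_on {a..b} f"
  unfolding continuous_on_eq_continuous_within
proof
  fix t assume t: "t \<in> {a..b}"
  then obtain d where d: "d > 0" "\<And>x y. a \<le> x \<and> x \<le> t \<and> t \<le> y \<and> y \<le> b \<and> y - x < d \<Longrightarrow> abs_continuous_on x y f"
    using assms unfolding locally_abs_continuous_on_def by blast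
  define x y where "x = max a (t - d/3)" and "y = min b (t + d/3)"
  have "abs_continuous_on x y f"
    using d t by (intro d(2)) (auto simp: x_def y_def)
  then have "continuous (at t within {x..y}) f"
    using abs_continuous_on_imp_continuous_on[of x y f] t d(1)
    unfolding continuous_on_eq_continuous_within by (simp add: x_def y_def)
  moreover have "at t within {x..y} = at t within {a..b}"
    using t d(1) by (intro at_within_nhd[of t "{t - d/3<..<t + d/3}"]) (auto simp: x_def y_def)
  ultimately show "continuous (at t within {a..b}) f" by simp
qed

text \<open>
  The bound is additive when intervals are joined, so it holds globally once it holds on short
  intervals around every point.
\<close>

lemma increment_le_integral:
  fixes f :: "real \<Rightarrow> 'a::real_normed_vector" and k :: "real \<Rightarrow> real"
  assumes ac: "locally_abs_continuous_on a b f" and N: "negligible N"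
    and k: "k integrable_on {a..b}" and k0: "\<And>t. t \<in> {a..b} \<Longrightarrow> 0 \<le> k t"
    and der: "\<And>t. t \<in> {a..b} - N \<Longrightarrow> \<exists>w. (f has_vector_derivative w) (at t within {a..b}) \<and> norm w \<le> k t"
    and st: "a \<le> s" "s \<le> t" "t \<le> b"
  shows "norm (f t - f s) \<le> integral {s..t} k"
proof -
  have ki: "k integrable_on {x..y}" if "a \<le> x" "y \<le> b" for x y
    using k that by (auto intro: integrable_on_subinterval)
  have "a \<le> s \<longrightarrow> t \<le> b \<longrightarrow> s \<le> t \<longrightarrow> norm (f t - f s) \<le> integral {s..t} k"
    using st(2)
  proof (induction rule: Bolzano)
    case (trans x y z)
    show ?case
    proof (intro impI)
      assume h: "a \<le> x" "z \<le> b" "x \<le> z"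
      have "norm (f z - f x) \<le> norm (f z - f y) + norm (f y - f x)"
        using norm_triangle_ineq[of "f z - f y" "f y - f x"] by simp
      also have "\<dots> \<le> integral {y..z} k + integral {x..y} k"
        using trans h by (intro add_mono) auto
      also have "\<dots> = integral {x..z} k"
        using Henstock_Kurzweil_Integration.integral_combine[OF trans(3,4) ki[OF h(1,2)]] by simp
      finally show "norm (f z - f x) \<le> integral {x..z} k" .
    qed
  next
    case (local c)
    then have "c \<in> {a..b}" using st by auto
    then obtain d where d: "d > 0" "\<And>x y. a \<le> x \<and> x \<le> c \<and> c \<le> y \<and> y \<le> b \<and> y - x < d \<Longrightarrow> abs_continuous_on x y f"
      using ac unfolding locally_abs_continuous_on_def by blast
    have "norm (f y - f x) \<le> integral {x..y} k"
      if "x \<le> c" "c \<le> y" "y - x < d" "a \<le> x" "y \<le> b" "x \<le> y" for x y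
    proof (rule abs_continuous_increment_le_integral[OF that(6) _ N])
      show "abs_continuous_on x y f" using d that by blast
      show "(k has_integral integral {x..y} k) {x..y}"
        using ki that by (simp add: integrable_integral)
      fix t assume t: "t \<in> {x..y} - N"
      then obtain w where "(f has_vector_derivative w) (at t within {a..b})" "norm w \<le> k t"
        using der[of t] \<open>a \<le> x\<close> \<open>y \<le> b\<close> by auto
      then show "\<exists>w. (f has_vector_derivative w) (at t within {x..y}) \<and> norm w \<le> k t"
        using \<open>a \<le> x\<close> \<open>y \<le> b\<close> by (meson atLeastatMost_subset_iff has_vector_derivative_within_subset)
    qed (use k0 that in auto)
    then show ?case using d(1) by (intro exI[of _ d]) auto
  qed
  then show ?thesis using st by blast
qed

corollary increment_le_const:
  fixes f :: "real \<Rightarrow> 'a::real_normed_vector"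
  assumes ac: "locally_abs_continuous_on a b f" and N: "negligible N" and "0 \<le> C"
    and der: "\<And>t. t \<in> {a..b} - N \<Longrightarrow> \<exists>w. (f has_vector_derivative w) (at t within {a..b}) \<and> norm w \<le> C"
    and st: "a \<le> s" "s \<le> t" "t \<le> b"
  shows "norm (f t - f s) \<le> C * (t - s)"
  using increment_le_integral[OF ac N _ _ der st] assms(3) st by (simp add: integrable_const_ivl mult.commute)

text \<open>
  The function \<open>ln (1 + F)\<close> has a derivative bounded by \<open>k\<close>.  The summand 1 keeps the logarithm
  1-Lipschitz where \<open>F\<close> is small or vanishes.
\<close>

lemma gronwall_abs_continuous:
  fixes F :: "real \<Rightarrow> real"
  assumes "a \<le> b" and ac: "locally_abs_continuous_on a b F" and N: "negligible N"
    and k: "k integrable_on {a..b}" and k0: "\<And>t. t \<in> {a..b} \<Longrightarrow> 0 \<le> k t"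
    and F0: "\<And>t. t \<in> {a..b} \<Longrightarrow> 0 \<le> F t"
    and der: "\<And>t. t \<in> {a..b} - N \<Longrightarrow> \<exists>w. (F has_vector_derivative w) (at t within {a..b}) \<and> \<bar>w\<bar> \<le> k t * F t"
  shows "1 + F b \<le> (1 + F a) * exp (integral {a..b} k)"
proof -
  have lip: "\<bar>ln (1 + y) - ln (1 + x)\<bar> \<le> 1 * \<bar>y - x\<bar>" if "0 \<le> x" "0 \<le> y" for x y :: real
  proof -
    have *: "ln (1 + y) - ln (1 + x) \<le> y - x" if "0 \<le> x" "x \<le> y" for x y :: real
    proof -
      have "ln (1 + y) - ln (1 + x) = ln ((1 + y) / (1 + x))" using that by (simp add: ln_div)
      also have "\<dots> \<le> (1 + y) / (1 + x) - 1" using that by (intro ln_le_minus_one) simp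
      also have "\<dots> = (y - x) / (1 + x)" using that by (simp add: field_simps)
      also have "\<dots> \<le> (y - x) / 1" using that by (intro divide_left_mono) auto
      also have "\<dots> = y - x" by simp
      finally show ?thesis .
    qed
    show ?thesis
    proof (cases "x \<le> y")
      case True then show ?thesis using *[of x y] that by simp
    next
      case False then show ?thesis using *[of y x] that by simp
    qed
  qed
  have "norm (ln (1 + F b) - ln (1 + F a)) \<le> integral {a..b} k"
  proof (rule increment_le_integral[OF _ N k k0])
    show "locally_abs_continuous_on a b (\<lambda>t. ln (1 + F t))"
      using lip F0 by (intro locally_abs_continuous_on_comparison[OF ac, of 1]) auto
    fix t assume t: "t \<in> {a..b} - N"
    then obtain w where w: "(F has_vector_derivative w) (at t within {a..b})" "\<bar>w\<bar> \<le> k t * F t"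
      using der by blast
    have Ft: "F t \<ge> 0" "k t \<ge> 0" using F0 k0 t by auto
    have "((\<lambda>t. ln (1 + F t)) has_vector_derivative w / (1 + F t)) (at t within {a..b})"
      using w(1) Ft unfolding has_real_derivative_iff_has_vector_derivative[symmetric]
      by (auto intro!: derivative_eq_intros)
    moreover have "\<bar>w\<bar> \<le> k t * (1 + F t)" using w(2) Ft by (simp add: algebra_simps)
    then have "norm (w / (1 + F t)) \<le> k t" using Ft by (simp add: divide_le_eq)
    ultimately show "\<exists>w. ((\<lambda>t. ln (1 + F t)) has_vector_derivative w) (at t within {a..b}) \<and> norm w \<le> k t"
      by blast
  qed (use \<open>a \<le> b\<close> in auto)
  then have "ln (1 + F b) \<le> ln (1 + F a) + integral {a..b} k" by simp
  then have "exp (ln (1 + F b)) \<le> exp (ln (1 + F a) + integral {a..b} k)" by simp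
  then show ?thesis using F0[of a] F0[of b] \<open>a \<le> b\<close> by (simp add: exp_add)
qed

text \<open>
  Cover \<open>N\<close> by an open set \<open>T\<close> of measure less than \<open>e\<close>, and add to \<open>h t\<close> the terms \<open>e * (t - a)\<close> and
  \<open>L\<close> times the measure of the part of \<open>T\<close> before \<open>t\<close>.  The first term makes up for the error \<open>e\<close> at
  points outside \<open>N\<close>, the second one grows with slope \<open>L\<close> near points of \<open>N\<close> and so outweighs any decrease
  of \<open>h\<close>.  For the resulting continuous function \<open>G\<close>, every \<open>t < b\<close> has a later point with a value that is at
  least as large, which forces \<open>G a \<le> G b\<close>.
\<close>

lemma lipschitz_mono_if_dini_nonneg:
  fixes h :: "real \<Rightarrow> real"
  assumes "a \<le> b" and lip: "L-lipschitz_on {a..b} h" and N: "negligible N"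
    and dini: "\<And>t e. \<lbrakk>t \<in> {a..<b} - N; e > 0\<rbrakk> \<Longrightarrow>
        \<exists>d>0. \<forall>s. t < s \<and> s < t + d \<and> s \<le> b \<longrightarrow> h t - e * (s - t) \<le> h s"
  shows "h a \<le> h b"
proof (rule field_le_epsilon)
  fix e0 :: real assume "e0 > 0"
  have L0: "L \<ge> 0" using lip lipschitz_on_nonneg by blast
  define e where "e = e0 / (b - a + L + 1)"
  have e: "e > 0" using \<open>e0 > 0\<close> \<open>a \<le> b\<close> L0 by (simp add: e_def)
  obtain T where T: "open T" "N \<subseteq> T" "T \<in> lmeasurable" "measure lebesgue T < e"
    using negligible_outer_open[OF N e] by blast
  define g where "g t = measure lebesgue (T \<inter> {a..t})" for t
  have g_add: "g s = g t + measure lebesgue (T \<inter> {t<..s})" if "a \<le> t" "t \<le> s" for s t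
  proof -
    have "T \<inter> {a..s} = (T \<inter> {a..t}) \<union> (T \<inter> {t<..s})" using that by auto
    moreover have A: "T \<inter> {a..t} \<in> lmeasurable" and B: "T \<inter> {t<..s} \<in> lmeasurable"
      using T(3) by (auto intro: fmeasurable_Int_fmeasurable)
    have "measure lebesgue ((T \<inter> {a..t}) \<union> (T \<inter> {t<..s})) = measure lebesgue (T \<inter> {a..t}) + measure lebesgue (T \<inter> {t<..s})"
      by (rule measure_Union[unfolded infinity_ennreal_def, OF fmeasurableD2[OF A] fmeasurableD2[OF B] fmeasurableD[OF A] fmeasurableD[OF B]]) auto
    ultimately show ?thesis unfolding g_def by simp
  qed
  have g_le: "measure lebesgue (T \<inter> {t<..s}) \<le> s - t" if "t \<le> s" for s t
  proof -
    have "measure lebesgue (T \<inter> {t<..s}) \<le> measure lebesgue {t<..s}"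
      using T(3) by (intro measure_mono_fmeasurable bounded_set_imp_lmeasurable)
        (auto intro: bounded_subset[of "{t..s}"] fmeasurableD)
    then show ?thesis using that by simp
  qed
  have g_cont: "continuous_on {a..b} g"
  proof (rule lipschitz_on_continuous_on[of 1], rule lipschitz_onI)
    have "\<bar>g s - g t\<bar> \<le> s - t" if "a \<le> t" "t \<le> s" for s t
      using g_add[OF that] g_le[OF that(2)] by simp
    then show "dist (g x) (g y) \<le> 1 * dist x y" if "x \<in> {a..b}" "y \<in> {a..b}" for x y
      using that by (cases "x \<le> y") (force simp: dist_real_def)+
  qed simp
  define G where "G t = h t + e * (t - a) + L * g t" for t
  have G_cont: "continuous_on {a..b} G"
    unfolding G_def by (intro continuous_intros g_cont lipschitz_on_continuous_on[OF lip])
  have step: "\<exists>s. t < s \<and> s \<le> b \<and> G t \<le> G s" if t: "t \<in> {a..<b}" for t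
  proof (cases "t \<in> N")
    case True
    then obtain d where d: "d > 0" "ball t d \<subseteq> T" using T(1,2) by (meson openE subsetD)
    define s where "s = min b (t + d/2)"
    have s: "t < s" "s \<le> b" using t d by (auto simp: s_def)
    have "T \<inter> {t<..s} = {t<..s}"
      using d by (auto simp: s_def subset_iff dist_real_def)
    then have "g s = g t + (s - t)" using g_add[of t s] t s by simp
    moreover have "\<bar>h s - h t\<bar> \<le> L * (s - t)"
      using lipschitz_onD[OF lip, of s t] s t by (auto simp: dist_real_def)
    moreover have "e * (t - a) \<le> e * (s - a)" using s e by simp
    ultimately have "G t \<le> G s" unfolding G_def by (simp add: distrib_left)
    then show ?thesis using s by blast
  next
    case False
    then obtain d where d: "d > 0" "\<forall>s. t < s \<and> s < t + d \<and> s \<le> b \<longrightarrow> h t - e * (s - t) \<le> h s"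
      using dini[of t e] t e by auto
    define s where "s = min b (t + d/2)"
    have s: "t < s" "s \<le> b" "s < t + d" using t d by (auto simp: s_def)
    have "L * g t \<le> L * g s"
      using g_add[of t s] s t L0 by (intro mult_left_mono) auto
    moreover have "h t - e * (s - t) \<le> h s" using d s by blast
    ultimately have "G t \<le> G s" unfolding G_def by (simp add: algebra_simps)
    then show ?thesis using s by blast
  qed
  define S where "S = {t \<in> {a..b}. G a \<le> G t}"
  have "closed S"
    using continuous_closed_preimage[OF G_cont, of "{G a..}"] by (simp add: S_def vimage_def Int_def)
  have "a \<in> S" "bdd_above S" using \<open>a \<le> b\<close> by (auto simp: S_def intro: bdd_aboveI[of _ b])
  then have c: "Sup S \<in> S" using \<open>closed S\<close> by (intro closed_contains_Sup) auto
  have "Sup S = b"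
  proof (rule ccontr)
    assume "Sup S \<noteq> b"
    then have "Sup S \<in> {a..<b}" using c by (auto simp: S_def)
    then obtain s where s: "Sup S < s" "s \<le> b" "G (Sup S) \<le> G s" using step by blast
    then have "s \<in> S" using c by (auto simp: S_def)
    then show False using s(1) cSup_upper[OF _ \<open>bdd_above S\<close>] by fastforce
  qed
  then have "G a \<le> G b" using c by (simp add: S_def)
  moreover have "g a = 0" unfolding g_def
    by (rule measure_eq_0_null_sets) (auto simp: negligible_iff_null_sets[symmetric] intro: negligible_subset[of "{a}"])
  moreover have "g b \<le> e"
  proof -
    have "g b \<le> measure lebesgue T"
      unfolding g_def using T(3) by (intro measure_mono_fmeasurable) (auto simp: fmeasurableD)
    then show ?thesis using T(4) by simp
  qed
  then have "L * g b \<le> L * e" using L0 by (intro mult_left_mono)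
  ultimately have "h a \<le> h b + e * (b - a) + L * e" unfolding G_def by simp
  also have "\<dots> \<le> h b + e * (b - a + L + 1)" using e by (simp add: algebra_simps)
  also have "\<dots> = h b + e0" using \<open>a \<le> b\<close> L0 by (simp add: e_def)
  finally show "h a \<le> h b + e0" .
qed

text \<open>
  The condition says that \<open>h\<close> has, to first order, a local minimum at almost every point.  It is
  invariant under reflection, so monotonicity follows in both directions.  This suits a maximum of
  functions one of which has a critical point where it attains the maximum, since the maximum
  itself need not be differentiable there.
\<close>

lemma lipschitz_constant_if_almost_minimal:
  fixes h :: "real \<Rightarrow> real"
  assumes lip: "L-lipschitz_on {a..b} h" and N: "negligible N"
    and dini: "\<And>t e. \<lbrakk>t \<in> {a..b} - N; e > 0\<rbrakk> \<Longrightarrow>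
        \<exists>d>0. \<forall>s\<in>{a..b}. \<bar>s - t\<bar> < d \<longrightarrow> h t - e * \<bar>s - t\<bar> \<le> h s"
    and st: "a \<le> s" "s \<le> t" "t \<le> b"
  shows "h s = h t"
proof (rule antisym)
  have lip': "L-lipschitz_on {s..t} h" using lip st by (auto intro: lipschitz_on_subset)
  show "h s \<le> h t"
  proof (rule lipschitz_mono_if_dini_nonneg[OF st(2) lip' N])
    fix x e assume "x \<in> {s..<t} - N" "(e::real) > 0"
    then obtain d where "d > 0" "\<forall>y\<in>{a..b}. \<bar>y - x\<bar> < d \<longrightarrow> h x - e * \<bar>y - x\<bar> \<le> h y"
      using dini[of x e] st by auto
    then show "\<exists>d>0. \<forall>y. x < y \<and> y < x + d \<and> y \<le> t \<longrightarrow> h x - e * (y - x) \<le> h y"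
      using st \<open>x \<in> {s..<t} - N\<close> by (intro exI[of _ d]) (smt (verit) DiffD1 atLeastAtMost_iff atLeastLessThan_iff)
  qed
  have "h (- (- t)) \<le> h (- (- s))"
  proof (rule lipschitz_mono_if_dini_nonneg[where h = "\<lambda>x. h (- x)" and L = L and N = "uminus ` N"])
    show "L-lipschitz_on {- t..- s} (\<lambda>x. h (- x))"
    proof (rule lipschitz_onI)
      fix x y assume "x \<in> {- t..- s}" "y \<in> {- t..- s}"
      then show "dist (h (- x)) (h (- y)) \<le> L * dist x y"
        using lipschitz_onD[OF lip', of "- x" "- y"] by (auto simp: dist_minus)
    qed (use lip lipschitz_on_nonneg in blast)
    show "negligible (uminus ` N)"
      using N by (intro negligible_differentiable_image_negligible)
        (auto simp: differentiable_on_def intro!: derivative_intros)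
    fix x e assume x: "x \<in> {- t..<- s} - uminus ` N" "(e::real) > 0"
    then have "- x \<in> {a..b} - N" using st by (auto simp: image_iff)
    then obtain d where d: "d > 0" "\<forall>y\<in>{a..b}. \<bar>y - (- x)\<bar> < d \<longrightarrow> h (- x) - e * \<bar>y - (- x)\<bar> \<le> h y"
      using dini[of "- x" e] x by auto
    have "h (- x) - e * (y - x) \<le> h (- y)" if "x < y" "y < x + d" "y \<le> - s" for y
      using d(2)[rule_format, of "- y"] that x st by auto
    then show "\<exists>d>0. \<forall>y. x < y \<and> y < x + d \<and> y \<le> - s \<longrightarrow> h (- x) - e * (y - x) \<le> h (- y)"
      using d(1) by blast
  qed (use st in auto)
  then show "h t \<le> h s" by simp
qed

lemma AE_lebesgue_on_obtain_negligible:
  assumes "AE t in lebesgue_on I. P t" "I \<in> sets lebesgue"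
  obtains N where "negligible N" "\<And>t. t \<in> I - N \<Longrightarrow> P t"
proof -
  have "AE t in lebesgue. t \<in> I \<longrightarrow> P t"
    using assms by (simp add: AE_restrict_space_iff)
  then obtain N where "N \<in> null_sets lebesgue" "{t \<in> space lebesgue. \<not> (t \<in> I \<longrightarrow> P t)} \<subseteq> N"
    by (auto simp: eventually_ae_filter)
  then show thesis using that[of N] by (auto simp: negligible_iff_null_sets)
qed

lemma AE_lebesgue_onI:
  assumes "negligible N" "\<And>t. t \<in> I - N \<Longrightarrow> P t" "I \<in> sets lebesgue"
  shows "AE t in lebesgue_on I. P t"
proof -
  have "N \<in> null_sets lebesgue" using assms(1) by (simp add: negligible_iff_null_sets)
  moreover have "{t \<in> space lebesgue. \<not> (t \<in> I \<longrightarrow> P t)} \<subseteq> N" using assms(2) by blast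
  ultimately have "AE t in lebesgue. t \<in> I \<longrightarrow> P t" by (rule AE_I')
  then show ?thesis using assms(3) by (simp add: AE_restrict_space_iff)
qed

section \<open>Functions of class Ck on open sets\<close>

lemma has_derivative_frechet:
  "f differentiable (at x) \<Longrightarrow> (f has_derivative frechet_derivative f (at x)) (at x)"
  by (simp add: frechet_derivative_works)

lemma frechet_derivative_eqI:
  "(f has_derivative D) (at x) \<Longrightarrow> frechet_derivative f (at x) = D"
  using frechet_derivative_at by metis

lemma norm_sum_Basis_le:
  fixes v :: "'a::euclidean_space" and B :: "'a \<Rightarrow> 'b::real_normed_vector"
  assumes "linear F" "\<And>b. b \<in> Basis \<Longrightarrow> norm (F b) \<le> c b"
  shows "norm (F v) \<le> (\<Sum>b\<in>Basis. c b) * norm v"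
proof -
  have "F v = F (\<Sum>b\<in>Basis. (v \<bullet> b) *\<^sub>R b)" by (simp add: euclidean_representation)
  also have "\<dots> = (\<Sum>b\<in>Basis. (v \<bullet> b) *\<^sub>R F b)"
    using assms(1) by (simp add: linear_sum linear_scale)
  finally have "norm (F v) \<le> (\<Sum>b\<in>Basis. norm ((v \<bullet> b) *\<^sub>R F b))"
    using norm_sum[of "\<lambda>b. (v \<bullet> b) *\<^sub>R F b" Basis] by simp
  also have "\<dots> \<le> (\<Sum>b\<in>Basis. norm v * c b)"
    using assms(2) by (intro sum_mono) (simp add: Basis_le_norm mult_mono)
  finally show ?thesis by (simp add: sum_distrib_left[symmetric] mult.commute)
qed

lemma Ck_on_differentiable:
  assumes "Ck_on (Suc k) S f" "x \<in> S"
  shows "f differentiable (at x)"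
  using assms by simp

lemma Ck1_locally_lipschitz:
  fixes f :: "'a::euclidean_space \<Rightarrow> 'b::real_normed_vector"
  assumes f: "Ck_on (Suc 0) S f" and "open S" "x \<in> S"
  obtains d L where "d > 0" "cball x d \<subseteq> S" "L-lipschitz_on (cball x d) f"
proof -
  obtain d where d: "d > 0" "cball x d \<subseteq> S" using assms(2,3) open_contains_cball by blast
  have diff: "f differentiable (at z)" if "z \<in> cball x d" for z
    using f d(2) that by auto
  have cont: "continuous_on (cball x d) (\<lambda>z. frechet_derivative f (at z) v)" for v
    using f d(2) by (auto intro: continuous_on_subset)
  have "\<exists>M. \<forall>z\<in>cball x d. norm (frechet_derivative f (at z) b) \<le> M" for b
    using compact_imp_bounded[OF compact_continuous_image[OF cont[of b] compact_cball]]
    by (auto simp: bounded_iff)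
  then obtain M where M: "\<And>b z. z \<in> cball x d \<Longrightarrow> norm (frechet_derivative f (at z) b) \<le> M b"
    by metis
  define L where "L = max 0 (\<Sum>b\<in>Basis. M b)"
  have "norm (f y - f z) \<le> L * norm (y - z)" if yz: "y \<in> cball x d" "z \<in> cball x d" for y z
  proof (rule differentiable_bound[OF convex_cball _ _ yz(1) yz(2)])
    fix w assume w: "w \<in> cball x d"
    then show D: "(f has_derivative frechet_derivative f (at w)) (at w within cball x d)"
      using diff has_derivative_frechet has_derivative_at_withinI by blast
    have lin: "linear (frechet_derivative f (at w))"
      using diff[OF w] linear_frechet_derivative by blast
    have "norm (frechet_derivative f (at w) v) \<le> L * norm v" for v
    proof -
      have "norm (frechet_derivative f (at w) v) \<le> (\<Sum>b\<in>Basis. M b) * norm v"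
        using norm_sum_Basis_le[OF lin] M[OF w] by blast
      also have "\<dots> \<le> L * norm v" by (simp add: L_def mult_right_mono)
      finally show ?thesis .
    qed
    then show "onorm (frechet_derivative f (at w)) \<le> L"
      by (rule onorm_le)
  qed
  then have "L-lipschitz_on (cball x d) f"
    by (intro lipschitz_onI) (auto simp: dist_norm L_def)
  then show thesis using d that by blast
qed

text \<open>
  The hypothesis concerns the derivative in one direction at a time; uniformity in the direction comes from
  summing the estimates over a basis.
\<close>

lemma Ck2_derivative_locally_lipschitz:
  fixes f :: "'a::euclidean_space \<Rightarrow> 'b::real_normed_vector"
  assumes f: "Ck_on (Suc (Suc 0)) S f" and "open S" "x \<in> S"
  obtains d L where "d > 0" "L \<ge> 0" "cball x d \<subseteq> S"
    "\<And>y z v. \<lbrakk>y \<in> cball x d; z \<in> cball x d\<rbrakk> \<Longrightarrow>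
       norm (frechet_derivative f (at y) v - frechet_derivative f (at z) v) \<le> L * norm (y - z) * norm v"
proof -
  have "\<exists>d L. d > 0 \<and> cball x d \<subseteq> S \<and> L-lipschitz_on (cball x d) (\<lambda>z. frechet_derivative f (at z) b)" for b
    using Ck1_locally_lipschitz[of S "\<lambda>z. frechet_derivative f (at z) b" x] f assms(2,3)
    by (metis Ck_on.simps(2))
  then obtain d L where dL: "\<And>b. d b > 0" "\<And>b. cball x (d b) \<subseteq> S"
     "\<And>b. (L b)-lipschitz_on (cball x (d b)) (\<lambda>z. frechet_derivative f (at z) b)"
    by metis
  define e where "e = Min (d ` Basis)"
  have e: "e > 0" "\<And>b. b \<in> Basis \<Longrightarrow> e \<le> d b"
    using dL(1) by (auto simp: e_def)
  have sub: "cball x e \<subseteq> S"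
    using e(2) dL(2) SOME_Basis by (meson subset_cball subset_trans)
  have L0: "L b \<ge> 0" for b using dL(3) lipschitz_on_nonneg by blast
  show thesis
  proof (rule that[OF e(1) _ sub])
    show "(\<Sum>b\<in>Basis. L b) \<ge> 0" using L0 by (intro sum_nonneg) auto
    fix y z v assume yz: "y \<in> cball x e" "z \<in> cball x e"
    have lin: "linear (frechet_derivative f (at w))" if "w \<in> cball x e" for w
      using f sub that by (intro linear_frechet_derivative) auto
    have "linear (\<lambda>v. frechet_derivative f (at y) v - frechet_derivative f (at z) v)"
      using lin yz by (intro linear_compose_sub)
    moreover have "norm (frechet_derivative f (at y) b - frechet_derivative f (at z) b) \<le> L b * norm (y - z)"
      if "b \<in> Basis" for b
      using lipschitz_onD[OF dL(3)[of b], of y z] yz e(2)[OF that] by (auto simp: dist_norm)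
    ultimately have "norm (frechet_derivative f (at y) v - frechet_derivative f (at z) v) \<le> (\<Sum>b\<in>Basis. L b * norm (y - z)) * norm v"
      using norm_sum_Basis_le[of "\<lambda>v. frechet_derivative f (at y) v - frechet_derivative f (at z) v" "\<lambda>b. L b * norm (y - z)" v]
      by simp
    then show "norm (frechet_derivative f (at y) v - frechet_derivative f (at z) v) \<le> (\<Sum>b\<in>Basis. L b) * norm (y - z) * norm v"
      by (simp add: sum_distrib_right)
  qed
qed

text \<open>
  The second difference is symmetric in \<open>v\<close> and \<open>w\<close>, and this is the source of the symmetry of the
  second derivative.  It is the increment over \<open>[0, t]\<close> of \<open>s \<mapsto> f (x + s v + t w) - f (x + s v)\<close>, a
  function whose derivative is \<open>t D w + o(t)\<close>.
\<close>

lemma second_difference_tendsto: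
  fixes f :: "'a::real_normed_vector \<Rightarrow> 'b::real_normed_vector"
  assumes S: "open S" "x \<in> S" and f: "\<And>z. z \<in> S \<Longrightarrow> f differentiable (at z)"
    and D: "((\<lambda>z. frechet_derivative f (at z) v) has_derivative D) (at x)"
  shows "((\<lambda>t. (f (x + t *\<^sub>R v + t *\<^sub>R w) - f (x + t *\<^sub>R v) - f (x + t *\<^sub>R w) + f x) /\<^sub>R t\<^sup>2)
           \<longlongrightarrow> D w) (at_right 0)"
proof (rule tendstoI)
  let ?D = "\<lambda>z. frechet_derivative f (at z)"
  fix \<epsilon> :: real assume \<epsilon>: "\<epsilon> > 0"
  define C where "C = 2 * norm v + norm w + 1"
  have C: "C > 0" by (simp add: C_def add_nonneg_pos)
  \<comment> \<open>The derivative in direction \<open>v\<close> is compared at two points, at distances of at most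
    \<open>t (norm v + norm w)\<close> and \<open>t norm v\<close> from \<open>x\<close>; the summand 1 in \<open>C\<close> makes it positive.\<close>
  define \<eta> where "\<eta> = \<epsilon> / (2 * C)"
  have \<eta>: "\<eta> > 0" using \<epsilon> C by (simp add: \<eta>_def)
  have linD: "linear D" using D has_derivative_linear by blast
  obtain d1 where d1: "d1 > 0" "\<And>y. norm (y - x) < d1 \<Longrightarrow>
      norm (?D y v - ?D x v - D (y - x)) \<le> \<eta> * norm (y - x)"
    using D \<eta> unfolding has_derivative_at_alt by blast
  obtain d2 where d2: "d2 > 0" "ball x d2 \<subseteq> S" using S openE by blast
  define d where "d = min d1 d2"
  have d: "d > 0" using d1 d2 by (simp add: d_def)
  have key: "norm ((f (x + t *\<^sub>R v + t *\<^sub>R w) - f (x + t *\<^sub>R v) - f (x + t *\<^sub>R w) + f x) /\<^sub>R t\<^sup>2 - D w) < \<epsilon>"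
    if t: "0 < t" "t < d / C" for t
  proof -
    have tC: "t * C < d" using t C by (simp add: field_simps)
    have small: "norm (s *\<^sub>R v + r *\<^sub>R w) \<le> t * (norm v + norm w)" if "0 \<le> s" "s \<le> t" "0 \<le> r" "r \<le> t" for s r
    proof -
      have "norm (s *\<^sub>R v + r *\<^sub>R w) \<le> s * norm v + r * norm w"
        using norm_triangle_ineq[of "s *\<^sub>R v" "r *\<^sub>R w"] that by simp
      also have "\<dots> \<le> t * norm v + t * norm w" using that by (intro add_mono mult_right_mono) auto
      finally show ?thesis by (simp add: algebra_simps)
    qed
    have tvw: "t * (norm v + norm w) < d"
    proof -
      have "t * (norm v + norm w) \<le> t * C" using t by (intro mult_left_mono) (auto simp: C_def)
      then show ?thesis using tC by simp
    qed
    have inS: "x + s *\<^sub>R v + r *\<^sub>R w \<in> S" if "0 \<le> s" "s \<le> t" "0 \<le> r" "r \<le> t" for s r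
      using small[OF that] tvw d2(2) by (force simp: d_def dist_norm norm_minus_commute add.assoc subset_iff)
    have inS0: "x + s *\<^sub>R v \<in> S" if "0 \<le> s" "s \<le> t" for s
      using inS[of s 0] that t by simp
    define \<phi> where "\<phi> s = f (x + s *\<^sub>R v + t *\<^sub>R w) - f (x + s *\<^sub>R v) - (s * t) *\<^sub>R D w" for s
    define \<phi>' where "\<phi>' s = ?D (x + s *\<^sub>R v + t *\<^sub>R w) v - ?D (x + s *\<^sub>R v) v - t *\<^sub>R D w" for s
    have der: "(\<phi> has_derivative (\<lambda>h. h *\<^sub>R \<phi>' s)) (at s within {0..t})" if s: "s \<in> {0..t}" for s
    proof -
      have 1: "(f has_derivative ?D (x + s *\<^sub>R v + t *\<^sub>R w)) (at (x + s *\<^sub>R v + t *\<^sub>R w))"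
        using inS[of s t] s t f has_derivative_frechet by auto
      have 2: "(f has_derivative ?D (x + s *\<^sub>R v)) (at (x + s *\<^sub>R v))"
        using inS0[of s] s t f has_derivative_frechet by auto
      have 3: "((\<lambda>s. f (x + s *\<^sub>R v + t *\<^sub>R w)) has_derivative (\<lambda>h. ?D (x + s *\<^sub>R v + t *\<^sub>R w) (h *\<^sub>R v))) (at s)"
        by (rule has_derivative_compose[of "\<lambda>s. x + s *\<^sub>R v + t *\<^sub>R w", OF _ 1]) (auto intro!: derivative_eq_intros)
      have 4: "((\<lambda>s. f (x + s *\<^sub>R v)) has_derivative (\<lambda>h. ?D (x + s *\<^sub>R v) (h *\<^sub>R v))) (at s)"
        by (rule has_derivative_compose[of "\<lambda>s. x + s *\<^sub>R v", OF _ 2]) (auto intro!: derivative_eq_intros)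
      have sc: "?D (x + s *\<^sub>R v + t *\<^sub>R w) (h *\<^sub>R v) = h *\<^sub>R ?D (x + s *\<^sub>R v + t *\<^sub>R w) v"
        "?D (x + s *\<^sub>R v) (h *\<^sub>R v) = h *\<^sub>R ?D (x + s *\<^sub>R v) v" for h
        using has_derivative_linear[OF 1] has_derivative_linear[OF 2] by (simp_all add: linear_scale)
      have 5: "((\<lambda>s. (s * t) *\<^sub>R D w) has_derivative (\<lambda>h. (h * t) *\<^sub>R D w)) (at s)"
        by (auto intro!: derivative_eq_intros)
      have "(\<phi> has_derivative (\<lambda>h. h *\<^sub>R \<phi>' s)) (at s)"
        using has_derivative_diff[OF has_derivative_diff[OF 3 4] 5]
        unfolding \<phi>_def \<phi>'_def sc by (simp add: algebra_simps)
      then show ?thesis by (rule has_derivative_at_withinI)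
    qed
    have bd: "norm (\<phi>' s) \<le> \<eta> * t * C" if s: "s \<in> {0..t}" for s
    proof -
      define y1 y2 where "y1 = x + s *\<^sub>R v + t *\<^sub>R w" and "y2 = x + s *\<^sub>R v"
      have n1: "norm (y1 - x) \<le> t * (norm v + norm w)" using small[of s t] s t by (simp add: y1_def add.assoc)
      have n2: "norm (y2 - x) \<le> t * norm v" using s by (simp add: y2_def mult_right_mono)
      have "norm (y1 - x) < d1" "norm (y2 - x) < d1"
      proof -
        show "norm (y1 - x) < d1" using n1 tvw by (simp add: d_def)
        have "t * norm v \<le> t * (norm v + norm w)" using t by (intro mult_left_mono) auto
        then show "norm (y2 - x) < d1" using n2 tvw by (simp add: d_def)
      qed
      then have b: "norm (?D y1 v - ?D x v - D (y1 - x)) \<le> \<eta> * norm (y1 - x)"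
        "norm (?D y2 v - ?D x v - D (y2 - x)) \<le> \<eta> * norm (y2 - x)"
        using d1(2) by blast+
      have "D (y1 - x) - D (y2 - x) = t *\<^sub>R D w"
        using linD by (simp add: y1_def y2_def linear_add linear_scale add.assoc)
      then have "\<phi>' s = (?D y1 v - ?D x v - D (y1 - x))
            - (?D y2 v - ?D x v - D (y2 - x))"
        by (simp add: \<phi>'_def y1_def y2_def algebra_simps)
      then have "norm (\<phi>' s) \<le> \<eta> * norm (y1 - x) + \<eta> * norm (y2 - x)"
        using b norm_triangle_ineq4[of "?D y1 v - ?D x v - D (y1 - x)"
            "?D y2 v - ?D x v - D (y2 - x)"] by simp
      also have "\<dots> \<le> \<eta> * (t * (norm v + norm w)) + \<eta> * (t * norm v)"
        using n1 n2 \<eta> by (intro add_mono mult_left_mono) auto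
      also have "\<dots> = \<eta> * t * (2 * norm v + norm w)" by (simp add: algebra_simps)
      also have "\<dots> \<le> \<eta> * t * C" using \<eta> t by (intro mult_left_mono) (auto simp: C_def)
      finally show ?thesis .
    qed
    have "norm (\<phi> t - \<phi> 0) \<le> (\<eta> * t * C) * norm (t - 0)"
    proof (rule differentiable_bound[of "{0..t}" \<phi> "\<lambda>s h. h *\<^sub>R \<phi>' s"])
      show "onorm (\<lambda>h. h *\<^sub>R \<phi>' s) \<le> \<eta> * t * C" if "s \<in> {0..t}" for s
        using mult_left_mono[OF bd[OF that] abs_ge_zero] by (intro onorm_le) (simp add: mult_ac)
    qed (use der t in auto)
    then have b: "norm (\<phi> t - \<phi> 0) \<le> \<eta> * C * t\<^sup>2" using t by (simp add: power2_eq_square algebra_simps)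
    have "(f (x + t *\<^sub>R v + t *\<^sub>R w) - f (x + t *\<^sub>R v) - f (x + t *\<^sub>R w) + f x) /\<^sub>R t\<^sup>2 - D w
        = (\<phi> t - \<phi> 0) /\<^sub>R t\<^sup>2"
      using t by (simp add: \<phi>_def algebra_simps power2_eq_square)
    then have "norm ((f (x + t *\<^sub>R v + t *\<^sub>R w) - f (x + t *\<^sub>R v) - f (x + t *\<^sub>R w) + f x) /\<^sub>R t\<^sup>2 - D w)
        = norm (\<phi> t - \<phi> 0) / t\<^sup>2"
      by (simp add: divide_inverse_commute)
    also have "\<dots> \<le> \<eta> * C" using b t by (simp add: divide_le_eq)
    also have "\<dots> < \<epsilon>" using \<epsilon> C by (simp add: \<eta>_def field_simps)
    finally show ?thesis .
  qed
  show "\<forall>\<^sub>F t in at_right 0. dist ((f (x + t *\<^sub>R v + t *\<^sub>R w) - f (x + t *\<^sub>R v) - f (x + t *\<^sub>R w) + f x) /\<^sub>R t\<^sup>2) (D w) < \<epsilon>"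
    unfolding eventually_at_right_field using key d C by (intro exI[of _ "d / C"]) (auto simp: dist_norm)
qed

lemma second_derivative_symmetric:
  fixes f :: "'a::real_normed_vector \<Rightarrow> 'b::real_normed_vector"
  assumes f: "Ck_on (Suc (Suc 0)) S f" and "open S" "x \<in> S"
  shows "frechet_derivative (\<lambda>z. frechet_derivative f (at z) v) (at x) w
       = frechet_derivative (\<lambda>z. frechet_derivative f (at z) w) (at x) v"
proof -
  let ?D = "\<lambda>v. frechet_derivative (\<lambda>z. frechet_derivative f (at z) v) (at x)"
  have d: "\<And>z. z \<in> S \<Longrightarrow> f differentiable (at z)"
    and D: "((\<lambda>z. frechet_derivative f (at z) v) has_derivative ?D v) (at x)" for v
    using f \<open>x \<in> S\<close> by (auto intro: has_derivative_frechet)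
  let ?q = "\<lambda>v w t. (f (x + t *\<^sub>R v + t *\<^sub>R w) - f (x + t *\<^sub>R v) - f (x + t *\<^sub>R w) + f x) /\<^sub>R t\<^sup>2"
  have 1: "(?q v w \<longlongrightarrow> ?D v w) (at_right 0)"
    by (rule second_difference_tendsto[OF assms(2,3) d D])
  have "(?q w v \<longlongrightarrow> ?D w v) (at_right 0)"
    by (rule second_difference_tendsto[OF assms(2,3) d D])
  then have 2: "(?q v w \<longlongrightarrow> ?D w v) (at_right 0)"
    by (simp add: add.commute add.left_commute diff_diff_eq)
  show ?thesis by (rule tendsto_unique[OF trivial_limit_at_right_real 1 2])
qed

section \<open>Polyhedral norms\<close>

lemma norm_onD:
  assumes "norm_on V \<nu>"
  shows "v \<in> V \<Longrightarrow> 0 \<le> \<nu> v" "v \<in> V \<Longrightarrow> \<nu> v = 0 \<longleftrightarrow> v = 0"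
    "v \<in> V \<Longrightarrow> \<nu> (c *\<^sub>R v) = \<bar>c\<bar> * \<nu> v" "v \<in> V \<Longrightarrow> w \<in> V \<Longrightarrow> \<nu> (v + w) \<le> \<nu> v + \<nu> w"
  using assms unfolding norm_on_def by blast+

lemma subspace_obtain_orthonormal_basis:
  fixes V :: "'e::euclidean_space set"
  assumes "subspace V"
  obtains B where "finite B" "B \<subseteq> V" "\<And>b. b \<in> B \<Longrightarrow> norm b = 1"
    "\<And>v. v \<in> V \<Longrightarrow> v = (\<Sum>b\<in>B. (v \<bullet> b) *\<^sub>R b)"
proof -
  obtain B where B: "B \<subseteq> V" "pairwise orthogonal B" "\<And>x. x \<in> B \<Longrightarrow> norm x = 1"
    "independent B" "card B = dim V" "span B = V"
    using orthonormal_basis_subspace[OF assms] by metis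
  have "finite B" using B(4) independent_imp_finite by blast
  moreover have "v = (\<Sum>b\<in>B. (v \<bullet> b) *\<^sub>R b)" if "v \<in> V" for v
    using orthonormal_basis_expand[OF B(2,3) _ \<open>finite B\<close>] that B(6) by metis
  ultimately show thesis using B(1,3) that by blast
qed

lemma norm_on_sum_le:
  assumes "norm_on V \<nu>" "subspace V" "finite B" "B \<subseteq> V"
  shows "\<nu> (\<Sum>b\<in>B. c b *\<^sub>R b) \<le> (\<Sum>b\<in>B. \<bar>c b\<bar> * \<nu> b)"
  using assms(3,4)
proof (induction B rule: finite_induct)
  case empty
  have "0 \<in> V" using assms(2) by (simp add: subspace_0)
  then show ?case using norm_onD(2)[OF assms(1) \<open>0 \<in> V\<close>] by simp
next
  case (insert x B)
  have "c x *\<^sub>R x \<in> V" "(\<Sum>b\<in>B. c b *\<^sub>R b) \<in> V"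
    using insert.prems assms(2) by (auto intro!: subspace_scale subspace_sum)
  then have "\<nu> (c x *\<^sub>R x + (\<Sum>b\<in>B. c b *\<^sub>R b)) \<le> \<nu> (c x *\<^sub>R x) + \<nu> (\<Sum>b\<in>B. c b *\<^sub>R b)"
    using norm_onD(4)[OF assms(1)] by blast
  also have "\<dots> \<le> \<bar>c x\<bar> * \<nu> x + (\<Sum>b\<in>B. \<bar>c b\<bar> * \<nu> b)"
    using insert norm_onD(3)[OF assms(1)] by auto
  finally show ?case using insert by simp
qed

lemma norm_on_le_norm:
  fixes V :: "'e::euclidean_space set"
  assumes "norm_on V \<nu>" "subspace V"
  obtains C where "C > 0" "\<And>v. v \<in> V \<Longrightarrow> \<nu> v \<le> C * norm v"
proof -
  obtain B where B: "finite B" "B \<subseteq> V" "\<And>b. b \<in> B \<Longrightarrow> norm b = 1"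
    "\<And>v. v \<in> V \<Longrightarrow> v = (\<Sum>b\<in>B. (v \<bullet> b) *\<^sub>R b)"
    using subspace_obtain_orthonormal_basis[OF assms(2)] by blast
  have nn: "0 \<le> \<nu> b" if "b \<in> B" for b using norm_onD(1)[OF assms(1)] B(2) that by blast
  have "\<nu> v \<le> (1 + (\<Sum>b\<in>B. \<nu> b)) * norm v" if "v \<in> V" for v
  proof -
    have "\<nu> v \<le> (\<Sum>b\<in>B. \<bar>v \<bullet> b\<bar> * \<nu> b)"
      using norm_on_sum_le[OF assms B(1,2), of "\<lambda>b. v \<bullet> b"] B(4)[OF that] by simp
    also have "\<dots> \<le> (\<Sum>b\<in>B. norm v * \<nu> b)"
    proof (intro sum_mono mult_right_mono nn)
      show "\<bar>v \<bullet> b\<bar> \<le> norm v" if "b \<in> B" for b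
        using Cauchy_Schwarz_ineq2[of v b] B(3)[OF that] by simp
    qed
    also have "\<dots> \<le> (1 + (\<Sum>b\<in>B. \<nu> b)) * norm v"
      by (simp add: algebra_simps sum_distrib_left)
    finally show ?thesis .
  qed
  moreover have "1 + (\<Sum>b\<in>B. \<nu> b) > 0" using sum_nonneg[of B \<nu>] nn by simp
  ultimately show thesis using that by blast
qed

lemma norm_le_norm_on:
  fixes V :: "'e::euclidean_space set"
  assumes "norm_on V \<nu>" "subspace V"
  obtains C where "C > 0" "\<And>v. v \<in> V \<Longrightarrow> norm v \<le> C * \<nu> v"
proof (cases "V \<inter> sphere 0 1 = {}")
  case True
  have "v = 0" if "v \<in> V" for v
  proof (rule ccontr)
    assume "v \<noteq> 0"
    then have "(1 / norm v) *\<^sub>R v \<in> V \<inter> sphere 0 1" using that assms(2) by (auto intro: subspace_scale)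
    then show False using True by blast
  qed
  then show thesis using that[of 1] norm_onD(1)[OF assms(1)] by (metis mult_1 norm_zero zero_less_one)
next
  case False
  obtain C where C: "C > 0" "\<And>v. v \<in> V \<Longrightarrow> \<nu> v \<le> C * norm v"
    using norm_on_le_norm[OF assms] by blast
  have tri: "\<nu> x - \<nu> y \<le> C * norm (x - y)" if "x \<in> V" "y \<in> V" for x y
  proof -
    have d: "x - y \<in> V" using that assms(2) by (simp add: subspace_diff)
    have "\<nu> x \<le> \<nu> (x - y) + \<nu> y" using norm_onD(4)[OF assms(1) d that(2)] by simp
    then show ?thesis using C(2)[OF d] by simp
  qed
  have "C-lipschitz_on V \<nu>"
  proof (rule lipschitz_onI)
    fix x y assume "x \<in> V" "y \<in> V"
    then show "dist (\<nu> x) (\<nu> y) \<le> C * dist x y"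
      using tri[of x y] tri[of y x] by (simp add: dist_norm norm_minus_commute abs_le_iff)
  qed (use C in simp)
  then have "continuous_on (V \<inter> sphere 0 1) \<nu>"
    using lipschitz_on_continuous_on lipschitz_on_subset by blast
  moreover have "compact (V \<inter> sphere 0 1)"
    using closed_subspace[OF assms(2)] by (intro closed_Int_compact) auto
  ultimately obtain x where x: "x \<in> V \<inter> sphere 0 1" "\<And>y. y \<in> V \<inter> sphere 0 1 \<Longrightarrow> \<nu> x \<le> \<nu> y"
    using continuous_attains_inf False by metis
  have "x \<noteq> 0" using x by auto
  then have pos: "\<nu> x > 0" using x(1) norm_onD(1,2)[OF assms(1), of x] by auto
  have "norm v \<le> (1 / \<nu> x) * \<nu> v" if "v \<in> V" for v
  proof (cases "v = 0")
    case True then show ?thesis using norm_onD(1)[OF assms(1) that] pos by simp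
  next
    case False
    then have "(1 / norm v) *\<^sub>R v \<in> V \<inter> sphere 0 1" using that assms(2) by (auto intro: subspace_scale)
    then have "\<nu> x \<le> \<nu> ((1 / norm v) *\<^sub>R v)" using x(2) by blast
    also have "\<dots> = \<nu> v / norm v" using norm_onD(3)[OF assms(1) that] by simp
    finally show ?thesis using pos False by (simp add: field_simps)
  qed
  then show thesis using that[of "1 / \<nu> x"] pos by simp
qed

lemma dual_ofD:
  assumes "\<eta> \<in> dual_of V"
  shows "v \<in> V \<Longrightarrow> w \<in> V \<Longrightarrow> \<eta> (v + w) = \<eta> v + \<eta> w" "v \<in> V \<Longrightarrow> \<eta> (c *\<^sub>R v) = c * \<eta> v"
  using assms by (auto simp: dual_of_def)

lemma dual_of_diff:
  assumes "\<eta> \<in> dual_of V" "subspace V" "v \<in> V" "w \<in> V"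
  shows "\<eta> (v - w) = \<eta> v - \<eta> w"
proof -
  have "\<eta> (v + (-1) *\<^sub>R w) = \<eta> v + (-1) * \<eta> w"
    using dual_ofD[OF assms(1)] assms(2-4) by (metis subspace_scale)
  then show ?thesis by simp
qed

lemma dual_of_sum:
  assumes "\<eta> \<in> dual_of V" "subspace V" "finite B" "B \<subseteq> V"
  shows "\<eta> (\<Sum>b\<in>B. c b *\<^sub>R b) = (\<Sum>b\<in>B. c b * \<eta> b)"
  using assms(3,4)
proof (induction B rule: finite_induct)
  case empty
  have "\<eta> (0 *\<^sub>R 0) = 0 * \<eta> 0" using dual_ofD(2)[OF assms(1)] assms(2) subspace_0 by blast
  then show ?case by simp
next
  case (insert x B)
  have "c x *\<^sub>R x \<in> V" "(\<Sum>b\<in>B. c b *\<^sub>R b) \<in> V"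
    using insert.prems assms(2) by (auto intro!: subspace_scale subspace_sum)
  then show ?case using insert dual_ofD[OF assms(1)] by simp
qed

lemma dual_of_representation:
  fixes V :: "'e::euclidean_space set"
  assumes "\<eta> \<in> dual_of V" "subspace V"
  obtains y where "y \<in> V" "\<And>v. v \<in> V \<Longrightarrow> \<eta> v = y \<bullet> v"
proof -
  obtain B where B: "finite B" "B \<subseteq> V" "\<And>b. b \<in> B \<Longrightarrow> norm b = 1"
    "\<And>v. v \<in> V \<Longrightarrow> v = (\<Sum>b\<in>B. (v \<bullet> b) *\<^sub>R b)"
    using subspace_obtain_orthonormal_basis[OF assms(2)] by blast
  show thesis
  proof
    show "(\<Sum>b\<in>B. \<eta> b *\<^sub>R b) \<in> V" using B(2) assms(2) by (auto intro!: subspace_scale subspace_sum)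
    show "\<eta> v = (\<Sum>b\<in>B. \<eta> b *\<^sub>R b) \<bullet> v" if "v \<in> V" for v
    proof -
      have "\<eta> v = (\<Sum>b\<in>B. (v \<bullet> b) * \<eta> b)"
        using dual_of_sum[OF assms B(1,2), of "\<lambda>b. v \<bullet> b"] B(4)[OF that] by simp
      also have "\<dots> = (\<Sum>b\<in>B. \<eta> b *\<^sub>R b) \<bullet> v"
        unfolding inner_sum_left by (intro sum.cong refl) (simp add: inner_commute)
      finally show ?thesis .
    qed
  qed
qed

lemma zero_if_linear_le_quadratic:
  fixes c k :: real
  assumes "\<And>s. s * c \<le> s\<^sup>2 * k"
  shows "c = 0"
proof -
  define m where "m = 1 + \<bar>k\<bar>"
  have m: "m > 0" "k \<le> m - 1" by (auto simp: m_def)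
  have "(c / m) * c \<le> (c / m)\<^sup>2 * k" by (rule assms)
  also have "\<dots> \<le> (c / m)\<^sup>2 * (m - 1)" using m by (intro mult_left_mono) auto
  finally have "c\<^sup>2 * m \<le> c\<^sup>2 * (m - 1)"
    using m(1) by (simp add: power2_eq_square field_simps)
  then show ?thesis by (simp add: right_diff_distrib)
qed

text \<open>
  The inequality that defines the subdifferential is tested at multiples \<open>s v\<close>, where its right hand side
  is quadratic in \<open>s\<close>.  Near \<open>s = 1\<close> and for \<open>v = w\<close> this determines \<open>\<eta> w\<close>; the multiple of \<open>v\<close> that has
  the norm of \<open>w\<close> yields the bound on the dual norm of \<open>\<eta>\<close>.
\<close>

lemma energy_subdifferential_max:
  assumes "norm_on V \<nu>" "subspace V" and \<eta>: "\<eta> \<in> energy_subdifferential V \<nu> w" and "w \<in> V"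
  shows "\<eta> w = (\<nu> w)\<^sup>2" and "v \<in> V \<Longrightarrow> \<eta> v \<le> \<nu> w * \<nu> v"
proof -
  have dual: "\<eta> \<in> dual_of V" and sub: "\<And>v. v \<in> V \<Longrightarrow> \<eta> (v - w) \<le> energy \<nu> v - energy \<nu> w"
    using \<eta> by (auto simp: energy_subdifferential_def)
  have "s * \<eta> v - \<eta> w \<le> ((\<bar>s\<bar> * \<nu> v)\<^sup>2 - (\<nu> w)\<^sup>2) / 2" if v: "v \<in> V" for v s
    using sub[OF subspace_scale[OF assms(2) v, of s]] dual_of_diff[OF dual assms(2) subspace_scale[OF assms(2) v, of s] \<open>w \<in> V\<close>]
    unfolding dual_ofD(2)[OF dual v] norm_onD(3)[OF assms(1) v] energy_def by (simp add: diff_divide_distrib)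
  then have diff: "s * \<eta> v - \<eta> w \<le> (s\<^sup>2 * (\<nu> v)\<^sup>2 - (\<nu> w)\<^sup>2) / 2" if "v \<in> V" for v s
    using that by (simp add: power_mult_distrib)
  have "s * (\<eta> w - (\<nu> w)\<^sup>2) \<le> s\<^sup>2 * ((\<nu> w)\<^sup>2 / 2)" for s
    using diff[OF \<open>w \<in> V\<close>, of "1 + s"] by (simp add: power2_eq_square algebra_simps)
  then have "\<eta> w - (\<nu> w)\<^sup>2 = 0" by (rule zero_if_linear_le_quadratic)
  then show w: "\<eta> w = (\<nu> w)\<^sup>2" by simp
  assume v: "v \<in> V"
  have w0: "\<nu> w \<ge> 0" and v0: "\<nu> v \<ge> 0" using norm_onD(1)[OF assms(1)] v \<open>w \<in> V\<close> by auto
  show "\<eta> v \<le> \<nu> w * \<nu> v"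
  proof (cases "\<nu> w * \<nu> v = 0")
    case True
    have q: "s * \<eta> v \<le> s\<^sup>2 * ((\<nu> v)\<^sup>2 / 2)" if "\<nu> w = 0" for s using diff[OF v, of s] w that by simp
    have "\<eta> v = 0" if "\<nu> w = 0" by (rule zero_if_linear_le_quadratic[OF q[OF that]])
    moreover have "\<eta> v = 0" if "\<nu> v = 0"
    proof -
      have "v = 0 *\<^sub>R v" using norm_onD(2)[OF assms(1) v] that by simp
      then show ?thesis using dual_ofD(2)[OF dual v, of 0] by simp
    qed
    ultimately show ?thesis using True by auto
  next
    case False
    then have pos: "\<nu> w > 0" "\<nu> v > 0" using w0 v0 by auto
    have "(\<nu> w / \<nu> v) * \<eta> v \<le> (\<nu> w)\<^sup>2"
      using diff[OF v, of "\<nu> w / \<nu> v"] w pos by (simp add: power_divide)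
    then show ?thesis using pos by (simp add: field_simps power2_eq_square)
  qed
qed

text \<open>
  For each \<open>Q\<close> the total slack, the sum of \<open>1 - y \<bullet> q\<close> over \<open>Q\<close>, attains its minimum on the compact
  set of admissible \<open>y\<close>.  If the minimum is 0, then all of \<open>Q\<close> is active at the minimiser.  If it is
  positive, then no admissible \<open>y\<close> has all slacks below a positive threshold.  There are finitely many \<open>Q\<close>.
\<close>

lemma almost_active_vertices_coactive:
  fixes V :: "'e::euclidean_space set" and P :: "'e set"
  assumes V: "subspace V" and P: "finite P" and bdd: "bounded {y \<in> V. \<forall>p\<in>P. y \<bullet> p \<le> 1}"
  obtains \<epsilon> :: real where "\<epsilon> > 0"
    "\<And>Q y. \<lbrakk>Q \<subseteq> P; y \<in> V; \<forall>p\<in>P. y \<bullet> p \<le> 1; \<forall>q\<in>Q. 1 - \<epsilon> \<le> y \<bullet> q\<rbrakk> \<Longrightarrow>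
       \<exists>z\<in>V. (\<forall>p\<in>P. z \<bullet> p \<le> 1) \<and> (\<forall>q\<in>Q. z \<bullet> q = 1)"
proof -
  define C where "C = {y \<in> V. \<forall>p\<in>P. y \<bullet> p \<le> 1}"
  have "C = V \<inter> (\<Inter>p\<in>P. {y. y \<bullet> p \<le> 1})" by (auto simp: C_def)
  moreover have "closed (\<Inter>p\<in>P. {y. y \<bullet> p \<le> 1})"
    by (intro closed_INT ballI closed_Collect_le continuous_intros)
  ultimately have "closed C" using closed_subspace[OF V] by (simp add: closed_Int)
  then have "compact C" using bdd by (simp add: C_def compact_eq_bounded_closed)
  have "C \<noteq> {}" using subspace_0[OF V] by (auto simp: C_def)
  have "\<exists>\<epsilon>>0. \<forall>y. y \<in> C \<and> (\<forall>q\<in>Q. 1 - \<epsilon> \<le> y \<bullet> q) \<longrightarrow> (\<exists>z\<in>C. \<forall>q\<in>Q. z \<bullet> q = 1)" if "Q \<subseteq> P" for Q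
  proof -
    have Q: "finite Q" using that P finite_subset by blast
    have "continuous_on C (\<lambda>y. \<Sum>q\<in>Q. 1 - y \<bullet> q)" by (intro continuous_intros)
    then obtain z where z: "z \<in> C" "\<And>y. y \<in> C \<Longrightarrow> (\<Sum>q\<in>Q. 1 - z \<bullet> q) \<le> (\<Sum>q\<in>Q. 1 - y \<bullet> q)"
      using continuous_attains_inf[OF \<open>compact C\<close> \<open>C \<noteq> {}\<close>] by blast
    have nn: "0 \<le> 1 - z \<bullet> q" if "q \<in> Q" for q using z(1) that \<open>Q \<subseteq> P\<close> by (auto simp: C_def)
    show ?thesis
    proof (cases "(\<Sum>q\<in>Q. 1 - z \<bullet> q) = 0")
      case True
      then have "\<forall>q\<in>Q. z \<bullet> q = 1" using sum_nonneg_eq_0_iff[OF Q, of "\<lambda>q. 1 - z \<bullet> q"] nn by auto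
      then show ?thesis using z(1) by (intro exI[of _ 1]) auto
    next
      case False
      define m where "m = (\<Sum>q\<in>Q. 1 - z \<bullet> q)"
      have m: "m > 0" using False sum_nonneg[of Q "\<lambda>q. 1 - z \<bullet> q"] nn by (simp add: m_def order_less_le)
      define \<epsilon> where "\<epsilon> = m / (real (card Q) + 1)"
      have "\<epsilon> > 0" using m by (simp add: \<epsilon>_def)
      have "\<not> (\<forall>q\<in>Q. 1 - \<epsilon> \<le> y \<bullet> q)" if "y \<in> C" for y
      proof
        assume "\<forall>q\<in>Q. 1 - \<epsilon> \<le> y \<bullet> q"
        then have "(\<Sum>q\<in>Q. 1 - y \<bullet> q) \<le> (\<Sum>q\<in>Q. \<epsilon>)" by (intro sum_mono) (auto simp: algebra_simps)
        then have "m \<le> real (card Q) * \<epsilon>" using z(2)[OF that] by (simp add: m_def)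
        also have "\<dots> < (real (card Q) + 1) * \<epsilon>" using \<open>\<epsilon> > 0\<close> by (simp add: algebra_simps)
        also have "\<dots> = m" by (simp add: \<epsilon>_def)
        finally show False by simp
      qed
      then show ?thesis using \<open>\<epsilon> > 0\<close> by blast
    qed
  qed
  then obtain e where e: "\<And>Q. Q \<subseteq> P \<Longrightarrow> e Q > (0::real)"
    "\<And>Q y. Q \<subseteq> P \<Longrightarrow> y \<in> C \<Longrightarrow> \<forall>q\<in>Q. 1 - e Q \<le> y \<bullet> q \<Longrightarrow> \<exists>z\<in>C. \<forall>q\<in>Q. z \<bullet> q = 1"
    by metis
  define \<epsilon> where "\<epsilon> = Min (e ` Pow P)"
  have "\<epsilon> > 0" unfolding \<epsilon>_def using P e(1) by (subst Min_gr_iff) auto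
  have le: "\<epsilon> \<le> e Q" if "Q \<subseteq> P" for Q unfolding \<epsilon>_def using P that by (intro Min_le) auto
  show thesis
  proof (rule that[OF \<open>\<epsilon> > 0\<close>])
    fix Q y assume h: "Q \<subseteq> P" "y \<in> V" "\<forall>p\<in>P. y \<bullet> p \<le> 1" "\<forall>q\<in>Q. 1 - \<epsilon> \<le> y \<bullet> q"
    then have "y \<in> C" "\<forall>q\<in>Q. 1 - e Q \<le> y \<bullet> q" using le[OF h(1)] by (auto simp: C_def)
    then show "\<exists>z\<in>V. (\<forall>p\<in>P. z \<bullet> p \<le> 1) \<and> (\<forall>q\<in>Q. z \<bullet> q = 1)"
      using e(2)[OF h(1)] by (fastforce simp: C_def)
  qed
qed

text \<open>
  The set \<open>H\<close> consists of functionals together with points at which they support the energy.  The number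
  \<open>\<epsilon>\<close> acts as a Lebesgue number for the cover of the dual sphere by the sets of functionals that
  expose a subset of a given face.
\<close>

definition common_face_gap :: "'e::euclidean_space set \<Rightarrow> ('e \<Rightarrow> real) \<Rightarrow> 'e set \<Rightarrow> real \<Rightarrow> bool" where
  "common_face_gap V \<nu> P \<epsilon> \<longleftrightarrow> (\<forall>r>0. \<forall>H. H \<noteq> {} \<and>
     (\<forall>\<eta> w. (\<eta>, w) \<in> H \<longrightarrow> w \<in> V \<and> \<nu> w = r \<and> \<eta> \<in> energy_subdifferential V \<nu> w) \<and>
     (\<forall>\<eta> w \<eta>' w'. (\<eta>, w) \<in> H \<and> (\<eta>', w') \<in> H \<longrightarrow> (\<forall>p\<in>P. \<bar>\<eta> p - \<eta>' p\<bar> \<le> \<epsilon> * r)) \<longrightarrow>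
     (\<exists>F. face_of_sphere V \<nu> r F \<and> snd ` H \<subseteq> F))"

text \<open>
  Let \<open>Q\<close> be the set of vertices that are active for some functional in \<open>H\<close>.  Each point \<open>w\<close> in \<open>H\<close> is \<open>r\<close> times
  a convex combination of vertices that are active for its functional, hence of elements of \<open>Q\<close>.  All of
  \<open>Q\<close> is almost active for any one functional in \<open>H\<close>, so there is a \<open>z\<close> for which all of \<open>Q\<close> is
  active, and the face exposed by \<open>z\<close> contains every \<open>w\<close>.
\<close>

lemma polyhedral_common_face_gap:
  fixes V :: "'e::euclidean_space set"
  assumes \<nu>: "norm_on V \<nu>" and V: "subspace V" and "polyhedral V \<nu>"
  obtains \<epsilon> P where "\<epsilon> > 0" "finite P" "{v \<in> V. \<nu> v \<le> 1} = convex hull P" "common_face_gap V \<nu> P \<epsilon>"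
proof -
  obtain P where P: "finite P" "{v \<in> V. \<nu> v \<le> 1} = convex hull P"
    using assms(3) by (auto simp: polyhedral_def polytope_def)
  have PK: "p \<in> V" "\<nu> p \<le> 1" if "p \<in> P" for p
    using P(2) that hull_inc[of p P convex] by auto
  have hull_le: "y \<bullet> v \<le> 1" if "\<forall>p\<in>P. y \<bullet> p \<le> 1" "v \<in> V" "\<nu> v \<le> 1" for y v
  proof -
    have "convex hull P \<subseteq> {v. y \<bullet> v \<le> 1}"
      using that(1) by (intro hull_minimal convex_halfspace_le) auto
    then show ?thesis using that(2,3) P(2) by blast
  qed
  obtain C where C: "C > 0" "\<And>v. v \<in> V \<Longrightarrow> \<nu> v \<le> C * norm v"
    using norm_on_le_norm[OF \<nu> V] by blast
  have "norm y \<le> C" if y: "y \<in> V" "\<forall>p\<in>P. y \<bullet> p \<le> 1" for y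
  proof (cases "y = 0")
    case False
    then have pos: "\<nu> y > 0" using norm_onD(1,2)[OF \<nu> y(1)] by simp
    have "y \<bullet> ((1 / \<nu> y) *\<^sub>R y) \<le> 1"
      using y pos V norm_onD(3)[OF \<nu> y(1)] by (intro hull_le) (auto simp: subspace_scale)
    then have "(norm y)\<^sup>2 \<le> \<nu> y" using pos by (simp add: divide_le_eq power2_norm_eq_inner)
    also have "\<dots> \<le> C * norm y" using C y by blast
    finally show ?thesis using False by (simp add: power2_eq_square)
  qed (use C in simp)
  then have "bounded {y \<in> V. \<forall>p\<in>P. y \<bullet> p \<le> 1}" by (auto simp: bounded_iff)
  then obtain \<epsilon> :: real where \<epsilon>: "\<epsilon> > 0"
    "\<And>Q y. \<lbrakk>Q \<subseteq> P; y \<in> V; \<forall>p\<in>P. y \<bullet> p \<le> 1; \<forall>q\<in>Q. 1 - \<epsilon> \<le> y \<bullet> q\<rbrakk> \<Longrightarrow>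
       \<exists>z\<in>V. (\<forall>p\<in>P. z \<bullet> p \<le> 1) \<and> (\<forall>q\<in>Q. z \<bullet> q = 1)"
    by (rule almost_active_vertices_coactive[OF V P(1)]) blast
  have "common_face_gap V \<nu> P \<epsilon>"
    unfolding common_face_gap_def
  proof (intro allI impI, elim conjE)
    fix r :: real and H :: "(('e \<Rightarrow> real) \<times> 'e) set"
    assume r: "r > 0" and "H \<noteq> {}"
      and "\<forall>\<eta> w. (\<eta>, w) \<in> H \<longrightarrow> w \<in> V \<and> \<nu> w = r \<and> \<eta> \<in> energy_subdifferential V \<nu> w"
      and "\<forall>\<eta> w \<eta>' w'. (\<eta>, w) \<in> H \<and> (\<eta>', w') \<in> H \<longrightarrow> (\<forall>p\<in>P. \<bar>\<eta> p - \<eta>' p\<bar> \<le> \<epsilon> * r)"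
    then have H: "\<And>\<eta> w. (\<eta>, w) \<in> H \<Longrightarrow> w \<in> V \<and> \<nu> w = r \<and> \<eta> \<in> energy_subdifferential V \<nu> w"
      and close: "\<And>\<eta> w \<eta>' w' p. (\<eta>, w) \<in> H \<Longrightarrow> (\<eta>', w') \<in> H \<Longrightarrow> p \<in> P \<Longrightarrow> \<bar>\<eta> p - \<eta>' p\<bar> \<le> \<epsilon> * r"
      by blast+
    have H2: "\<eta> \<in> dual_of V" "\<eta> w = r\<^sup>2" "\<And>p. p \<in> P \<Longrightarrow> \<eta> p \<le> r" if "(\<eta>, w) \<in> H" for \<eta> w
    proof -
      have w: "w \<in> V" "\<nu> w = r" "\<eta> \<in> energy_subdifferential V \<nu> w" using H that by auto
      show "\<eta> \<in> dual_of V" using w by (simp add: energy_subdifferential_def)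
      show "\<eta> w = r\<^sup>2" using energy_subdifferential_max(1)[OF \<nu> V w(3,1)] w(2) by simp
      show "\<eta> p \<le> r" if "p \<in> P" for p
      proof -
        have "\<eta> p \<le> r * \<nu> p" using energy_subdifferential_max(2)[OF \<nu> V w(3,1) PK(1)[OF that]] w(2) by simp
        also have "\<dots> \<le> r * 1" using PK(2)[OF that] r by (intro mult_left_mono) auto
        finally show ?thesis by simp
      qed
    qed
    define Q where "Q = {p \<in> P. \<exists>\<eta> w. (\<eta>, w) \<in> H \<and> \<eta> p = r}"
    have "Q \<subseteq> P" by (auto simp: Q_def)
    have w_in_hull: "\<exists>c. (\<forall>p\<in>P. 0 \<le> c p) \<and> sum c P = 1 \<and> (\<Sum>p\<in>P. c p *\<^sub>R p) = (1 / r) *\<^sub>R w \<and>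
        (\<forall>p\<in>P. c p \<noteq> 0 \<longrightarrow> p \<in> Q)" if "(\<eta>, w) \<in> H" for \<eta> w
    proof -
      have w: "w \<in> V" "\<nu> w = r" using H that by auto
      then have "(1 / r) *\<^sub>R w \<in> convex hull P"
        using P(2)[symmetric] V r norm_onD(3)[OF \<nu> w(1)] by (auto simp: subspace_scale)
      then obtain c where c: "\<forall>p\<in>P. 0 \<le> c p" "sum c P = 1" "(\<Sum>p\<in>P. c p *\<^sub>R p) = (1 / r) *\<^sub>R w"
        using convex_hull_finite[OF P(1)] by auto
      have "(\<Sum>p\<in>P. c p * \<eta> p) = \<eta> ((1 / r) *\<^sub>R w)"
        using dual_of_sum[OF H2(1)[OF that] V P(1)] PK(1) c(3) by (metis subsetI)
      also have "\<dots> = r" using dual_ofD(2)[OF H2(1)[OF that] w(1)] H2(2)[OF that] r by (simp add: power2_eq_square)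
      finally have "(\<Sum>p\<in>P. c p * (r - \<eta> p)) = 0"
        using c(2) by (simp add: right_diff_distrib sum_subtractf flip: sum_distrib_right)
      moreover have "\<And>p. p \<in> P \<Longrightarrow> 0 \<le> c p * (r - \<eta> p)" using c(1) H2(3)[OF that] by simp
      ultimately have "\<forall>p\<in>P. c p * (r - \<eta> p) = 0"
        using sum_nonneg_eq_0_iff[OF P(1), of "\<lambda>p. c p * (r - \<eta> p)"] by simp
      then have "\<forall>p\<in>P. c p \<noteq> 0 \<longrightarrow> p \<in> Q" using that unfolding Q_def by auto
      then show ?thesis using c by blast
    qed
    obtain \<eta>1 w1 where 1: "(\<eta>1, w1) \<in> H" using \<open>H \<noteq> {}\<close> by auto
    obtain y where y: "y \<in> V" "\<And>v. v \<in> V \<Longrightarrow> \<eta>1 v = y \<bullet> v"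
      using dual_of_representation[OF H2(1)[OF 1] V] by blast
    have "(1 / r) *\<^sub>R y \<in> V" using y V by (simp add: subspace_scale)
    moreover have "\<forall>p\<in>P. ((1 / r) *\<^sub>R y) \<bullet> p \<le> 1"
      using H2(3)[OF 1] y(2) PK(1) r by simp
    moreover have "\<forall>q\<in>Q. 1 - \<epsilon> \<le> ((1 / r) *\<^sub>R y) \<bullet> q"
    proof
      fix q assume "q \<in> Q"
      then obtain \<eta> w where q: "q \<in> P" "(\<eta>, w) \<in> H" "\<eta> q = r" by (auto simp: Q_def)
      have "r - \<epsilon> * r \<le> y \<bullet> q" using close[OF 1 q(2,1)] q(3) y(2)[OF PK(1)[OF q(1)]] by linarith
      then show "1 - \<epsilon> \<le> ((1 / r) *\<^sub>R y) \<bullet> q" using r by (simp add: field_simps)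
    qed
    ultimately obtain z where z: "z \<in> V" "\<forall>p\<in>P. z \<bullet> p \<le> 1" "\<forall>q\<in>Q. z \<bullet> q = 1"
      using \<epsilon>(2)[OF \<open>Q \<subseteq> P\<close>] by blast
    define F where "F = {v \<in> {v \<in> V. \<nu> v \<le> r}. \<forall>w\<in>{v \<in> V. \<nu> v \<le> r}. z \<bullet> w \<le> z \<bullet> v}"
    have zle: "z \<bullet> v \<le> r" if "v \<in> V" "\<nu> v \<le> r" for v
    proof -
      have "z \<bullet> ((1 / r) *\<^sub>R v) \<le> 1"
        using that r V norm_onD(3)[OF \<nu> that(1)] by (intro hull_le z(2)) (auto simp: subspace_scale)
      then show ?thesis using r by (simp add: divide_le_eq)
    qed
    have zw: "z \<bullet> w = r" if mem: "(\<eta>, w) \<in> H" for \<eta> w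
    proof -
      obtain c where c: "sum c P = 1" "(\<Sum>p\<in>P. c p *\<^sub>R p) = (1 / r) *\<^sub>R w" "\<forall>p\<in>P. c p \<noteq> 0 \<longrightarrow> p \<in> Q"
        using w_in_hull[OF mem] by blast
      have "z \<bullet> ((1 / r) *\<^sub>R w) = (\<Sum>p\<in>P. c p * (z \<bullet> p))" by (simp add: inner_sum_right flip: c(2))
      also have "\<dots> = (\<Sum>p\<in>P. c p)" using c(3) z(3) by (intro sum.cong) auto
      finally show ?thesis using c(1) r by (simp add: field_simps)
    qed
    have "(\<lambda>v. z \<bullet> v) \<in> dual_of V" by (simp add: dual_of_def inner_add_right)
    moreover have "\<exists>v\<in>V. z \<bullet> v \<noteq> 0" using zw[OF 1] H[OF 1] r by (intro bexI[of _ w1]) auto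
    ultimately have "face_of_sphere V \<nu> r F"
      unfolding face_of_sphere_def Let_def F_def by blast
    moreover have "snd ` H \<subseteq> F"
    proof
      fix w assume "w \<in> snd ` H"
      then obtain \<eta> where "(\<eta>, w) \<in> H" by force
      then show "w \<in> F" using zw[of \<eta> w] zle H[of \<eta> w] by (simp add: F_def)
    qed
    ultimately show "\<exists>F. face_of_sphere V \<nu> r F \<and> snd ` H \<subseteq> F" by blast
  qed
  with \<epsilon>(1) P show thesis by (rule that)
qed

section \<open>Differentials in charts\<close>

text \<open>
  The differential of \<open>f\<close> at \<open>p\<close> in any charts around \<open>p\<close> and \<open>f p\<close>, not only in the preferred
  ones: near the identity everything is computed in the single chart chosen there.
\<close>

definition has_chart_derivative ::
  "('m, 'e::real_normed_vector) chart \<Rightarrow> ('n, 'f::real_normed_vector) chart \<Rightarrow> ('m \<Rightarrow> 'n) \<Rightarrow> 'm \<Rightarrow> ('e \<Rightarrow> 'f) \<Rightarrow> bool" where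
  "has_chart_derivative c d f p D \<longleftrightarrow> ((snd d \<circ> f \<circ> chart_inv c) has_derivative D) (at (snd c p))"

lemma has_chart_derivative_unique:
  "has_chart_derivative c d f p D \<Longrightarrow> has_chart_derivative c d f p D' \<Longrightarrow> D = D'"
  unfolding has_chart_derivative_def by (rule has_derivative_unique)

lemma has_chart_derivative_linear: "has_chart_derivative c d f p D \<Longrightarrow> linear D"
  unfolding has_chart_derivative_def by (rule has_derivative_linear)

lemma smooth_atlas_chartD:
  assumes "smooth_atlas A" "c \<in> A"
  shows "open (fst c)" "open (snd c ` fst c)" "continuous_on (fst c) (snd c)"
    "continuous_on (snd c ` fst c) (chart_inv c)" "inj_on (snd c) (fst c)"
    "\<And>p. p \<in> fst c \<Longrightarrow> chart_inv c (snd c p) = p"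
proof -
  have h: "homeomorphism (fst c) (snd c ` fst c) (snd c) (chart_inv c)"
    using assms unfolding smooth_atlas_def by blast
  then show "continuous_on (fst c) (snd c)" "continuous_on (snd c ` fst c) (chart_inv c)"
    "\<And>p. p \<in> fst c \<Longrightarrow> chart_inv c (snd c p) = p"
    by (auto simp: homeomorphism_def)
  then show "inj_on (snd c) (fst c)" by (metis inj_onI)
  show "open (fst c)" "open (snd c ` fst c)" using assms unfolding smooth_atlas_def by blast+
qed

lemma chart_inv_image:
  assumes "smooth_atlas A" "c \<in> A" "x \<in> snd c ` fst c"
  shows "chart_inv c x \<in> fst c" "snd c (chart_inv c x) = x"
  using assms smooth_atlas_chartD(6)[OF assms(1,2)] by auto

lemma chart_at_in:
  assumes "smooth_atlas A"
  shows "chart_at A p \<in> A" "p \<in> fst (chart_at A p)"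
proof -
  have "\<exists>c. c \<in> A \<and> p \<in> fst c" using assms unfolding smooth_atlas_def by blast
  then have "chart_at A p \<in> A \<and> p \<in> fst (chart_at A p)" unfolding chart_at_def by (rule someI_ex)
  then show "chart_at A p \<in> A" "p \<in> fst (chart_at A p)" by auto
qed

lemma open_chart_preimage:
  assumes "smooth_atlas A" "c \<in> A" "continuous_on UNIV f" "open U"
  shows "open {x \<in> snd c ` fst c. f (chart_inv c x) \<in> U}"
proof -
  have "continuous_on (snd c ` fst c) (\<lambda>x. f (chart_inv c x))"
    using continuous_on_compose2[OF assms(3) smooth_atlas_chartD(4)[OF assms(1,2)]] by simp
  then have "open (snd c ` fst c \<inter> (\<lambda>x. f (chart_inv c x)) -` U)"
    using smooth_atlas_chartD(2)[OF assms(1,2)] assms(4) by (intro continuous_open_preimage)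
  then show ?thesis by (simp add: vimage_def Int_def)
qed

lemma has_chart_derivative_compose:
  assumes A: "smooth_atlas A" "c \<in> A" "p \<in> fst c" and B: "smooth_atlas B" "d \<in> B" "f p \<in> fst d"
    and f: "continuous_on UNIV f"
    and D: "has_chart_derivative c d f p D" and D': "has_chart_derivative d e g (f p) D'"
  shows "has_chart_derivative c e (g \<circ> f) p (D' \<circ> D)"
proof -
  let ?\<phi> = "snd d \<circ> f \<circ> chart_inv c"
  have px: "?\<phi> (snd c p) = snd d (f p)" using smooth_atlas_chartD(6)[OF A] by simp
  have d1: "(?\<phi> has_derivative D) (at (snd c p))"
    using D by (simp only: has_chart_derivative_def)
  have d2: "((snd e \<circ> g \<circ> chart_inv d) has_derivative D') (at (?\<phi> (snd c p)))"
    using D' by (simp only: has_chart_derivative_def px)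
  have "((\<lambda>x. (snd e \<circ> g \<circ> chart_inv d) (?\<phi> x)) has_derivative (\<lambda>x. D' (D x))) (at (snd c p))"
    by (rule has_derivative_compose[OF d1 d2])
  then have "((snd e \<circ> (g \<circ> f) \<circ> chart_inv c) has_derivative (\<lambda>x. D' (D x))) (at (snd c p))"
  proof (rule has_derivative_transform_within_open)
    show "open {x \<in> snd c ` fst c. f (chart_inv c x) \<in> fst d}"
      using open_chart_preimage[OF A(1,2) f] smooth_atlas_chartD(1)[OF B(1,2)] by blast
    show "snd c p \<in> {x \<in> snd c ` fst c. f (chart_inv c x) \<in> fst d}"
      using A(3) B(3) smooth_atlas_chartD(6)[OF A] by auto
    fix x assume "x \<in> {x \<in> snd c ` fst c. f (chart_inv c x) \<in> fst d}"
    then show "(snd e \<circ> g \<circ> chart_inv d) (?\<phi> x) = (snd e \<circ> (g \<circ> f) \<circ> chart_inv c) x"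
      using smooth_atlas_chartD(6)[OF B(1,2)] by simp
  qed
  then show ?thesis unfolding has_chart_derivative_def comp_def[of D'] .
qed

lemma has_chart_derivative_id:
  assumes "smooth_atlas A" "c \<in> A" "p \<in> fst c"
  shows "has_chart_derivative c c (\<lambda>x. x) p (\<lambda>v. v)"
  unfolding has_chart_derivative_def
proof (rule has_derivative_transform_within_open[OF has_derivative_ident])
  show "open (snd c ` fst c)" using smooth_atlas_chartD(2)[OF assms(1,2)] .
  show "x = (snd c \<circ> (\<lambda>x. x) \<circ> chart_inv c) x" if "x \<in> snd c ` fst c" for x
    using chart_inv_image(2)[OF assms(1,2) that] by simp
qed (use assms in auto)

lemma chart_transition_derivative:
  assumes A: "smooth_atlas A" "c \<in> A" "d \<in> A" "p \<in> fst c" "p \<in> fst d"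
  obtains T where "has_chart_derivative c d (\<lambda>x. x) p T"
    "T = frechet_derivative (snd d \<circ> chart_inv c) (at (snd c p))"
proof -
  have "Ck_on (Suc 0) (snd c ` (fst c \<inter> fst d)) (snd d \<circ> chart_inv c)"
    using A(1-3) unfolding smooth_atlas_def smooth_on_def by blast
  then have "(snd d \<circ> chart_inv c) differentiable (at (snd c p))"
    by (rule Ck_on_differentiable) (use A in auto)
  then show thesis
    using that has_derivative_frechet unfolding has_chart_derivative_def comp_def by blast
qed

lemma continuous_on_nbhd_in_chart:
  fixes \<gamma> :: "real \<Rightarrow> 'm::topological_space" and f :: "'m \<Rightarrow> 'n::topological_space"
  assumes "smooth_atlas A" "c \<in> A" "continuous_on I \<gamma>" "t \<in> I" "continuous_on UNIV f"
    "f (\<gamma> t) \<in> fst c" "\<epsilon> > 0"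
  obtains d where "d > 0"
    "\<And>s. s \<in> I \<Longrightarrow> \<bar>s - t\<bar> < d \<Longrightarrow> f (\<gamma> s) \<in> fst c \<and> dist (snd c (f (\<gamma> s))) (snd c (f (\<gamma> t))) < \<epsilon>"
proof -
  let ?U = "fst c \<inter> snd c -` ball (snd c (f (\<gamma> t))) \<epsilon>"
  have "open ?U"
    using smooth_atlas_chartD(1,3)[OF assms(1,2)] by (intro continuous_open_preimage) auto
  moreover have "f (\<gamma> t) \<in> ?U" using assms(6,7) by simp
  moreover have "continuous_on I (\<lambda>s. f (\<gamma> s))"
    using continuous_on_compose2[OF assms(5,3)] by simp
  then have "((\<lambda>s. f (\<gamma> s)) \<longlongrightarrow> f (\<gamma> t)) (at t within I)"
    using assms(4) by (auto simp: continuous_on_def)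
  ultimately have "\<forall>\<^sub>F s in at t within I. f (\<gamma> s) \<in> ?U" using topological_tendstoD by blast
  then obtain d where d: "d > 0" "\<forall>s\<in>I. s \<noteq> t \<and> dist s t < d \<longrightarrow> f (\<gamma> s) \<in> ?U"
    unfolding eventually_at by blast
  show thesis
  proof (rule that[OF d(1)])
    fix s assume "s \<in> I" "\<bar>s - t\<bar> < d"
    then have "f (\<gamma> s) \<in> ?U" using d(2) \<open>f (\<gamma> t) \<in> ?U\<close> by (cases "s = t") (auto simp: dist_real_def)
    then show "f (\<gamma> s) \<in> fst c \<and> dist (snd c (f (\<gamma> s))) (snd c (f (\<gamma> t))) < \<epsilon>"
      by (simp add: dist_commute)
  qed
qed

lemma has_chart_derivative_curve:
  assumes A: "smooth_atlas A" "c \<in> A" "\<gamma> t \<in> fst c" and \<gamma>: "continuous_on I \<gamma>" "t \<in> I"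
    and f: "has_chart_derivative c d f (\<gamma> t) D"
    and v: "((snd c \<circ> \<gamma>) has_vector_derivative v) (at t within I)"
  shows "((\<lambda>s. snd d (f (\<gamma> s))) has_vector_derivative D v) (at t within I)"
proof -
  have "\<exists>r>0. \<forall>s\<in>I. \<bar>s - t\<bar> < r \<longrightarrow> \<gamma> s \<in> fst c"
    by (rule continuous_on_nbhd_in_chart[OF A(1,2) \<gamma> continuous_on_id[of UNIV], of 1]) (use A(3) in auto)
  then obtain r where r: "r > 0" "\<And>s. s \<in> I \<Longrightarrow> \<bar>s - t\<bar> < r \<Longrightarrow> \<gamma> s \<in> fst c"
    by blast
  have d1: "((snd c \<circ> \<gamma>) has_derivative (\<lambda>h. h *\<^sub>R v)) (at t within I)"
    using v by (simp only: has_vector_derivative_def)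
  have d2: "((snd d \<circ> f \<circ> chart_inv c) has_derivative D) (at ((snd c \<circ> \<gamma>) t))"
    using f by (simp only: has_chart_derivative_def comp_apply[of "snd c" \<gamma>])
  have "((\<lambda>s. (snd d \<circ> f \<circ> chart_inv c) ((snd c \<circ> \<gamma>) s)) has_derivative (\<lambda>h. D (h *\<^sub>R v))) (at t within I)"
    by (rule has_derivative_compose[OF d1 d2])
  then have "((\<lambda>s. (snd d \<circ> f \<circ> chart_inv c) ((snd c \<circ> \<gamma>) s)) has_vector_derivative D v) (at t within I)"
    using has_chart_derivative_linear[OF f] by (simp add: has_vector_derivative_def linear_scale)
  then show ?thesis
  proof (rule has_vector_derivative_transform_within[OF _ r(1) \<gamma>(2)])
    show "(snd d \<circ> f \<circ> chart_inv c) ((snd c \<circ> \<gamma>) s) = snd d (f (\<gamma> s))" if "s \<in> I" "dist s t < r" for s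
      using r(2)[OF that(1)] that(2) smooth_atlas_chartD(6)[OF A(1,2)] by (simp add: dist_real_def)
  qed
qed

section \<open>Translations and the adjoint representation\<close>

context lie_group
begin

lemma in_carrier [simp]: "x \<in> carrier G"
  by (simp add: carrier_UNIV)

lemma continuous_left_mult: "continuous_on UNIV (\<lambda>h. g \<otimes> h)"
  and continuous_right_mult: "continuous_on UNIV (\<lambda>h. h \<otimes> g)"
proof -
  have c: "continuous_on UNIV (\<lambda>(g, h). g \<otimes> h)" using smooth_mult by (simp add: smooth_map_def)
  have p: "continuous_on UNIV (\<lambda>h. (g, h))" "continuous_on UNIV (\<lambda>h. (h, g))"
    by (intro continuous_on_Pair continuous_on_const continuous_on_id)+
  show "continuous_on UNIV (\<lambda>h. g \<otimes> h)" "continuous_on UNIV (\<lambda>h. h \<otimes> g)"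
    using continuous_on_compose2[OF c p(1)] continuous_on_compose2[OF c p(2)] by simp_all
qed

text \<open>
  The coordinate expression of the multiplication and its domain, in the form in which the smoothness of the
  multiplication with respect to the product atlas provides them.
\<close>

definition mult_dom :: "('g, 'e) chart \<Rightarrow> ('g, 'e) chart \<Rightarrow> ('g, 'e) chart \<Rightarrow> ('e \<times> 'e) set" where
  "mult_dom c d e = map_prod (snd c) (snd d) ` ((fst c \<times> fst d) \<inter> (\<lambda>(g, h). g \<otimes> h) -` fst e)"

definition mult_in :: "('g, 'e) chart \<Rightarrow> ('g, 'e) chart \<Rightarrow> ('g, 'e) chart \<Rightarrow> 'e \<times> 'e \<Rightarrow> 'e" where
  "mult_in c d e = snd e \<circ> (\<lambda>(g, h). g \<otimes> h) \<circ> chart_inv (fst c \<times> fst d, map_prod (snd c) (snd d))"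

context
  fixes c d e assumes cde: "c \<in> A" "d \<in> A" "e \<in> A"
begin

lemma mult_in_eq:
  assumes "g \<in> fst c" "h \<in> fst d"
  shows "mult_in c d e (snd c g, snd d h) = snd e (g \<otimes> h)"
proof -
  have "inj_on (map_prod (snd c) (snd d)) (fst c \<times> fst d)"
    using smooth_atlas_chartD(5)[OF atlas] cde by (intro map_prod_inj_on) auto
  then have "chart_inv (fst c \<times> fst d, map_prod (snd c) (snd d)) (map_prod (snd c) (snd d) (g, h)) = (g, h)"
    unfolding chart_inv_def fst_conv snd_conv using assms by (intro inv_into_f_f) auto
  then show ?thesis by (simp add: mult_in_def)
qed

lemma mult_domI: "g \<in> fst c \<Longrightarrow> h \<in> fst d \<Longrightarrow> g \<otimes> h \<in> fst e \<Longrightarrow> (snd c g, snd d h) \<in> mult_dom c d e"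
  by (force simp: mult_dom_def)

lemma Ck_on_mult_in: "Ck_on k (mult_dom c d e) (mult_in c d e)"
proof -
  have "(fst c \<times> fst d, map_prod (snd c) (snd d)) \<in> product_atlas A A"
    using cde unfolding product_atlas_def by blast
  then have "smooth_on (mult_dom c d e) (mult_in c d e)"
    using smooth_mult cde(3) unfolding smooth_map_def mult_dom_def mult_in_def by fastforce
  then show ?thesis by (simp add: smooth_on_def)
qed

lemma open_mult_dom: "open (mult_dom c d e)"
proof -
  let ?S = "snd c ` fst c \<times> snd d ` fst d"
  let ?f = "\<lambda>z. chart_inv c (fst z) \<otimes> chart_inv d (snd z)"
  have inv: "\<And>p. p \<in> fst c \<Longrightarrow> chart_inv c (snd c p) = p" "\<And>p. p \<in> fst d \<Longrightarrow> chart_inv d (snd d p) = p"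
    using smooth_atlas_chartD(6)[OF atlas] cde by auto
  have "mult_dom c d e = ?S \<inter> ?f -` fst e"
    unfolding mult_dom_def using inv by (auto simp: image_iff)
  moreover have "continuous_on ?S ?f"
  proof -
    have p: "continuous_on ?S (\<lambda>z. (chart_inv c (fst z), chart_inv d (snd z)))"
      using smooth_atlas_chartD(4)[OF atlas cde(1)] smooth_atlas_chartD(4)[OF atlas cde(2)]
      by (intro continuous_on_Pair continuous_on_compose2[of "snd c ` fst c" "chart_inv c" _ fst]
          continuous_on_compose2[of "snd d ` fst d" "chart_inv d" _ snd] continuous_intros) auto
    have m: "continuous_on UNIV (\<lambda>(g, h). g \<otimes> h)" using smooth_mult by (simp add: smooth_map_def)
    show ?thesis using continuous_on_compose2[OF m p] by (simp only: case_prod_conv subset_UNIV)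
  qed
  moreover have "open ?S"
    using smooth_atlas_chartD(2)[OF atlas] cde by (intro open_Times) auto
  ultimately show ?thesis
    using continuous_open_preimage[OF _ _ smooth_atlas_chartD(1)[OF atlas cde(3)], of ?S ?f] by simp
qed

lemma mult_in_has_derivative:
  assumes "z \<in> mult_dom c d e"
  shows "(mult_in c d e has_derivative frechet_derivative (mult_in c d e) (at z)) (at z)"
  using Ck_on_differentiable[OF Ck_on_mult_in[of "Suc 0"] assms] by (rule has_derivative_frechet)

lemma has_chart_derivative_left_mult:
  assumes g: "g \<in> fst c" and h: "h \<in> fst d" and "g \<otimes> h \<in> fst e"
  shows "has_chart_derivative d e (\<lambda>h. g \<otimes> h) h
           (\<lambda>v. frechet_derivative (mult_in c d e) (at (snd c g, snd d h)) (0, v))"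
  unfolding has_chart_derivative_def
proof (rule has_derivative_transform_within_open)
  show "((\<lambda>y. mult_in c d e (snd c g, y)) has_derivative
      (\<lambda>v. frechet_derivative (mult_in c d e) (at (snd c g, snd d h)) (0, v))) (at (snd d h))"
    by (rule has_derivative_compose[of "\<lambda>y. (snd c g, y)", OF _ mult_in_has_derivative[OF mult_domI[OF assms]]])
      (auto intro!: derivative_eq_intros)
  show "open (snd d ` fst d)" using smooth_atlas_chartD(2)[OF atlas cde(2)] .
  show "snd d h \<in> snd d ` fst d" using h by blast
  fix y assume "y \<in> snd d ` fst d"
  then obtain k where "k \<in> fst d" "y = snd d k" by blast
  then show "mult_in c d e (snd c g, y) = (snd e \<circ> (\<lambda>h. g \<otimes> h) \<circ> chart_inv d) y"
    using mult_in_eq[OF g] smooth_atlas_chartD(6)[OF atlas cde(2)] by simp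
qed

lemma has_chart_derivative_right_mult:
  assumes g: "g \<in> fst c" and h: "h \<in> fst d" and "g \<otimes> h \<in> fst e"
  shows "has_chart_derivative c e (\<lambda>g. g \<otimes> h) g
           (\<lambda>v. frechet_derivative (mult_in c d e) (at (snd c g, snd d h)) (v, 0))"
  unfolding has_chart_derivative_def
proof (rule has_derivative_transform_within_open)
  show "((\<lambda>x. mult_in c d e (x, snd d h)) has_derivative
      (\<lambda>v. frechet_derivative (mult_in c d e) (at (snd c g, snd d h)) (v, 0))) (at (snd c g))"
    by (rule has_derivative_compose[of "\<lambda>x. (x, snd d h)", OF _ mult_in_has_derivative[OF mult_domI[OF assms]]])
      (auto intro!: derivative_eq_intros)
  show "open (snd c ` fst c)" using smooth_atlas_chartD(2)[OF atlas cde(1)] .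
  show "snd c g \<in> snd c ` fst c" using g by blast
  fix x assume "x \<in> snd c ` fst c"
  then obtain k where "k \<in> fst c" "x = snd c k" by blast
  then show "mult_in c d e (x, snd d h) = (snd e \<circ> (\<lambda>g. g \<otimes> h) \<circ> chart_inv c) x"
    using mult_in_eq[OF _ h] smooth_atlas_chartD(6)[OF atlas cde(1)] by simp
qed

end

abbreviation "c1 \<equiv> chart_at A \<one>"
abbreviation "e1 \<equiv> snd (chart_at A \<one>) \<one>"

lemma c1 [simp]: "c1 \<in> A" "\<one> \<in> fst c1"
  using chart_at_in[OF atlas] by auto

lemma chart_at_mem [simp]: "chart_at A p \<in> A" "p \<in> fst (chart_at A p)"
  using chart_at_in[OF atlas] by auto

text \<open>
  Conjugation by \<open>g\<close> is differentiable because it is a left translation followed by a right translation,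
  from the chart at the identity to the one at \<open>g\<close> and back.
\<close>

lemma has_chart_derivative_Ad:
  "has_chart_derivative c1 c1 (\<lambda>h. g \<otimes> h \<otimes> inv g) \<one> (Ad G A g)"
proof -
  have 1: "has_chart_derivative c1 (chart_at A g) (\<lambda>h. g \<otimes> h) \<one>
     (\<lambda>v. frechet_derivative (mult_in (chart_at A g) c1 (chart_at A g)) (at (snd (chart_at A g) g, e1)) (0, v))"
    by (rule has_chart_derivative_left_mult) auto
  have 2: "has_chart_derivative (chart_at A g) c1 (\<lambda>h. h \<otimes> inv g) (g \<otimes> \<one>)
     (\<lambda>v. frechet_derivative (mult_in (chart_at A g) (chart_at A (inv g)) c1) (at (snd (chart_at A g) (g \<otimes> \<one>), snd (chart_at A (inv g)) (inv g))) (v, 0))"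
    by (rule has_chart_derivative_right_mult) auto
  obtain D where D: "has_chart_derivative c1 c1 ((\<lambda>h. h \<otimes> inv g) \<circ> (\<lambda>h. g \<otimes> h)) \<one> D"
    using has_chart_derivative_compose[OF atlas _ _ atlas _ _ continuous_left_mult 1 2] by auto
  then have D: "has_chart_derivative c1 c1 (\<lambda>h. g \<otimes> h \<otimes> inv g) \<one> D" by (simp add: comp_def)
  have "g \<otimes> \<one> \<otimes> inv g = \<one>" by simp
  then have "Ad G A g = frechet_derivative (snd c1 \<circ> (\<lambda>h. g \<otimes> h \<otimes> inv g) \<circ> chart_inv c1) (at e1)"
    unfolding Ad_def differential_def by simp
  also have "\<dots> = D" using D unfolding has_chart_derivative_def by (rule frechet_derivative_eqI)
  finally show ?thesis using D by simp
qed

lemma linear_Ad: "linear (Ad G A g)"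
  using has_chart_derivative_Ad by (rule has_chart_derivative_linear)

lemma continuous_conj: "continuous_on UNIV (\<lambda>h. g \<otimes> h \<otimes> inv g)"
  using continuous_on_compose2[OF continuous_right_mult[of "inv g"] continuous_left_mult[of g]] by simp

lemma Ad_mult: "Ad G A (g \<otimes> h) v = Ad G A g (Ad G A h v)"
proof -
  have one: "h \<otimes> \<one> \<otimes> inv h = \<one>" by simp
  have "has_chart_derivative c1 c1 ((\<lambda>k. g \<otimes> k \<otimes> inv g) \<circ> (\<lambda>k. h \<otimes> k \<otimes> inv h)) \<one> (Ad G A g \<circ> Ad G A h)"
    by (rule has_chart_derivative_compose[OF atlas _ _ atlas _ _ continuous_conj has_chart_derivative_Ad])
      (simp_all add: one has_chart_derivative_Ad)
  moreover have "(\<lambda>k. g \<otimes> k \<otimes> inv g) \<circ> (\<lambda>k. h \<otimes> k \<otimes> inv h) = (\<lambda>k. (g \<otimes> h) \<otimes> k \<otimes> inv (g \<otimes> h))"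
    by (rule ext) (simp add: m_assoc inv_mult_group)
  ultimately have "Ad G A g \<circ> Ad G A h = Ad G A (g \<otimes> h)"
    using has_chart_derivative_unique[OF _ has_chart_derivative_Ad] by metis
  then show ?thesis by (metis comp_apply)
qed

lemma Ad_one: "Ad G A \<one> v = v"
proof -
  have "(\<lambda>h. \<one> \<otimes> h \<otimes> inv \<one>) = (\<lambda>h. h)" by (rule ext) simp
  then have "Ad G A \<one> = (\<lambda>v. v)"
    using has_chart_derivative_unique[OF has_chart_derivative_Ad[of \<one>]] has_chart_derivative_id[OF atlas c1] by metis
  then show ?thesis by simp
qed

lemma has_chart_derivative_dL:
  "has_chart_derivative c1 (chart_at A g) (\<lambda>h. g \<otimes> h) \<one> (dL G A g)"
proof -
  have D: "has_chart_derivative c1 (chart_at A g) (\<lambda>h. g \<otimes> h) \<one>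
     (\<lambda>v. frechet_derivative (mult_in (chart_at A g) c1 (chart_at A g)) (at (snd (chart_at A g) g, e1)) (0, v))"
    (is "has_chart_derivative _ _ _ _ ?D")
    by (rule has_chart_derivative_left_mult) auto
  have "dL G A g = ?D"
    unfolding dL_def differential_def r_one[OF in_carrier]
    using D unfolding has_chart_derivative_def by (rule frechet_derivative_eqI)
  then show ?thesis using D by simp
qed

lemma linear_dL: "linear (dL G A g)"
  using has_chart_derivative_dL by (rule has_chart_derivative_linear)

text \<open>
  Recovers the control of a horizontal curve from its velocity.
\<close>

lemma left_translation_back:
  obtains D where "has_chart_derivative (chart_at A g) c1 (\<lambda>h. inv g \<otimes> h) g D" "\<And>v. D (dL G A g v) = v"
proof -
  have D: "has_chart_derivative (chart_at A g) c1 (\<lambda>h. inv g \<otimes> h) g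
     (\<lambda>v. frechet_derivative (mult_in (chart_at A (inv g)) (chart_at A g) c1) (at (snd (chart_at A (inv g)) (inv g), snd (chart_at A g) g)) (0, v))"
    (is "has_chart_derivative _ _ _ _ ?D")
    by (rule has_chart_derivative_left_mult) auto
  have "has_chart_derivative c1 c1 ((\<lambda>h. inv g \<otimes> h) \<circ> (\<lambda>h. g \<otimes> h)) \<one> (?D \<circ> dL G A g)"
    by (rule has_chart_derivative_compose[OF atlas _ _ atlas _ _ continuous_left_mult has_chart_derivative_dL])
      (simp_all add: D)
  moreover have "(\<lambda>h. inv g \<otimes> h) \<circ> (\<lambda>h. g \<otimes> h) = (\<lambda>h. h)"
    by (rule ext) (simp add: m_assoc[symmetric])
  ultimately have "?D \<circ> dL G A g = (\<lambda>v. v)"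
    using has_chart_derivative_unique has_chart_derivative_id[OF atlas c1] by metis
  then have "?D (dL G A g v) = v" for v by (metis comp_apply)
  then show thesis using that[OF D] by simp
qed

end

section \<open>The differential of the adjoint representation\<close>

lemma has_derivative_quadratic_zero:
  fixes r :: "'a::real_normed_vector \<Rightarrow> 'b::real_normed_vector"
  assumes "d > 0" "C \<ge> 0" "\<And>x. norm (x - a) < d \<Longrightarrow> norm (r x) \<le> C * (norm (x - a))\<^sup>2"
  shows "(r has_derivative (\<lambda>_. 0)) (at a)"
  unfolding has_derivative_at_alt
proof (intro conjI allI impI)
  fix e :: real assume "e > 0"
  have ra: "r a = 0" using assms(3)[of a] \<open>d > 0\<close> by simp
  define d' where "d' = min d (e / (C + 1))"
  have "d' > 0" using \<open>d > 0\<close> \<open>e > 0\<close> \<open>C \<ge> 0\<close> by (simp add: d'_def)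
  moreover have "norm (r y - r a - 0) \<le> e * norm (y - a)" if "norm (y - a) < d'" for y
  proof -
    have "norm (r y) \<le> C * norm (y - a) * norm (y - a)"
      using assms(3)[of y] that by (simp add: d'_def power2_eq_square mult.assoc)
    also have "\<dots> \<le> e * norm (y - a)"
    proof (rule mult_right_mono)
      have "C * norm (y - a) \<le> (C + 1) * (e / (C + 1))"
        using that \<open>C \<ge> 0\<close> by (intro mult_mono) (auto simp: d'_def)
      then show "C * norm (y - a) \<le> e" using \<open>C \<ge> 0\<close> by simp
    qed simp
    finally show ?thesis using ra by simp
  qed
  ultimately show "\<exists>d>0. \<forall>y. norm (y - a) < d \<longrightarrow> norm (r y - r a - 0) \<le> e * norm (y - a)" by blast
qed (rule bounded_linear_zero)

context lie_group
begin

abbreviation "mu \<equiv> mult_in c1 c1 c1"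
abbreviation "Dmu z \<equiv> frechet_derivative (mult_in c1 c1 c1) (at z)"
abbreviation "D2mu v w \<equiv> frechet_derivative (\<lambda>z. Dmu z v) (at (e1, e1)) w"

lemma mult_dom_one:
  assumes "q \<in> fst c1"
  shows "(snd c1 q, e1) \<in> mult_dom c1 c1 c1" "(e1, snd c1 q) \<in> mult_dom c1 c1 c1"
  using assms by (auto intro!: mult_domI)

lemma Dmu_left:
  assumes "q \<in> fst c1"
  shows "has_chart_derivative c1 c1 (\<lambda>h. q \<otimes> h) \<one> (\<lambda>v. Dmu (snd c1 q, e1) (0, v))"
  using assms by (intro has_chart_derivative_left_mult) auto

lemma Dmu_right:
  assumes "q \<in> fst c1"
  shows "has_chart_derivative c1 c1 (\<lambda>h. h \<otimes> q) \<one> (\<lambda>v. Dmu (e1, snd c1 q) (v, 0))"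
  using assms by (intro has_chart_derivative_right_mult) auto

lemma Dmu_unit: "Dmu (e1, e1) (0, v) = v" "Dmu (e1, e1) (v, 0) = v"
proof -
  have "(\<lambda>v. Dmu (e1, e1) (0, v)) = (\<lambda>v. v)" "(\<lambda>v. Dmu (e1, e1) (v, 0)) = (\<lambda>v. v)"
    using has_chart_derivative_unique[OF Dmu_left[OF c1(2)], of "\<lambda>v. v"]
      has_chart_derivative_unique[OF Dmu_right[OF c1(2)], of "\<lambda>v. v"] has_chart_derivative_id[OF atlas c1]
    by simp_all
  then show "Dmu (e1, e1) (0, v) = v" "Dmu (e1, e1) (v, 0) = v" by metis+
qed

text \<open>
  Differentiate \<open>(q h q\<inverse>) q = q h\<close> with respect to \<open>h\<close> at the identity.  This relation determines
  \<open>Ad\<close> near the identity from first derivatives of the multiplication, and so gives the regularity of \<open>Ad\<close>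
  from that of the multiplication alone.
\<close>

lemma Dmu_Ad:
  assumes q: "q \<in> fst c1"
  shows "Dmu (e1, snd c1 q) (Ad G A q v, 0) = Dmu (snd c1 q, e1) (0, v)"
proof -
  have one: "q \<otimes> \<one> \<otimes> inv q = \<one>" by simp
  have "has_chart_derivative c1 c1 ((\<lambda>h. h \<otimes> q) \<circ> (\<lambda>h. q \<otimes> h \<otimes> inv q)) \<one>
      ((\<lambda>v. Dmu (e1, snd c1 q) (v, 0)) \<circ> Ad G A q)"
    by (rule has_chart_derivative_compose[OF atlas _ _ atlas _ _ continuous_conj has_chart_derivative_Ad])
      (simp_all add: one Dmu_right[OF q])
  moreover have "(\<lambda>h. h \<otimes> q) \<circ> (\<lambda>h. q \<otimes> h \<otimes> inv q) = (\<lambda>h. q \<otimes> h)"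
    by (rule ext) (simp add: m_assoc)
  ultimately have "(\<lambda>v. Dmu (e1, snd c1 q) (v, 0)) \<circ> Ad G A q = (\<lambda>v. Dmu (snd c1 q, e1) (0, v))"
    using has_chart_derivative_unique[OF _ Dmu_left[OF q]] by metis
  then show ?thesis by (metis comp_apply)
qed

lemma D2mu_has_derivative: "((\<lambda>z. Dmu z v) has_derivative D2mu v) (at (e1, e1))"
proof -
  have "Ck_on (Suc (Suc 0)) (mult_dom c1 c1 c1) mu" by (rule Ck_on_mult_in) auto
  then have "Ck_on (Suc 0) (mult_dom c1 c1 c1) (\<lambda>z. Dmu z v)"
    unfolding Ck_on.simps(2)[of "Suc 0"] by blast
  then have "(\<lambda>z. Dmu z v) differentiable (at (e1, e1))"
    using mult_dom_one(1)[OF c1(2)] by (rule Ck_on_differentiable)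
  then show ?thesis by (rule has_derivative_frechet)
qed

lemma linear_D2mu: "linear (D2mu v)"
  using D2mu_has_derivative by (rule has_derivative_linear)

lemma D2mu_sym: "D2mu v w = D2mu w v"
proof (rule second_derivative_symmetric)
  show "Ck_on (Suc (Suc 0)) (mult_dom c1 c1 c1) mu" by (rule Ck_on_mult_in) auto
  show "open (mult_dom c1 c1 c1)" by (rule open_mult_dom) auto
  show "(e1, e1) \<in> mult_dom c1 c1 c1" using mult_dom_one(1)[OF c1(2)] .
qed

lemma Dmu_left_has_derivative:
  "((\<lambda>x. Dmu (x, e1) (0, v)) has_derivative (\<lambda>u. D2mu (0, v) (u, 0))) (at e1)"
  by (rule has_derivative_compose[of "\<lambda>x. (x, e1)", OF _ D2mu_has_derivative])
    (auto intro!: derivative_eq_intros)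

lemma Dmu_right_has_derivative:
  "((\<lambda>x. Dmu (e1, x) (v, 0)) has_derivative (\<lambda>u. D2mu (0, u) (v, 0))) (at e1)"
proof -
  have "((\<lambda>x. Dmu (e1, x) (v, 0)) has_derivative (\<lambda>u. D2mu (v, 0) (0, u))) (at e1)"
    by (rule has_derivative_compose[of "\<lambda>x. (e1, x)", OF _ D2mu_has_derivative])
      (auto intro!: derivative_eq_intros)
  then show ?thesis by (simp only: D2mu_sym[of "(v, 0)"])
qed

text \<open>
  The field is given in the preferred chart at each point.  The chain rule, applied to the transition
  to the chart at the identity, turns it into a partial derivative of the multiplication.
\<close>

lemma left_invariant_field_in_chart:
  assumes q: "q \<in> fst c1"
  shows "field_in_chart A c1 (left_invariant_field G A X) (snd c1 q) = Dmu (snd c1 q, e1) (0, X)"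
proof -
  have inv: "chart_inv c1 (snd c1 q) = q" using smooth_atlas_chartD(6)[OF atlas c1(1) q] .
  obtain T where T: "has_chart_derivative (chart_at A q) c1 (\<lambda>x. x) q T"
    "T = frechet_derivative (snd c1 \<circ> chart_inv (chart_at A q)) (at (snd (chart_at A q) q))"
    using chart_transition_derivative[OF atlas chart_at_mem(1) c1(1) chart_at_mem(2) q] by metis
  have "has_chart_derivative c1 c1 ((\<lambda>x. x) \<circ> (\<lambda>h. q \<otimes> h)) \<one> (T \<circ> dL G A q)"
    by (rule has_chart_derivative_compose[OF atlas _ _ atlas _ _ continuous_left_mult has_chart_derivative_dL])
      (simp_all add: T(1))
  then have "has_chart_derivative c1 c1 (\<lambda>h. q \<otimes> h) \<one> (T \<circ> dL G A q)" by (simp add: comp_def)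
  then have "T \<circ> dL G A q = (\<lambda>v. Dmu (snd c1 q, e1) (0, v))"
    by (rule has_chart_derivative_unique[OF _ Dmu_left[OF q]])
  then have "T (dL G A q X) = Dmu (snd c1 q, e1) (0, X)" by (metis comp_apply)
  then show ?thesis unfolding field_in_chart_def Let_def left_invariant_field_def inv T(2)[symmetric] .
qed

lemma ad_eq_D2mu: "ad G A X Y = D2mu (0, Y) (X, 0) - D2mu (0, X) (Y, 0)"
proof -
  let ?F = "\<lambda>X. field_in_chart A c1 (left_invariant_field G A X)"
  have "(?F X has_derivative (\<lambda>u. D2mu (0, X) (u, 0))) (at e1)" for X
  proof (rule has_derivative_transform_within_open[OF Dmu_left_has_derivative])
    show "open (snd c1 ` fst c1)" using smooth_atlas_chartD(2)[OF atlas c1(1)] .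
    show "e1 \<in> snd c1 ` fst c1" using c1(2) by blast
    show "Dmu (x, e1) (0, X) = ?F X x" if "x \<in> snd c1 ` fst c1" for x
      using that left_invariant_field_in_chart by auto
  qed
  then have "frechet_derivative (?F X) (at e1) = (\<lambda>u. D2mu (0, X) (u, 0))" for X
    by (rule frechet_derivative_eqI)
  moreover have "?F X e1 = X" for X
    using left_invariant_field_in_chart[OF c1(2)] by (simp add: Dmu_unit)
  ultimately show ?thesis by (simp add: ad_def field_bracket_def Let_def)
qed

lemma linear_ad_right: "linear (ad G A X)"
proof -
  have "linear (\<lambda>Y. D2mu (0, Y) (X, 0))" unfolding D2mu_sym[of "(0, _)" "(X, 0)"]
    using linear_compose[OF _ linear_D2mu, of "\<lambda>Y. (0, Y)" "(X, 0)"] by (simp add: comp_def linear_iff)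
  moreover have "linear (\<lambda>Y. D2mu (0, X) (Y, 0))"
    using linear_compose[OF _ linear_D2mu, of "\<lambda>Y. (Y, 0)" "(0, X)"] by (simp add: comp_def linear_iff)
  ultimately show ?thesis unfolding ad_eq_D2mu by (rule linear_compose_sub)
qed

lemma ad_antisym: "ad G A X Y = - ad G A Y X"
  by (simp add: ad_eq_D2mu)

lemma linear_ad_left: "linear (\<lambda>X. ad G A X Y)"
  unfolding ad_antisym[of _ Y] by (rule linear_compose_neg[OF linear_ad_right])

lemma ad_self: "ad G A X X = 0"
  by (simp add: ad_eq_D2mu)

lemma ad_bounded:
  obtains C where "C \<ge> 0" "\<And>X Y. norm (ad G A X Y) \<le> C * norm X * norm Y"
proof -
  have "bilinear (ad G A)" unfolding bilinear_def using linear_ad_right linear_ad_left by blast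
  then obtain B where "B > 0" "\<forall>X Y. norm (ad G A X Y) \<le> B * norm X * norm Y"
    using bilinear_bounded_pos by metis
  then show thesis using that[of B] by simp
qed

text \<open>
  By \<open>Dmu_Ad\<close>, the vector \<open>Ad v\<close> at \<open>x\<close> solves a linear equation whose matrix \<open>Dmu (e1, x) (_, 0)\<close> and right
  hand side are Lipschitz in \<open>x\<close>.  At \<open>e1\<close> the matrix is the identity, so near \<open>e1\<close> its inverse has norm at
  most 2.
\<close>

lemma Ad_near_one:
  obtains d K where "d > 0" "K \<ge> 0" "cball e1 d \<subseteq> snd c1 ` fst c1"
    "\<And>x y v. \<lbrakk>x \<in> cball e1 d; y \<in> cball e1 d\<rbrakk> \<Longrightarrow>
       norm (Ad G A (chart_inv c1 x) v - Ad G A (chart_inv c1 y) v) \<le> K * norm v * norm (x - y)"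
    "\<And>x v. x \<in> cball e1 d \<Longrightarrow> norm (Dmu (e1, x) (v, 0) - v) \<le> K * norm (x - e1) * norm v"
proof -
  have "Ck_on (Suc (Suc 0)) (mult_dom c1 c1 c1) mu" by (rule Ck_on_mult_in) auto
  moreover have "open (mult_dom c1 c1 c1)" by (rule open_mult_dom) auto
  ultimately obtain d0 K where K: "d0 > 0" "K \<ge> 0" "cball (e1, e1) d0 \<subseteq> mult_dom c1 c1 c1"
    "\<And>y z v. \<lbrakk>y \<in> cball (e1, e1) d0; z \<in> cball (e1, e1) d0\<rbrakk> \<Longrightarrow>
       norm (Dmu y v - Dmu z v) \<le> K * norm (y - z) * norm v"
    using Ck2_derivative_locally_lipschitz mult_dom_one(1)[OF c1(2)] by metis
  have "\<exists>r>0. cball e1 r \<subseteq> snd c1 ` fst c1"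
    using smooth_atlas_chartD(2)[OF atlas c1(1)] c1(2) open_contains_cball by blast
  then obtain d1 where d1: "d1 > 0" "cball e1 d1 \<subseteq> snd c1 ` fst c1" by blast
  define d where "d = min (min d0 d1) (1 / (2 * (K + 1)))"
  have d: "d > 0" "d \<le> d0" "d \<le> d1" "K * d \<le> 1 / 2"
  proof -
    show "d > 0" "d \<le> d0" "d \<le> d1" using K(1,2) d1 by (auto simp: d_def)
    have "K * d \<le> (K + 1) * (1 / (2 * (K + 1)))" using K(2) \<open>d > 0\<close> by (intro mult_mono) (auto simp: d_def)
    also have "\<dots> = 1 / 2" using K(2) by simp
    finally show "K * d \<le> 1 / 2" .
  qed
  have sub: "cball e1 d \<subseteq> snd c1 ` fst c1" using d1 d(3) by (meson subset_cball subset_trans)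
  let ?w = "\<lambda>x v. Ad G A (chart_inv c1 x) v"
  have mem: "(x, e1) \<in> cball (e1, e1) d0" "(e1, x) \<in> cball (e1, e1) d0" if "x \<in> cball e1 d" for x
    using that d(2) by (auto simp: dist_Pair_Pair)
  have L: "norm (Dmu (x, e1) (0, v) - Dmu (y, e1) (0, v)) \<le> K * norm (x - y) * norm v"
    "norm (Dmu (e1, x) (v, 0) - Dmu (e1, y) (v, 0)) \<le> K * norm (x - y) * norm v"
    if "x \<in> cball e1 d" "y \<in> cball e1 d" for x y v
    using K(4)[OF mem(1)[OF that(1)] mem(1)[OF that(2)], of "(0, v)"]
      K(4)[OF mem(2)[OF that(1)] mem(2)[OF that(2)], of "(v, 0)"] by (simp_all add: norm_Pair)
  have e1d: "e1 \<in> cball e1 d" using d(1) by simp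
  have small: "K * norm (x - e1) * norm v \<le> norm v / 2" if "x \<in> cball e1 d" for x and v :: 'e
  proof -
    have "K * norm (x - e1) \<le> K * d" using that K(2) by (intro mult_left_mono) (auto simp: dist_norm norm_minus_commute)
    then have "K * norm (x - e1) * norm v \<le> 1 / 2 * norm v" using d(4) by (intro mult_right_mono) auto
    then show ?thesis by simp
  qed
  have R: "norm (Dmu (e1, x) (v, 0) - v) \<le> K * norm (x - e1) * norm v" if "x \<in> cball e1 d" for x v
    using L(2)[OF that e1d] by (simp add: Dmu_unit)
  have inv_le: "norm v \<le> 2 * norm (Dmu (e1, x) (v, 0))" if "x \<in> cball e1 d" for x v
  proof -
    have "norm v \<le> norm (Dmu (e1, x) (v, 0)) + norm (Dmu (e1, x) (v, 0) - v)"
      using norm_triangle_ineq4[of "Dmu (e1, x) (v, 0)" "Dmu (e1, x) (v, 0) - v"] by simp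
    then show ?thesis using R[OF that, of v] small[OF that, of v] by simp
  qed
  have RL: "Dmu (e1, x) (?w x v, 0) = Dmu (x, e1) (0, v)" if "x \<in> cball e1 d" for x v
  proof -
    have "chart_inv c1 x \<in> fst c1" "snd c1 (chart_inv c1 x) = x"
      using chart_inv_image[OF atlas c1(1)] sub that by auto
    then show ?thesis using Dmu_Ad by metis
  qed
  have w_le: "norm (?w x v) \<le> 4 * norm v" if "x \<in> cball e1 d" for x v
  proof -
    have "norm (Dmu (x, e1) (0, v) - v) \<le> norm v / 2"
      using L(1)[OF that e1d, of v] small[OF that, of v] by (simp add: Dmu_unit)
    moreover have "norm (Dmu (x, e1) (0, v)) \<le> norm (Dmu (x, e1) (0, v) - v) + norm v"
      using norm_triangle_ineq[of "Dmu (x, e1) (0, v) - v" v] by simp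
    ultimately have "norm (Dmu (x, e1) (0, v)) \<le> 2 * norm v"
      using norm_ge_zero[of v] by linarith
    then show ?thesis using inv_le[OF that, of "?w x v"] RL[OF that, of v] by simp
  qed
  have lin: "linear (\<lambda>v. Dmu (e1, x) (v, 0))" if "x \<in> cball e1 d" for x
  proof -
    have "(e1, x) \<in> mult_dom c1 c1 c1" using mem(2)[OF that] K(3) by blast
    then have "linear (Dmu (e1, x))" using mult_in_has_derivative[OF c1(1) c1(1) c1(1)] has_derivative_linear by blast
    then show ?thesis using linear_compose[of "\<lambda>v. (v, 0)" "Dmu (e1, x)"] by (simp add: comp_def linear_iff)
  qed
  have lip: "norm (?w x v - ?w y v) \<le> 10 * K * norm v * norm (x - y)" if x: "x \<in> cball e1 d" and y: "y \<in> cball e1 d" for x y v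
  proof -
    have "Dmu (e1, x) (?w x v - ?w y v, 0) =
       (Dmu (x, e1) (0, v) - Dmu (y, e1) (0, v)) - (Dmu (e1, x) (?w y v, 0) - Dmu (e1, y) (?w y v, 0))"
      using linear_diff[OF lin[OF x], of "?w x v" "?w y v"] RL[OF x, of v] RL[OF y, of v] by simp
    then have "norm (Dmu (e1, x) (?w x v - ?w y v, 0)) \<le>
        norm (Dmu (x, e1) (0, v) - Dmu (y, e1) (0, v)) + norm (Dmu (e1, x) (?w y v, 0) - Dmu (e1, y) (?w y v, 0))"
      by (simp only: norm_triangle_ineq4)
    also have "\<dots> \<le> K * norm (x - y) * norm v + K * norm (x - y) * (4 * norm v)"
    proof (rule add_mono[OF L(1)[OF x y]])
      have "norm (Dmu (e1, x) (?w y v, 0) - Dmu (e1, y) (?w y v, 0)) \<le> K * norm (x - y) * norm (?w y v)"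
        by (rule L(2)[OF x y])
      also have "\<dots> \<le> K * norm (x - y) * (4 * norm v)" using w_le[OF y] K(2) by (intro mult_left_mono) auto
      finally show "norm (Dmu (e1, x) (?w y v, 0) - Dmu (e1, y) (?w y v, 0)) \<le> K * norm (x - y) * (4 * norm v)" .
    qed
    finally show ?thesis using inv_le[OF x, of "?w x v - ?w y v"] by (simp add: algebra_simps)
  qed
  show thesis
  proof (rule that[OF d(1) _ sub])
    show "10 * K \<ge> 0" using K(2) by simp
    show "norm (Dmu (e1, x) (v, 0) - v) \<le> 10 * K * norm (x - e1) * norm v" if "x \<in> cball e1 d" for x v
      using R[OF that, of v] K(2) by (simp add: mult.assoc) (smt (verit) mult_nonneg_nonneg norm_ge_zero)
  qed (use lip in auto)
qed

text \<open>
  Differentiating \<open>Dmu_Ad\<close> at the identity expresses the differential of \<open>Ad\<close> as a difference of two mixed second derivatives of the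
  multiplication.  After exchanging the order of differentiation in one of them, this is the
  coordinate formula for the bracket of left invariant fields.
\<close>

lemma Ad_has_derivative_at_one:
  "((\<lambda>x. Ad G A (chart_inv c1 x) Y) has_derivative (\<lambda>X. ad G A X Y)) (at e1)"
proof -
  obtain d K where dK: "d > 0" "K \<ge> 0" "cball e1 d \<subseteq> snd c1 ` fst c1"
    "\<And>x y v. \<lbrakk>x \<in> cball e1 d; y \<in> cball e1 d\<rbrakk> \<Longrightarrow>
       norm (Ad G A (chart_inv c1 x) v - Ad G A (chart_inv c1 y) v) \<le> K * norm v * norm (x - y)"
    "\<And>x v. x \<in> cball e1 d \<Longrightarrow> norm (Dmu (e1, x) (v, 0) - v) \<le> K * norm (x - e1) * norm v"
    using Ad_near_one by metis
  let ?w = "\<lambda>x. Ad G A (chart_inv c1 x) Y"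
  have w1: "?w e1 = Y" using smooth_atlas_chartD(6)[OF atlas c1] by (simp add: Ad_one)
  \<comment> \<open>The remainder is \<open>(1 - R x) (?w x - Y)\<close> with \<open>R x = Dmu (e1, x) (_, 0)\<close>, where both factors are
    Lipschitz and vanish at \<open>e1\<close>, hence it is quadratically small.\<close>
  let ?r = "\<lambda>x. ?w x - Y + Dmu (e1, x) (Y, 0) - Dmu (e1, x) (?w x, 0)"
  have "(?r has_derivative (\<lambda>_. 0)) (at e1)"
  proof (rule has_derivative_quadratic_zero[OF dK(1), of "K * K * norm Y"])
    fix x assume "norm (x - e1) < d"
    then have x: "x \<in> cball e1 d" and e: "e1 \<in> cball e1 d"
      using dK(1) by (auto simp: dist_norm norm_minus_commute)
    have q: "chart_inv c1 x \<in> fst c1" "snd c1 (chart_inv c1 x) = x"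
      using chart_inv_image[OF atlas c1(1)] dK(3) x by auto
    have "linear (Dmu (e1, x))"
      using mult_in_has_derivative[OF c1(1) c1(1) c1(1)] mult_dom_one(2)[OF q(1)] q(2) has_derivative_linear by metis
    then have "Dmu (e1, x) ((?w x, 0) - (Y, 0)) = Dmu (e1, x) (?w x, 0) - Dmu (e1, x) (Y, 0)"
      by (rule linear_diff)
    then have "Dmu (e1, x) (?w x - Y, 0) = Dmu (e1, x) (?w x, 0) - Dmu (e1, x) (Y, 0)" by simp
    then have "?r x = - (Dmu (e1, x) (?w x - Y, 0) - (?w x - Y))" by simp
    then have "norm (?r x) = norm (Dmu (e1, x) (?w x - Y, 0) - (?w x - Y))"
      by (simp only: norm_minus_cancel)
    also have "\<dots> \<le> K * norm (x - e1) * norm (?w x - Y)" by (rule dK(5)[OF x])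
    also have "\<dots> \<le> K * norm (x - e1) * (K * norm Y * norm (x - e1))"
      using dK(4)[OF x e, of Y] w1 dK(2) by (intro mult_left_mono) auto
    finally show "norm (?r x) \<le> K * K * norm Y * (norm (x - e1))\<^sup>2" by (simp add: power2_eq_square algebra_simps)
  qed (use dK in simp)
  then have "((\<lambda>x. ?r x + (Dmu (x, e1) (0, Y) - Dmu (e1, x) (Y, 0) + Y)) has_derivative
      (\<lambda>X. 0 + (D2mu (0, Y) (X, 0) - D2mu (0, X) (Y, 0) + 0))) (at e1)"
    by (intro has_derivative_add has_derivative_diff Dmu_left_has_derivative Dmu_right_has_derivative has_derivative_const)
  then have "((\<lambda>x. ?r x + (Dmu (x, e1) (0, Y) - Dmu (e1, x) (Y, 0) + Y)) has_derivative (\<lambda>X. ad G A X Y)) (at e1)"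
    by (simp add: ad_eq_D2mu)
  then show ?thesis
  proof (rule has_derivative_transform_within_open)
    show "open (snd c1 ` fst c1)" using smooth_atlas_chartD(2)[OF atlas c1(1)] .
    show "e1 \<in> snd c1 ` fst c1" using c1(2) by blast
    fix x assume "x \<in> snd c1 ` fst c1"
    then have "chart_inv c1 x \<in> fst c1" "snd c1 (chart_inv c1 x) = x"
      using chart_inv_image[OF atlas c1(1)] by auto
    then have "Dmu (e1, x) (?w x, 0) = Dmu (x, e1) (0, Y)" using Dmu_Ad by metis
    then show "?r x + (Dmu (x, e1) (0, Y) - Dmu (e1, x) (Y, 0) + Y) = ?w x" by simp
  qed
qed

section \<open>The adjoint representation along curves\<close>

text \<open>
  Since \<open>Ad\<close> is multiplicative, \<open>Ad (\<gamma> s) = Ad (\<gamma> t) \<circ> Ad (inv (\<gamma> t) \<otimes> \<gamma> s)\<close>, and the curve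
  \<open>s \<mapsto> inv (\<gamma> t) \<otimes> \<gamma> s\<close> passes through the identity with velocity \<open>v\<close> at time \<open>t\<close>.
\<close>

lemma Ad_along_curve_has_derivative:
  assumes \<gamma>: "continuous_on I \<gamma>" "t \<in> I" and v: "has_velocity A \<gamma> (dL G A (\<gamma> t) v) t I"
  shows "((\<lambda>s. Ad G A (\<gamma> s) Y) has_vector_derivative Ad G A (\<gamma> t) (ad G A v Y)) (at t within I)"
proof -
  let ?g = "\<gamma> t"
  obtain D where D: "has_chart_derivative (chart_at A ?g) c1 (\<lambda>h. inv ?g \<otimes> h) ?g D" "\<And>v. D (dL G A ?g v) = v"
    using left_translation_back by metis
  have \<sigma>: "((\<lambda>s. snd c1 (inv ?g \<otimes> \<gamma> s)) has_vector_derivative v) (at t within I)"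
    using has_chart_derivative_curve[OF atlas chart_at_mem \<gamma> D(1) v[unfolded has_velocity_def]] D(2) by simp
  have d1: "((\<lambda>s. snd c1 (inv ?g \<otimes> \<gamma> s)) has_derivative (\<lambda>h. h *\<^sub>R v)) (at t within I)"
    using \<sigma> by (simp only: has_vector_derivative_def)
  have "inv ?g \<otimes> ?g = \<one>" by simp
  then have d2: "((\<lambda>x. Ad G A (chart_inv c1 x) Y) has_derivative (\<lambda>X. ad G A X Y)) (at (snd c1 (inv ?g \<otimes> \<gamma> t)))"
    using Ad_has_derivative_at_one by simp
  have d3: "((\<lambda>s. Ad G A (chart_inv c1 (snd c1 (inv ?g \<otimes> \<gamma> s))) Y) has_derivative (\<lambda>h. ad G A (h *\<^sub>R v) Y)) (at t within I)"
    by (rule has_derivative_compose[OF d1 d2])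
  have "(Ad G A ?g has_derivative Ad G A ?g) (at z)" for z
    using linear_Ad by (intro bounded_linear_imp_has_derivative) (simp add: linear_conv_bounded_linear)
  from has_derivative_compose[OF d3 this]
  have "((\<lambda>s. Ad G A ?g (Ad G A (chart_inv c1 (snd c1 (inv ?g \<otimes> \<gamma> s))) Y)) has_vector_derivative Ad G A ?g (ad G A v Y)) (at t within I)"
    using linear_scale[OF linear_ad_left[of Y]] linear_scale[OF linear_Ad] by (simp add: has_vector_derivative_def)
  moreover have "\<exists>r>0. \<forall>s\<in>I. \<bar>s - t\<bar> < r \<longrightarrow> inv ?g \<otimes> \<gamma> s \<in> fst c1"
    by (rule continuous_on_nbhd_in_chart[OF atlas c1(1) \<gamma> continuous_left_mult[of "inv ?g"], of 1]) auto
  then obtain r where r: "r > 0" "\<And>s. s \<in> I \<Longrightarrow> \<bar>s - t\<bar> < r \<Longrightarrow> inv ?g \<otimes> \<gamma> s \<in> fst c1" by blast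
  ultimately show ?thesis
  proof (elim has_vector_derivative_transform_within[OF _ r(1) \<gamma>(2)])
    fix s assume s: "s \<in> I" "dist s t < r"
    then have "chart_inv c1 (snd c1 (inv ?g \<otimes> \<gamma> s)) = inv ?g \<otimes> \<gamma> s"
      using r(2) smooth_atlas_chartD(6)[OF atlas c1(1)] by (simp add: dist_real_def)
    then have "Ad G A ?g (Ad G A (chart_inv c1 (snd c1 (inv ?g \<otimes> \<gamma> s))) Y) = Ad G A (?g \<otimes> (inv ?g \<otimes> \<gamma> s)) Y"
      by (simp add: Ad_mult)
    also have "?g \<otimes> (inv ?g \<otimes> \<gamma> s) = \<gamma> s" by (simp add: m_assoc[symmetric])
    finally show "Ad G A ?g (Ad G A (chart_inv c1 (snd c1 (inv ?g \<otimes> \<gamma> s))) Y) = Ad G A (\<gamma> s) Y" .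
  qed
qed

text \<open>
  The same factorisation reduces the claim to points near the identity, where \<open>Ad\<close> is Lipschitz in
  coordinates; left translation by the inverse of \<open>\<gamma> t\<close> is Lipschitz near \<open>\<gamma> t\<close>.
\<close>

lemma Ad_along_curve_abs_continuous:
  assumes ac: "abs_continuous_curve A {a..b} \<gamma>"
  shows "locally_abs_continuous_on a b (\<lambda>s. Ad G A (\<gamma> s) Y)"
  unfolding locally_abs_continuous_on_def
proof
  fix t assume t: "t \<in> {a..b}"
  let ?g = "\<gamma> t" and ?\<phi> = "chart_at A (\<gamma> t)" and ?\<psi> = "chart_at A (inv (\<gamma> t))"
  have \<gamma>: "continuous_on {a..b} \<gamma>" using ac by (simp add: abs_continuous_curve_def)
  have one: "inv ?g \<otimes> ?g = \<one>" by simp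
  have "(snd ?\<psi> (inv ?g), snd ?\<phi> ?g) \<in> mult_dom ?\<psi> ?\<phi> c1" by (rule mult_domI) (auto simp: one)
  moreover have "Ck_on (Suc 0) (mult_dom ?\<psi> ?\<phi> c1) (mult_in ?\<psi> ?\<phi> c1)" "open (mult_dom ?\<psi> ?\<phi> c1)"
    by (rule Ck_on_mult_in open_mult_dom; simp)+
  ultimately obtain d1 L1 where L1: "d1 > 0" "L1-lipschitz_on (cball (snd ?\<psi> (inv ?g), snd ?\<phi> ?g) d1) (mult_in ?\<psi> ?\<phi> c1)"
    using Ck1_locally_lipschitz by metis
  obtain d2 K where K: "d2 > 0" "K \<ge> 0" "\<And>x y v. \<lbrakk>x \<in> cball e1 d2; y \<in> cball e1 d2\<rbrakk> \<Longrightarrow>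
       norm (Ad G A (chart_inv c1 x) v - Ad G A (chart_inv c1 y) v) \<le> K * norm v * norm (x - y)"
    using Ad_near_one by metis
  obtain r1 where r1: "r1 > 0" "\<And>s. s \<in> {a..b} \<Longrightarrow> \<bar>s - t\<bar> < r1 \<Longrightarrow> \<gamma> s \<in> fst ?\<phi> \<and> dist (snd ?\<phi> (\<gamma> s)) (snd ?\<phi> ?g) < d1"
    by (rule continuous_on_nbhd_in_chart[OF atlas chart_at_mem(1)[of ?g] \<gamma> t continuous_on_id[of UNIV], of d1]) (use L1 in auto)
  obtain r2 where r2: "r2 > 0" "\<And>s. s \<in> {a..b} \<Longrightarrow> \<bar>s - t\<bar> < r2 \<Longrightarrow> inv ?g \<otimes> \<gamma> s \<in> fst c1 \<and> dist (snd c1 (inv ?g \<otimes> \<gamma> s)) e1 < d2"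
    by (rule continuous_on_nbhd_in_chart[OF atlas c1(1) \<gamma> t continuous_left_mult[of "inv ?g"], of d2]) (use K in \<open>auto simp: one\<close>)
  obtain B where B: "B > 0" "\<And>v. norm (Ad G A ?g v) \<le> B * norm v"
    using linear_bounded_pos[OF linear_Ad] by metis
  have L1_0: "L1 \<ge> 0" using L1(2) lipschitz_on_nonneg by blast
  define C where "C = B * (K * norm Y * L1)"
  have "abs_continuous_on x y (\<lambda>s. Ad G A (\<gamma> s) Y)"
    if xy: "a \<le> x" "x \<le> t" "t \<le> y" "y \<le> b" "y - x < min r1 r2" for x y
  proof (rule abs_continuous_on_comparison[where L = C])
    have in_nbhd: "s \<in> {a..b}" "\<bar>s - t\<bar> < r1" "\<bar>s - t\<bar> < r2" if "x \<le> s" "s \<le> y" for s using xy that by auto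
    have "\<gamma> ` {x..y} \<subseteq> fst ?\<phi>" using r1(2) in_nbhd by auto
    then show "abs_continuous_on x y (snd ?\<phi> \<circ> \<gamma>)"
      using ac xy chart_at_mem(1)[of ?g] unfolding abs_continuous_curve_def by auto
    show "C \<ge> 0" using B(1) K(2) L1_0 by (simp add: C_def)
    fix s s' assume "x \<le> s" "s \<le> s'" "s' \<le> y"
    then have s: "x \<le> s" "s \<le> y" and s': "x \<le> s'" "s' \<le> y" by auto
    define \<sigma> where "\<sigma> s = snd c1 (inv ?g \<otimes> \<gamma> s)" for s
    have \<sigma>: "\<sigma> s \<in> cball e1 d2" "Ad G A (\<gamma> s) Y = Ad G A ?g (Ad G A (chart_inv c1 (\<sigma> s)) Y)"
      "\<gamma> s \<in> fst ?\<phi>" "(snd ?\<psi> (inv ?g), snd ?\<phi> (\<gamma> s)) \<in> cball (snd ?\<psi> (inv ?g), snd ?\<phi> ?g) d1"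
      "\<sigma> s = mult_in ?\<psi> ?\<phi> c1 (snd ?\<psi> (inv ?g), snd ?\<phi> (\<gamma> s))"
      if h: "x \<le> s" "s \<le> y" for s
    proof -
      have f: "inv ?g \<otimes> \<gamma> s \<in> fst c1" "dist (\<sigma> s) e1 < d2" using r2(2)[OF in_nbhd(1,3)[OF h]] by (auto simp: \<sigma>_def)
      show "\<sigma> s \<in> cball e1 d2" using f(2) by (simp add: dist_commute)
      have "chart_inv c1 (\<sigma> s) = inv ?g \<otimes> \<gamma> s" unfolding \<sigma>_def using smooth_atlas_chartD(6)[OF atlas c1(1) f(1)] .
      then have "Ad G A ?g (Ad G A (chart_inv c1 (\<sigma> s)) Y) = Ad G A (?g \<otimes> (inv ?g \<otimes> \<gamma> s)) Y" by (simp add: Ad_mult)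
      also have "?g \<otimes> (inv ?g \<otimes> \<gamma> s) = \<gamma> s" by (simp add: m_assoc[symmetric])
      finally show "Ad G A (\<gamma> s) Y = Ad G A ?g (Ad G A (chart_inv c1 (\<sigma> s)) Y)" by simp
      show m: "\<gamma> s \<in> fst ?\<phi>" using r1(2)[OF in_nbhd(1,2)[OF h]] by simp
      show "(snd ?\<psi> (inv ?g), snd ?\<phi> (\<gamma> s)) \<in> cball (snd ?\<psi> (inv ?g), snd ?\<phi> ?g) d1"
        using r1(2)[OF in_nbhd(1,2)[OF h]] by (simp add: dist_Pair_Pair dist_commute)
      show "\<sigma> s = mult_in ?\<psi> ?\<phi> c1 (snd ?\<psi> (inv ?g), snd ?\<phi> (\<gamma> s))"
        unfolding \<sigma>_def by (rule mult_in_eq[symmetric]) (auto simp: m)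
    qed
    have "norm (\<sigma> s' - \<sigma> s) \<le> L1 * norm ((snd ?\<phi> \<circ> \<gamma>) s' - (snd ?\<phi> \<circ> \<gamma>) s)"
      using lipschitz_onD[OF L1(2) \<sigma>(4)[OF s'] \<sigma>(4)[OF s]] \<sigma>(5)[OF s] \<sigma>(5)[OF s']
      by (simp add: dist_Pair_Pair) (simp add: dist_norm)
    then have 1: "K * norm Y * norm (\<sigma> s' - \<sigma> s) \<le> K * norm Y * (L1 * norm ((snd ?\<phi> \<circ> \<gamma>) s' - (snd ?\<phi> \<circ> \<gamma>) s))"
      using K(2) by (intro mult_left_mono) auto
    have "norm (Ad G A (\<gamma> s') Y - Ad G A (\<gamma> s) Y) \<le> B * norm (Ad G A (chart_inv c1 (\<sigma> s')) Y - Ad G A (chart_inv c1 (\<sigma> s)) Y)"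
      using B(2)[of "Ad G A (chart_inv c1 (\<sigma> s')) Y - Ad G A (chart_inv c1 (\<sigma> s)) Y"] \<sigma>(2)[OF s] \<sigma>(2)[OF s'] linear_diff[OF linear_Ad] by simp
    also have "\<dots> \<le> B * (K * norm Y * (L1 * norm ((snd ?\<phi> \<circ> \<gamma>) s' - (snd ?\<phi> \<circ> \<gamma>) s)))"
      using B(1) order_trans[OF K(3)[OF \<sigma>(1)[OF s'] \<sigma>(1)[OF s]] 1] by (intro mult_left_mono) auto
    finally show "norm (Ad G A (\<gamma> s') Y - Ad G A (\<gamma> s) Y) \<le> C * norm ((snd ?\<phi> \<circ> \<gamma>) s' - (snd ?\<phi> \<circ> \<gamma>) s)"
      by (simp add: C_def mult.assoc)
  qed
  then show "\<exists>d>0. \<forall>x y. a \<le> x \<and> x \<le> t \<and> t \<le> y \<and> y \<le> b \<and> y - x < d \<longrightarrow> abs_continuous_on x y (\<lambda>s. Ad G A (\<gamma> s) Y)"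
    using r1(1) r2(1) by (intro exI[of _ "min r1 r2"]) auto
qed

text \<open>
  The velocity at \<open>s\<close> is given in the chart at \<open>\<gamma> s\<close>, but a zero velocity is zero in every chart.  So on
  a short interval the coordinates in one fixed chart are absolutely continuous with derivative 0.
\<close>

lemma curve_constant_if_control_zero:
  assumes ac: "abs_continuous_curve A {a..b} \<gamma>" and N: "negligible N"
    and v: "\<And>t. t \<in> {a..b} - N \<Longrightarrow> has_velocity A \<gamma> (dL G A (\<gamma> t) 0) t {a..b}"
    and st: "a \<le> s" "s \<le> t" "t \<le> b"
  shows "\<gamma> s = \<gamma> t"
proof -
  have \<gamma>: "continuous_on {a..b} \<gamma>" using ac by (simp add: abs_continuous_curve_def)
  have "a \<le> s \<longrightarrow> t \<le> b \<longrightarrow> s \<le> t \<longrightarrow> \<gamma> s = \<gamma> t"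
    using st(2)
  proof (induction rule: Bolzano)
    case (local t)
    let ?\<phi> = "chart_at A (\<gamma> t)"
    have t: "t \<in> {a..b}" using local st by auto
    obtain r where r: "r > 0" "\<And>s. s \<in> {a..b} \<Longrightarrow> \<bar>s - t\<bar> < r \<Longrightarrow> \<gamma> s \<in> fst ?\<phi> \<and> dist (snd ?\<phi> (\<gamma> s)) (snd ?\<phi> (\<gamma> t)) < 1"
      by (rule continuous_on_nbhd_in_chart[OF atlas chart_at_mem(1)[of "\<gamma> t"] \<gamma> t continuous_on_id[of UNIV], of 1]) auto
    have "\<gamma> x = \<gamma> y" if xy: "x \<le> t" "t \<le> y" "y - x < r" "a \<le> x" "y \<le> b" "x \<le> y" for x y
    proof -
      have m: "\<gamma> s \<in> fst ?\<phi>" if "x \<le> s" "s \<le> y" for s using r(2)[of s] xy that by auto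
      have "norm ((snd ?\<phi> \<circ> \<gamma>) y - (snd ?\<phi> \<circ> \<gamma>) x) \<le> 0"
      proof (rule abs_continuous_increment_le_integral[OF xy(6) _ N])
        have "\<gamma> ` {x..y} \<subseteq> fst ?\<phi>" using m by auto
        then show "abs_continuous_on x y (snd ?\<phi> \<circ> \<gamma>)"
          using ac xy chart_at_mem(1)[of "\<gamma> t"] unfolding abs_continuous_curve_def by auto
        show "((\<lambda>_. 0) has_integral 0) {x..y}" by simp
        fix s assume s: "s \<in> {x..y} - N"
        have "s \<in> {a..b}" using s xy by auto
        have ms: "\<gamma> s \<in> fst ?\<phi>" using m s by auto
        obtain T where T: "has_chart_derivative (chart_at A (\<gamma> s)) ?\<phi> (\<lambda>x. x) (\<gamma> s) T"
          by (rule chart_transition_derivative[OF atlas chart_at_mem(1) chart_at_mem(1) chart_at_mem(2) ms]) blast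
        have v0: "((snd (chart_at A (\<gamma> s)) \<circ> \<gamma>) has_vector_derivative 0) (at s within {a..b})"
          using v[of s] s \<open>s \<in> {a..b}\<close> linear_0[OF linear_dL] by (simp add: has_velocity_def)
        have "((\<lambda>s. snd ?\<phi> (\<gamma> s)) has_vector_derivative T 0) (at s within {a..b})"
          by (rule has_chart_derivative_curve[OF atlas chart_at_mem \<gamma> \<open>s \<in> {a..b}\<close> T v0])
        then have "((snd ?\<phi> \<circ> \<gamma>) has_vector_derivative 0) (at s within {x..y})"
          using linear_0[OF has_chart_derivative_linear[OF T]] xy
          by (auto simp: comp_def intro: has_vector_derivative_within_subset)
        then show "\<exists>w. ((snd ?\<phi> \<circ> \<gamma>) has_vector_derivative w) (at s within {x..y}) \<and> norm w \<le> 0" by auto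
      qed auto
      then have "snd ?\<phi> (\<gamma> y) = snd ?\<phi> (\<gamma> x)" by simp
      then show ?thesis
        using smooth_atlas_chartD(5)[OF atlas chart_at_mem(1)] m xy(6) by (metis inj_onD order_refl)
    qed
    then show ?case using r(1) by blast
  qed auto
  then show ?thesis using st by simp
qed

end

section \<open>Bounds for the adjoint representation\<close>

lemma interval_with_endpoints_in_sets_lebesgue:
  assumes "interval_with_endpoints a b I"
  shows "I \<in> sets lebesgue"
proof -
  have "I = {a<..<b} \<union> (I \<inter> {a, b})"
    using assms unfolding interval_with_endpoints_def by fastforce
  moreover have "I \<inter> {a, b} \<in> sets lebesgue"
    by (rule negligible_imp_sets) (simp add: negligible_finite)
  moreover have "{a<..<b} \<in> sets lebesgue" by simp
  ultimately show ?thesis by (metis sets.Un)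
qed

text \<open>
  The inner product identifies the dual space with \<open>'e\<close>, where norms have been compared already.
\<close>

lemma blinfun_norm_on_bound:
  fixes N' :: "('e::euclidean_space \<Rightarrow>\<^sub>L real) \<Rightarrow> real"
  assumes N': "norm_on UNIV N'"
  obtains C where "C > 0" "\<And>\<xi>. norm \<xi> \<le> C * N' \<xi>"
proof -
  define \<iota> :: "'e \<Rightarrow> 'e \<Rightarrow>\<^sub>L real" where "\<iota> = blinfun_inner_right"
  have \<iota>: "blinfun_apply (\<iota> y) x = y \<bullet> x" for x y by (simp add: \<iota>_def)
  have lin: "\<iota> (x + y) = \<iota> x + \<iota> y" "\<iota> (c *\<^sub>R x) = c *\<^sub>R \<iota> x" for x y c
    by (intro blinfun_eqI; simp add: \<iota> blinfun.add_left blinfun.scaleR_left inner_add_left)+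
  have inj: "\<iota> y = 0 \<longleftrightarrow> y = 0" for y
  proof
    assume "\<iota> y = 0"
    then have "y \<bullet> y = 0" using \<iota>[of y y] by simp
    then show "y = 0" by simp
  next
    assume "y = 0"
    then show "\<iota> y = 0" by (intro blinfun_eqI) (simp add: \<iota>)
  qed
  have "norm_on UNIV (\<lambda>y. N' (\<iota> y))"
    using norm_onD[OF N'] unfolding norm_on_def by (simp add: lin inj)
  then obtain C where C: "C > 0" "\<And>y. norm y \<le> C * N' (\<iota> y)"
    using norm_le_norm_on[of UNIV "\<lambda>y. N' (\<iota> y)"] by auto
  have "norm \<xi> \<le> C * N' \<xi>" for \<xi>
  proof -
    define y where "y = (\<Sum>b\<in>Basis. blinfun_apply \<xi> b *\<^sub>R b)"
    have "blinfun_apply \<xi> x = y \<bullet> x" for x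
    proof -
      have "blinfun_apply \<xi> x = blinfun_apply \<xi> (\<Sum>b\<in>Basis. (x \<bullet> b) *\<^sub>R b)"
        by (simp add: euclidean_representation)
      also have "\<dots> = (\<Sum>b\<in>Basis. (x \<bullet> b) * blinfun_apply \<xi> b)"
        by (simp add: blinfun.sum_right blinfun.scaleR_right)
      also have "\<dots> = y \<bullet> x"
        unfolding y_def inner_sum_left by (intro sum.cong refl) (simp add: inner_commute)
      finally show ?thesis .
    qed
    then have "\<xi> = \<iota> y" by (intro blinfun_eqI) (simp add: \<iota>)
    moreover have "norm (\<iota> y) \<le> norm y"
      by (rule norm_blinfun_bound) (auto simp: \<iota> Cauchy_Schwarz_ineq2)
    ultimately show ?thesis using C(2)[of y] by simp
  qed
  then show thesis using that C(1) by blast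
qed

context lie_group
begin

lemma Ad_norm_le_basis: "norm (Ad G A g v) \<le> (\<Sum>b\<in>Basis. norm (Ad G A g b)) * norm v"
  by (rule norm_sum_Basis_le[OF linear_Ad]) simp

text \<open>
  The squared Hilbert--Schmidt norm \<open>F\<close> of \<open>Ad (\<gamma> t)\<close> is locally absolutely continuous, and its derivative is at most a
  constant times \<open>norm (u t) * F t\<close>.  Gronwall's inequality then bounds it by an exponential of the
  length of the curve.
\<close>

lemma Ad_bounded_along_horizontal_curve:
  fixes R :: real
  assumes V: "subspace V" and \<nu>: "norm_on V \<nu>"
  shows "\<exists>B\<ge>0. \<forall>\<gamma> u v. horizontal_curve G A V {0..1} \<gamma> u \<and> \<gamma> 0 = \<one> \<and>
      (\<integral>\<^sup>+ t. ennreal (\<nu> (u t)) \<partial>lebesgue_on {0..1}) \<le> ennreal R \<longrightarrow> norm (Ad G A (\<gamma> 1) v) \<le> B * norm v"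
proof -
  obtain C where C: "C \<ge> 0" "\<And>X Y. norm (ad G A X Y) \<le> C * norm X * norm Y"
    using ad_bounded by blast
  obtain c where c: "c > 0" "\<And>v. v \<in> V \<Longrightarrow> norm v \<le> c * \<nu> v"
    using norm_le_norm_on[OF \<nu> V] by blast
  define n where "n = real DIM('e)"
  define K where "K = 2 * n * n * C"
  have n: "n \<ge> 0" and K: "K \<ge> 0" using C(1) by (auto simp: n_def K_def)
  define E where "E = (1 + n) * exp (K * (c * max R 0))"
  have main: "norm (Ad G A (\<gamma> 1) v) \<le> n * sqrt E * norm v"
    if hc: "horizontal_curve G A V {0..1} \<gamma> u" and \<gamma>0: "\<gamma> 0 = \<one>"
      and len: "(\<integral>\<^sup>+ t. ennreal (\<nu> (u t)) \<partial>lebesgue_on {0..1}) \<le> ennreal R" for \<gamma> u v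
  proof -
    have ac: "abs_continuous_curve A {0..1} \<gamma>" and um: "u \<in> borel_measurable (lebesgue_on {0..1})"
      and AEu: "AE t in lebesgue_on {0..1}. u t \<in> V \<and> has_velocity A \<gamma> (dL G A (\<gamma> t) (u t)) t {0..1}"
      using hc by (auto simp: horizontal_curve_def)
    have \<gamma>: "continuous_on {0..1} \<gamma>" using ac by (simp add: abs_continuous_curve_def)
    obtain Z where Z: "negligible Z" "\<And>t. t \<in> {0..1} - Z \<Longrightarrow> u t \<in> V \<and> has_velocity A \<gamma> (dL G A (\<gamma> t) (u t)) t {0..1}"
      using AE_lebesgue_on_obtain_negligible[OF AEu] by auto
    \<comment> \<open>The Euclidean norm of the control is measurable at once, and the length bounds its integral.\<close>
    have "(\<integral>\<^sup>+ t. ennreal (norm (u t) / c) \<partial>lebesgue_on {0..1}) \<le> (\<integral>\<^sup>+ t. ennreal (\<nu> (u t)) \<partial>lebesgue_on {0..1})"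
    proof (rule nn_integral_mono_AE)
      show "AE t in lebesgue_on {0..1}. ennreal (norm (u t) / c) \<le> ennreal (\<nu> (u t))"
        using AEu
      proof eventually_elim
        case (elim t)
        then show ?case using c by (intro ennreal_leI) (simp add: divide_le_eq mult.commute)
      qed
    qed
    then have le: "(\<integral>\<^sup>+ t. ennreal (norm (u t) / c) \<partial>lebesgue_on {0..1}) \<le> ennreal R" using len by (rule order_trans)
    have int: "integrable (lebesgue_on {0..1}) (\<lambda>t. norm (u t) / c)"
    proof (rule integrableI_bounded)
      show "(\<lambda>t. norm (u t) / c) \<in> borel_measurable (lebesgue_on {0..1})" using um by measurable
      show "(\<integral>\<^sup>+ t. ennreal (norm (norm (u t) / c)) \<partial>lebesgue_on {0..1}) < \<infinity>"
        using le c(1) le_less_trans by fastforce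
    qed
    define L where "L = integral\<^sup>L (lebesgue_on {0..1}) (\<lambda>t. norm (u t) / c)"
    have "ennreal L \<le> ennreal R"
      using nn_integral_eq_integral[OF int] le c(1) by (simp add: L_def)
    also have "\<dots> \<le> ennreal (max R 0)" by (rule ennreal_leI) simp
    finally have L: "L \<le> max R 0" by (simp only: ennreal_le_iff[OF max.cobounded2])
    have HK: "((\<lambda>t. norm (u t) / c) has_integral L) {0..1}"
      unfolding L_def by (rule has_integral_integral_lebesgue_on[OF int]) simp
    define k where "k t = K * norm (u t)" for t
    have k: "(k has_integral K * c * L) {0..1}"
      using has_integral_mult_right[OF HK, of "K * c"] c(1) by (simp add: k_def[abs_def])
    then have k_le: "integral {0..1} k \<le> K * (c * max R 0)"
      using L K c(1) by (simp add: integral_unique mult.assoc mult_left_mono)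
    define F where "F t = (\<Sum>b\<in>Basis. Ad G A (\<gamma> t) b \<bullet> Ad G A (\<gamma> t) b)" for t
    have F_nonneg: "F t \<ge> 0" for t unfolding F_def by (intro sum_nonneg) auto
    have Ad_b: "norm (Ad G A (\<gamma> t) b) \<le> sqrt (F t)" if "b \<in> Basis" for b t
    proof (rule real_le_rsqrt)
      show "(norm (Ad G A (\<gamma> t) b))\<^sup>2 \<le> F t"
        unfolding F_def power2_norm_eq_inner using that by (intro member_le_sum) auto
    qed
    have Ad_v: "norm (Ad G A (\<gamma> t) v) \<le> n * sqrt (F t) * norm v" for v t
    proof -
      have "(\<Sum>b\<in>Basis. norm (Ad G A (\<gamma> t) b)) \<le> n * sqrt (F t)"
        using sum_bounded_above[of Basis "\<lambda>b. norm (Ad G A (\<gamma> t) b)" "sqrt (F t)"] Ad_b by (simp add: n_def)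
      then show ?thesis using Ad_norm_le_basis[of "\<gamma> t" v] by (meson mult_right_mono norm_ge_zero order_trans)
    qed
    have Fac: "locally_abs_continuous_on 0 1 F"
      unfolding F_def
    proof (rule locally_abs_continuous_on_sum)
      fix b :: 'e assume "b \<in> Basis"
      have f: "locally_abs_continuous_on 0 1 (\<lambda>t. Ad G A (\<gamma> t) b)" by (rule Ad_along_curve_abs_continuous[OF ac])
      have "bounded ((\<lambda>t. Ad G A (\<gamma> t) b) ` {0..1})"
        by (intro compact_imp_bounded compact_continuous_image locally_abs_continuous_on_imp_continuous_on[OF f] compact_Icc)
      then obtain M where M: "M > 0" "\<And>t. t \<in> {0..1} \<Longrightarrow> norm (Ad G A (\<gamma> t) b) \<le> M"
        unfolding bounded_pos by auto
      show "locally_abs_continuous_on 0 1 (\<lambda>t. Ad G A (\<gamma> t) b \<bullet> Ad G A (\<gamma> t) b)"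
      proof (rule locally_abs_continuous_on_comparison[OF f, of "2 * M"])
        fix s t :: real assume st: "0 \<le> s" "s \<le> t" "t \<le> 1"
        let ?x = "Ad G A (\<gamma> t) b" and ?y = "Ad G A (\<gamma> s) b"
        have "?x \<bullet> ?x - ?y \<bullet> ?y = (?x + ?y) \<bullet> (?x - ?y)" by (simp add: algebra_simps inner_commute)
        then have "\<bar>?x \<bullet> ?x - ?y \<bullet> ?y\<bar> \<le> norm (?x + ?y) * norm (?x - ?y)" by (simp add: Cauchy_Schwarz_ineq2)
        also have "\<dots> \<le> (2 * M) * norm (?x - ?y)"
          using norm_triangle_ineq[of ?x ?y] M(2)[of s] M(2)[of t] st by (intro mult_right_mono) auto
        finally show "norm (?x \<bullet> ?x - ?y \<bullet> ?y) \<le> 2 * M * norm (?x - ?y)" by simp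
      qed (use M in simp)
    qed simp
    have "1 + F 1 \<le> (1 + F 0) * exp (integral {0..1} k)"
    proof (rule gronwall_abs_continuous[OF _ Fac Z(1)])
      show "k integrable_on {0..1}" using k by blast
      show "0 \<le> k t" for t using K by (simp add: k_def)
      fix t assume t: "t \<in> {0..1} - Z"
      then have t01: "t \<in> {0..1}" by simp
      have d: "((\<lambda>t. Ad G A (\<gamma> t) b) has_vector_derivative Ad G A (\<gamma> t) (ad G A (u t) b)) (at t within {0..1})" for b
        using Ad_along_curve_has_derivative[OF \<gamma> t01] Z(2)[OF t] by blast
      have "(F has_vector_derivative (\<Sum>b\<in>Basis. Ad G A (\<gamma> t) b \<bullet> Ad G A (\<gamma> t) (ad G A (u t) b)
           + Ad G A (\<gamma> t) (ad G A (u t) b) \<bullet> Ad G A (\<gamma> t) b)) (at t within {0..1})"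
        unfolding F_def
        by (intro has_vector_derivative_sum bounded_bilinear.has_vector_derivative[OF bounded_bilinear_inner] d)
      moreover have "\<bar>\<Sum>b\<in>Basis. Ad G A (\<gamma> t) b \<bullet> Ad G A (\<gamma> t) (ad G A (u t) b)
           + Ad G A (\<gamma> t) (ad G A (u t) b) \<bullet> Ad G A (\<gamma> t) b\<bar> \<le> k t * F t"
      proof -
        have "\<bar>Ad G A (\<gamma> t) b \<bullet> Ad G A (\<gamma> t) (ad G A (u t) b) + Ad G A (\<gamma> t) (ad G A (u t) b) \<bullet> Ad G A (\<gamma> t) b\<bar>
            \<le> 2 * n * C * norm (u t) * F t" if b: "b \<in> Basis" for b
        proof -
          let ?x = "Ad G A (\<gamma> t) b" and ?y = "Ad G A (\<gamma> t) (ad G A (u t) b)"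
          have "norm ?y \<le> n * sqrt (F t) * norm (ad G A (u t) b)" by (rule Ad_v)
          also have "\<dots> \<le> n * sqrt (F t) * (C * norm (u t))"
            using C(2)[of "u t" b] b n F_nonneg by (intro mult_left_mono) auto
          finally have y: "norm ?y \<le> n * sqrt (F t) * (C * norm (u t))" .
          have "\<bar>?x \<bullet> ?y\<bar> \<le> norm ?x * norm ?y" by (rule Cauchy_Schwarz_ineq2)
          also have "\<dots> \<le> sqrt (F t) * (n * sqrt (F t) * (C * norm (u t)))"
            using Ad_b[OF b] y F_nonneg by (intro mult_mono) auto
          also have "\<dots> = n * C * norm (u t) * (sqrt (F t) * sqrt (F t))" by (simp only: mult_ac)
          also have "\<dots> = n * C * norm (u t) * F t" using F_nonneg by simp
          finally have "\<bar>?x \<bullet> ?y\<bar> \<le> n * C * norm (u t) * F t" .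
          then show ?thesis by (simp add: inner_commute[of ?y ?x])
        qed
        then have "\<bar>\<Sum>b\<in>Basis. Ad G A (\<gamma> t) b \<bullet> Ad G A (\<gamma> t) (ad G A (u t) b)
             + Ad G A (\<gamma> t) (ad G A (u t) b) \<bullet> Ad G A (\<gamma> t) b\<bar> \<le> (\<Sum>b\<in>(Basis::'e set). 2 * n * C * norm (u t) * F t)"
          by (intro order_trans[OF sum_abs] sum_mono)
        also have "\<dots> = k t * F t" by (simp add: k_def K_def n_def)
        finally show ?thesis .
      qed
      ultimately show "\<exists>w. (F has_vector_derivative w) (at t within {0..1}) \<and> \<bar>w\<bar> \<le> k t * F t" by blast
    qed (auto simp: F_nonneg)
    also have "F 0 = n" by (simp add: F_def \<gamma>0 Ad_one n_def)
    also have "(1 + n) * exp (integral {0..1} k) \<le> E"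
      unfolding E_def using n k_le by (intro mult_left_mono) auto
    finally have "F 1 \<le> E" by simp
    then have "n * sqrt (F 1) * norm v \<le> n * sqrt E * norm v"
      using n by (intro mult_right_mono mult_left_mono) auto
    then show ?thesis using Ad_v[of 1 v] by simp
  qed
  have "E \<ge> 0" using n by (simp add: E_def)
  then show ?thesis using main n by (intro exI[of _ "n * sqrt E"]) auto
qed

lemma Ad_bounded_on_sf_cball:
  assumes V: "subspace V" and \<nu>: "norm_on V \<nu>" and "r > 0"
  obtains B where "B \<ge> 0" "\<And>g v. g \<in> sf_cball G A V \<nu> \<one> r \<Longrightarrow> norm (Ad G A g v) \<le> B * norm v"
proof -
  obtain B where B: "B \<ge> 0" "\<And>\<gamma> u v. horizontal_curve G A V {0..1} \<gamma> u \<and> \<gamma> 0 = \<one> \<and>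
      (\<integral>\<^sup>+ t. ennreal (\<nu> (u t)) \<partial>lebesgue_on {0..1}) \<le> ennreal (r + 1) \<Longrightarrow> norm (Ad G A (\<gamma> 1) v) \<le> B * norm v"
    using Ad_bounded_along_horizontal_curve[OF V \<nu>, of "r + 1"] by blast
  show thesis
  proof (rule that[OF B(1)])
    fix g v assume "g \<in> sf_cball G A V \<nu> \<one> r"
    then have "sf_dist G A V \<nu> \<one> g \<le> ennreal r" by (simp add: sf_cball_def)
    \<comment> \<open>The distance is an infimum, which is only known to be approached by slightly longer curves.\<close>
    also have "\<dots> < ennreal (r + 1)" using \<open>r > 0\<close> by (simp add: ennreal_less_iff)
    finally obtain \<gamma> u where "horizontal_curve G A V {0..1} \<gamma> u" "\<gamma> 0 = \<one>" "\<gamma> 1 = g"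
      "(\<integral>\<^sup>+ t. ennreal (\<nu> (u t)) \<partial>lebesgue_on {0..1}) < ennreal (r + 1)"
      unfolding sf_dist_def Inf_less_iff by blast
    then show "norm (Ad G A g v) \<le> B * norm v" using B(2)[of \<gamma> u v] by auto
  qed
qed

text \<open>
  To compare the distance from \<open>\<gamma> 0\<close> to \<open>\<gamma> t\<close> with the speed, run \<open>\<gamma>\<close> up to time \<open>t\<close> and then stay.  In
  contrast to a reparametrisation on the unit interval, this does not rescale the control.
\<close>

lemma stopped_curve_horizontal:
  assumes V: "subspace V" and hc: "horizontal_curve G A V {0..1} \<gamma> u" and t: "t \<in> {0..1}"
  shows "horizontal_curve G A V {0..1} (\<lambda>s. \<gamma> (min s t)) (\<lambda>s. if s < t then u s else 0)"
proof -
  have ac: "abs_continuous_curve A {0..1} \<gamma>" and um: "u \<in> borel_measurable (lebesgue_on {0..1})"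
    and AEu: "AE t in lebesgue_on {0..1}. u t \<in> V \<and> has_velocity A \<gamma> (dL G A (\<gamma> t) (u t)) t {0..1}"
    using hc by (auto simp: horizontal_curve_def)
  have \<gamma>: "continuous_on {0..1} \<gamma>" using ac by (simp add: abs_continuous_curve_def)
  obtain Z where Z: "negligible Z" "\<And>t. t \<in> {0..1} - Z \<Longrightarrow> u t \<in> V \<and> has_velocity A \<gamma> (dL G A (\<gamma> t) (u t)) t {0..1}"
    using AE_lebesgue_on_obtain_negligible[OF AEu] by auto
  have "abs_continuous_curve A {0..1} (\<lambda>s. \<gamma> (min s t))"
    unfolding abs_continuous_curve_def
  proof (intro conjI ballI allI impI)
    show "continuous_on {0..1} (\<lambda>s. \<gamma> (min s t))"
      using t by (intro continuous_on_compose2[OF \<gamma>] continuous_intros) auto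
    fix \<phi> c d assume \<phi>: "\<phi> \<in> A" and cd: "c \<le> d \<and> {c..d} \<subseteq> {0..1} \<and> (\<lambda>s. \<gamma> (min s t)) ` {c..d} \<subseteq> fst \<phi>"
    have "\<gamma> ` {min c t..min d t} \<subseteq> fst \<phi>"
    proof
      fix y assume "y \<in> \<gamma> ` {min c t..min d t}"
      then obtain s where s: "min c t \<le> s" "s \<le> min d t" "y = \<gamma> s" by auto
      then have "max c s \<in> {c..d}" "min (max c s) t = s" using cd by (auto simp: min_def max_def split: if_splits)
      then show "y \<in> fst \<phi>" using cd s(3) by (metis (no_types, lifting) image_subset_iff)
    qed
    moreover have "min c t \<le> min d t" "{min c t..min d t} \<subseteq> {0..1}" using cd t by auto
    ultimately have "abs_continuous_on (min c t) (min d t) (snd \<phi> \<circ> \<gamma>)"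
      using ac \<phi> unfolding abs_continuous_curve_def by blast
    then have "abs_continuous_on c d (\<lambda>s. (snd \<phi> \<circ> \<gamma>) (min s t))" by (rule abs_continuous_on_stopped)
    then show "abs_continuous_on c d (snd \<phi> \<circ> (\<lambda>s. \<gamma> (min s t)))" by (simp add: comp_def)
  qed
  moreover have "(\<lambda>s. if s < t then u s else 0) \<in> borel_measurable (lebesgue_on {0..1})"
  proof (rule measurable_If[OF um])
    have "{s \<in> space (lebesgue_on {0..1}). s < t} = {0..1} \<inter> {..<t}" by auto
    then show "{s \<in> space (lebesgue_on {0..1}). s < t} \<in> sets (lebesgue_on {0..1})"
      by (simp add: sets_restrict_space_iff)
  qed simp
  moreover have "AE s in lebesgue_on {0..1}. (if s < t then u s else 0) \<in> V \<and>
      has_velocity A (\<lambda>s. \<gamma> (min s t)) (dL G A (\<gamma> (min s t)) (if s < t then u s else 0)) s {0..1}"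
  proof (rule AE_lebesgue_onI)
    show "negligible (Z \<union> {t})" using Z(1) by simp
    fix s assume s: "s \<in> {0..1} - (Z \<union> {t})"
    show "(if s < t then u s else 0) \<in> V \<and>
      has_velocity A (\<lambda>s. \<gamma> (min s t)) (dL G A (\<gamma> (min s t)) (if s < t then u s else 0)) s {0..1}"
    proof (cases "s < t")
      case True
      have uv: "u s \<in> V" "((snd (chart_at A (\<gamma> s)) \<circ> \<gamma>) has_vector_derivative dL G A (\<gamma> s) (u s)) (at s within {0..1})"
        using Z(2)[of s] s by (auto simp: has_velocity_def)
      have "((snd (chart_at A (\<gamma> s)) \<circ> (\<lambda>s. \<gamma> (min s t))) has_vector_derivative dL G A (\<gamma> s) (u s)) (at s within {0..1})"
        by (rule has_vector_derivative_transform_within[OF uv(2), of "t - s"]) (use s True in \<open>auto simp: dist_real_def\<close>)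
      then show ?thesis using True uv(1) by (simp add: has_velocity_def)
    next
      case False
      then have st: "s > t" using s by auto
      have "((snd (chart_at A (\<gamma> t)) \<circ> (\<lambda>s. \<gamma> (min s t))) has_vector_derivative 0) (at s within {0..1})"
        by (rule has_vector_derivative_transform_within[OF has_vector_derivative_const[of "snd (chart_at A (\<gamma> t)) (\<gamma> t)"], of "s - t"])
          (use s st in \<open>auto simp: dist_real_def\<close>)
      then show ?thesis using st subspace_0[OF V] linear_0[OF linear_dL] by (simp add: has_velocity_def)
    qed
  qed simp
  ultimately show ?thesis unfolding horizontal_curve_def by blast
qed

lemma constant_speed_curve_in_sf_cball:
  assumes V: "subspace V" and \<nu>: "norm_on V \<nu>" and hc: "horizontal_curve G A V {0..1} \<gamma> u"
    and sp: "has_speed \<nu> {0..1} u r" and "r \<ge> 0" and t: "t \<in> {0..1}"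
  shows "\<gamma> t \<in> sf_cball G A V \<nu> (\<gamma> 0) r"
proof -
  let ?u = "\<lambda>s. if s < t then u s else 0"
  have "\<nu> 0 = 0" using norm_onD(2)[OF \<nu> subspace_0[OF V]] by simp
  have "(\<integral>\<^sup>+ s. ennreal (\<nu> (?u s)) \<partial>lebesgue_on {0..1}) \<le> (\<integral>\<^sup>+ s. ennreal r \<partial>lebesgue_on {0..1::real})"
  proof (rule nn_integral_mono_AE)
    show "AE s in lebesgue_on {0..1}. ennreal (\<nu> (?u s)) \<le> ennreal r"
      using sp unfolding has_speed_def
      by eventually_elim (use \<open>\<nu> 0 = 0\<close> \<open>r \<ge> 0\<close> in auto)
  qed
  also have "\<dots> = ennreal r" by (simp add: emeasure_restrict_space)
  finally have "(\<integral>\<^sup>+ s. ennreal (\<nu> (?u s)) \<partial>lebesgue_on {0..1}) \<le> ennreal r" .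
  moreover have "sf_dist G A V \<nu> (\<gamma> 0) (\<gamma> t) \<le> (\<integral>\<^sup>+ s. ennreal (\<nu> (?u s)) \<partial>lebesgue_on {0..1})"
    unfolding sf_dist_def
  proof (rule Inf_lower, intro CollectI exI conjI)
    show "horizontal_curve G A V {0..1} (\<lambda>s. \<gamma> (min s t)) ?u"
      by (rule stopped_curve_horizontal[OF V hc t])
  qed (use t in auto)
  ultimately show ?thesis unfolding sf_cball_def by (blast intro: order_trans)
qed

text \<open>
  The set in the definition of \<open>M_bound\<close> is bounded above because \<open>Ad\<close> is bounded on the ball; the restriction to unit vectors
  is lifted by bilinearity.
\<close>

lemma M_bound_bounds:
  assumes V: "subspace V" and \<nu>: "norm_on V \<nu>" and N: "norm_on UNIV N" and "r > 0"
    and g: "g \<in> sf_cball G A V \<nu> \<one> r"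
  shows "N (Ad G A g (ad G A X Y)) \<le> M_bound G A V \<nu> N r * N X * N Y" "0 \<le> M_bound G A V \<nu> N r"
proof -
  let ?S = "{N (Ad G A g (ad G A X Y)) | g X Y. g \<in> sf_cball G A V \<nu> \<one> r \<and> N X = 1 \<and> N Y = 1}"
  obtain B where B: "B \<ge> 0" "\<And>g v. g \<in> sf_cball G A V \<nu> \<one> r \<Longrightarrow> norm (Ad G A g v) \<le> B * norm v"
    using Ad_bounded_on_sf_cball[OF V \<nu> \<open>r > 0\<close>] by blast
  obtain C where C: "C \<ge> 0" "\<And>X Y. norm (ad G A X Y) \<le> C * norm X * norm Y"
    using ad_bounded by blast
  obtain c where c: "c > 0" "\<And>v. N v \<le> c * norm v" using norm_on_le_norm[OF N subspace_UNIV] by auto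
  obtain c' where c': "c' > 0" "\<And>v. norm v \<le> c' * N v" using norm_le_norm_on[OF N subspace_UNIV] by auto
  have "x \<le> c * (B * (C * c' * c'))" if xS: "x \<in> ?S" for x
  proof -
    obtain h X Y where x: "x = N (Ad G A h (ad G A X Y))" "h \<in> sf_cball G A V \<nu> \<one> r" "N X = 1" "N Y = 1"
      using xS by blast
    have nX: "norm X \<le> c'" "norm Y \<le> c'" using c'(2)[of X] c'(2)[of Y] x by auto
    have "norm (ad G A X Y) \<le> C * norm X * norm Y" by (rule C(2))
    also have "\<dots> \<le> C * c' * c'" using nX C(1) c'(1) by (intro mult_mono) auto
    finally have 1: "norm (ad G A X Y) \<le> C * c' * c'" .
    have "x \<le> c * norm (Ad G A h (ad G A X Y))" using c(2) x(1) by simp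
    also have "\<dots> \<le> c * (B * norm (ad G A X Y))" using B(2)[OF x(2)] c(1) by simp
    also have "\<dots> \<le> c * (B * (C * c' * c'))" using 1 B(1) c(1) by (intro mult_left_mono) auto
    finally show ?thesis .
  qed
  then have bdd: "bdd_above ?S" by (rule bdd_aboveI)
  have unit: "N (Ad G A g (ad G A X Y)) \<le> M_bound G A V \<nu> N r" if "N X = 1" "N Y = 1" for X Y
    unfolding M_bound_def using g that by (intro cSup_upper[OF _ bdd]) blast
  have N0: "N (Ad G A g (ad G A X Y)) \<ge> 0" for X Y using norm_onD(1)[OF N] by simp
  have normalise: "N ((1 / N X) *\<^sub>R X) = 1" if "X \<noteq> 0" for X
    using norm_onD(1,2,3)[OF N, of X] that by simp
  obtain X0 :: 'e where "X0 \<noteq> 0" using SOME_Basis nonzero_Basis by blast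
  from unit[OF normalise[OF this] normalise[OF this]] N0 show M0: "0 \<le> M_bound G A V \<nu> N r"
    by (rule order_trans[rotated])
  show "N (Ad G A g (ad G A X Y)) \<le> M_bound G A V \<nu> N r * N X * N Y"
  proof (cases "X = 0 \<or> Y = 0")
    case True
    then have "ad G A X Y = 0" using linear_0[OF linear_ad_left] linear_0[OF linear_ad_right] by auto
    then have "N (Ad G A g (ad G A X Y)) = 0" using linear_0[OF linear_Ad] norm_onD(2)[OF N] by simp
    then show ?thesis using M0 norm_onD(1)[OF N] by simp
  next
    case False
    then have pos: "N X > 0" "N Y > 0" using norm_onD(1,2)[OF N] by (simp_all add: order_less_le)
    have "Ad G A g (ad G A ((1 / N X) *\<^sub>R X) ((1 / N Y) *\<^sub>R Y)) = (1 / N X * (1 / N Y)) *\<^sub>R Ad G A g (ad G A X Y)"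
      using linear_scale[OF linear_ad_left] linear_scale[OF linear_ad_right] linear_scale[OF linear_Ad] by simp
    then have "(1 / N X * (1 / N Y)) * N (Ad G A g (ad G A X Y)) \<le> M_bound G A V \<nu> N r"
      using unit[OF normalise normalise, of X Y] False norm_onD(3)[OF N] pos by simp
    then show ?thesis using pos by (simp add: field_simps)
  qed
qed

end

lemma unit_interval_obtain_outside_negligible:
  assumes "negligible Z"
  obtains t :: real where "t \<in> {0..1} - Z"
proof -
  have "\<not> {0..1::real} \<subseteq> Z"
    using assms negligible_subset[of Z "{0..1::real}"] negligible_interval(1)[of 0 "1::real"] by auto
  then show thesis using that by blast
qed

section \<open>Normal curves\<close>

lemma linear_le_Max_vertices:
  fixes \<eta> :: "'a::real_vector \<Rightarrow> real"
  assumes \<nu>: "norm_on V \<nu>" and V: "subspace V" and P: "finite P" "{v \<in> V. \<nu> v \<le> 1} = convex hull P"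
    and \<eta>: "linear \<eta>" and v: "v \<in> V"
  shows "\<eta> v \<le> Max (\<eta> ` P) * \<nu> v"
proof (cases "v = 0")
  case True
  then show ?thesis using linear_0[OF \<eta>] norm_onD(2)[OF \<nu> v] by simp
next
  case False
  then have pos: "\<nu> v > 0" using norm_onD(1,2)[OF \<nu> v] by simp
  have "convex {x. \<eta> x \<le> Max (\<eta> ` P)}"
    unfolding convex_def using linear_add[OF \<eta>] linear_scale[OF \<eta>] by (auto intro: convex_bound_le)
  then have "convex hull P \<subseteq> {x. \<eta> x \<le> Max (\<eta> ` P)}"
    using P(1) by (intro hull_minimal) auto
  moreover have "(1 / \<nu> v) *\<^sub>R v \<in> convex hull P"
    using P(2)[symmetric] V v pos norm_onD(3)[OF \<nu> v] by (auto simp: subspace_scale)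
  ultimately have "\<eta> ((1 / \<nu> v) *\<^sub>R v) \<le> Max (\<eta> ` P)" by blast
  then show ?thesis using pos linear_scale[OF \<eta>] by (simp add: divide_le_eq mult.commute)
qed

context lie_group
begin

lemma covector_along_curve:
  assumes hc: "abs_continuous_curve A {0..1} \<gamma>"
  shows "locally_abs_continuous_on 0 1 (\<lambda>t. blinfun_apply \<xi> (Ad G A (\<gamma> t) Y))"
    and "t \<in> {0..1} \<Longrightarrow> has_velocity A \<gamma> (dL G A (\<gamma> t) v) t {0..1} \<Longrightarrow>
      ((\<lambda>t. blinfun_apply \<xi> (Ad G A (\<gamma> t) Y)) has_vector_derivative
         blinfun_apply \<xi> (Ad G A (\<gamma> t) (ad G A v Y))) (at t within {0..1})"
proof -
  show "locally_abs_continuous_on 0 1 (\<lambda>t. blinfun_apply \<xi> (Ad G A (\<gamma> t) Y))"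
  proof (rule locally_abs_continuous_on_comparison[OF Ad_along_curve_abs_continuous[OF hc, of Y], of "norm \<xi>"])
    fix s t :: real
    show "norm (blinfun_apply \<xi> (Ad G A (\<gamma> t) Y) - blinfun_apply \<xi> (Ad G A (\<gamma> s) Y)) \<le> norm \<xi> * norm (Ad G A (\<gamma> t) Y - Ad G A (\<gamma> s) Y)"
      using norm_blinfun[of \<xi> "Ad G A (\<gamma> t) Y - Ad G A (\<gamma> s) Y"] by (simp only: blinfun.diff_right)
  qed simp
  assume t: "t \<in> {0..1}" and v: "has_velocity A \<gamma> (dL G A (\<gamma> t) v) t {0..1}"
  have \<gamma>: "continuous_on {0..1} \<gamma>" using hc by (simp add: abs_continuous_curve_def)
  show "((\<lambda>t. blinfun_apply \<xi> (Ad G A (\<gamma> t) Y)) has_vector_derivative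
         blinfun_apply \<xi> (Ad G A (\<gamma> t) (ad G A v Y))) (at t within {0..1})"
    by (rule bounded_linear.has_vector_derivative[OF blinfun.bounded_linear_right Ad_along_curve_has_derivative[OF \<gamma> t v]])
qed

lemma covector_along_curve_lipschitz:
  assumes ac: "abs_continuous_curve A {0..1} \<gamma>" and Z: "negligible Z" and "D \<ge> 0"
    and v: "\<And>t. t \<in> {0..1} - Z \<Longrightarrow> has_velocity A \<gamma> (dL G A (\<gamma> t) (u t)) t {0..1}"
    and D: "\<And>t. t \<in> {0..1} - Z \<Longrightarrow> \<bar>blinfun_apply \<xi> (Ad G A (\<gamma> t) (ad G A (u t) Y))\<bar> \<le> D"
    and st: "s \<in> {0..1}" "t \<in> {0..1}"
  shows "\<bar>blinfun_apply \<xi> (Ad G A (\<gamma> s) Y) - blinfun_apply \<xi> (Ad G A (\<gamma> t) Y)\<bar> \<le> D * \<bar>s - t\<bar>"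
proof -
  let ?f = "\<lambda>t. blinfun_apply \<xi> (Ad G A (\<gamma> t) Y)"
  have *: "norm (?f t - ?f s) \<le> D * (t - s)" if "0 \<le> s" "s \<le> t" "t \<le> 1" for s t
  proof (rule increment_le_const[OF covector_along_curve(1)[OF ac] Z \<open>D \<ge> 0\<close> _ that])
    fix \<tau> assume \<tau>: "\<tau> \<in> {0..1} - Z"
    then show "\<exists>w. (?f has_vector_derivative w) (at \<tau> within {0..1}) \<and> norm w \<le> D"
      using covector_along_curve(2)[OF ac _ v[OF \<tau>]] D[OF \<tau>] by auto
  qed
  show ?thesis
  proof (cases "s \<le> t")
    case True then show ?thesis using *[of s t] st by (simp add: abs_minus_commute)
  next
    case False then show ?thesis using *[of t s] st by simp
  qed
qed

text \<open>
  The bound \<open>D\<close> on the derivatives of the functionals makes them vary by at most \<open>\<epsilon> r\<close> on the vertices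
  during \<open>I\<close>.
\<close>

lemma control_in_face_if_covector_slow:
  assumes hc: "horizontal_curve G A V {0..1} \<gamma> u" and cov: "is_covector G A V \<nu> {0..1} \<gamma> u \<xi>"
    and sp: "has_speed \<nu> {0..1} u r" and "r > 0"
    and gap: "common_face_gap V \<nu> P \<epsilon>" and "\<epsilon> > 0"
    and D: "AE t in lebesgue_on {0..1}. \<forall>p\<in>P. \<bar>blinfun_apply \<xi> (Ad G A (\<gamma> t) (ad G A (u t) p))\<bar> \<le> D" and "D \<ge> 0"
    and I: "interval_with_endpoints a b I" "I \<subseteq> {0..1}" and small: "\<bar>a - b\<bar> * D \<le> \<epsilon> * r"
  shows "takes_values_in_face V \<nu> I u"
proof -
  have ac: "abs_continuous_curve A {0..1} \<gamma>"
    and AEu: "AE t in lebesgue_on {0..1}. u t \<in> V \<and> has_velocity A \<gamma> (dL G A (\<gamma> t) (u t)) t {0..1}"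
    using hc by (auto simp: horizontal_curve_def)
  let ?\<eta> = "\<lambda>t v. blinfun_apply \<xi> (Ad G A (\<gamma> t) v)"
  let ?good = "\<lambda>t. u t \<in> V \<and> has_velocity A \<gamma> (dL G A (\<gamma> t) (u t)) t {0..1} \<and> \<nu> (u t) = r \<and>
      ?\<eta> t \<in> energy_subdifferential V \<nu> (u t) \<and> (\<forall>p\<in>P. \<bar>?\<eta> t (ad G A (u t) p)\<bar> \<le> D)"
  have "AE t in lebesgue_on {0..1}. ?good t"
    using AEu cov sp D unfolding is_covector_def has_speed_def by eventually_elim auto
  then obtain Z where Z: "negligible Z" "\<And>t. t \<in> {0..1} - Z \<Longrightarrow> ?good t"
    by (rule AE_lebesgue_on_obtain_negligible) auto
  have close: "\<bar>?\<eta> s p - ?\<eta> t p\<bar> \<le> D * \<bar>s - t\<bar>" if "p \<in> P" "s \<in> {0..1}" "t \<in> {0..1}" for p s t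
    using Z(2) that by (intro covector_along_curve_lipschitz[OF ac Z(1) \<open>D \<ge> 0\<close>]) auto
  obtain t0 where t0: "t0 \<in> {0..1} - Z" by (rule unit_interval_obtain_outside_negligible[OF Z(1)])
  \<comment> \<open>Some face is required even if \<open>I\<close> is negligible; then any good time provides one.\<close>
  define J where "J = (if I - Z = {} then {t0} else I - Z)"
  have J: "J \<noteq> {}" "J \<subseteq> {0..1} - Z" "I - Z \<subseteq> J"
    using t0 I(2) by (auto simp: J_def)
  have J_close: "\<bar>s - t\<bar> \<le> \<bar>a - b\<bar>" if "s \<in> J" "t \<in> J" for s t
  proof (cases "I - Z = {}")
    case True
    then show ?thesis using that by (simp add: J_def)
  next
    case False
    then have "s \<in> {a..b}" "t \<in> {a..b}" using that I(1) by (auto simp: J_def interval_with_endpoints_def)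
    then show ?thesis by auto
  qed
  have "\<forall>p\<in>P. \<bar>?\<eta> s p - ?\<eta> t p\<bar> \<le> \<epsilon> * r" if st: "s \<in> J" "t \<in> J" for s t
  proof
    fix p assume "p \<in> P"
    then have "\<bar>?\<eta> s p - ?\<eta> t p\<bar> \<le> D * \<bar>s - t\<bar>" using close J(2) st by blast
    also have "\<dots> \<le> D * \<bar>a - b\<bar>" using J_close st \<open>D \<ge> 0\<close> by (intro mult_left_mono) auto
    also have "\<dots> \<le> \<epsilon> * r" using small by (simp add: mult.commute)
    finally show "\<bar>?\<eta> s p - ?\<eta> t p\<bar> \<le> \<epsilon> * r" .
  qed
  moreover have "u t \<in> V \<and> \<nu> (u t) = r \<and> ?\<eta> t \<in> energy_subdifferential V \<nu> (u t)" if "t \<in> J" for t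
    using that J(2) Z(2) by blast
  ultimately have "\<exists>F. face_of_sphere V \<nu> r F \<and> snd ` ((\<lambda>t. (?\<eta> t, u t)) ` J) \<subseteq> F"
    using J(1) by (intro gap[unfolded common_face_gap_def, rule_format, OF \<open>r > 0\<close>]) auto
  then obtain F where F: "face_of_sphere V \<nu> r F" "u ` J \<subseteq> F" by (auto simp: image_image)
  have "AE t in lebesgue_on I. u t \<in> F"
    using F(2) J(3) by (intro AE_lebesgue_onI[OF Z(1)] interval_with_endpoints_in_sets_lebesgue[OF I(1)]) auto
  then show ?thesis unfolding takes_values_in_face_def using F(1) \<open>r > 0\<close> by blast
qed

text \<open>
  Let \<open>h t\<close> be the maximum of the functional \<open>\<xi> \<circ> Ad (\<gamma> t)\<close> over the vertices, that is, its dual norm.  It is Lipschitz and equals the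
  speed for almost every \<open>t\<close>.  At such a \<open>t\<close> the function \<open>s \<mapsto> \<xi> (Ad (\<gamma> s) (u t))\<close> is bounded by \<open>h s * \<nu> (u t)\<close>, with
  equality for \<open>s = t\<close>, and its derivative at \<open>t\<close> is \<open>\<xi> (Ad (\<gamma> t) [u t, u t]) = 0\<close>.  So \<open>h\<close> has a local
  minimum at \<open>t\<close> to first order.
\<close>

lemma normal_curve_constant_speed:
  assumes \<nu>: "norm_on V \<nu>" and V: "subspace V" and P: "finite P" "{v \<in> V. \<nu> v \<le> 1} = convex hull P"
    and hc: "horizontal_curve G A V {0..1} \<gamma> u" and cov: "is_covector G A V \<nu> {0..1} \<gamma> u \<xi>"
  obtains r D where "has_speed \<nu> {0..1} u r" "D \<ge> 0"
    "AE t in lebesgue_on {0..1}. \<forall>p\<in>P. \<bar>blinfun_apply \<xi> (Ad G A (\<gamma> t) (ad G A (u t) p))\<bar> \<le> D"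
proof -
  have ac: "abs_continuous_curve A {0..1} \<gamma>"
    and AEu: "AE t in lebesgue_on {0..1}. u t \<in> V \<and> has_velocity A \<gamma> (dL G A (\<gamma> t) (u t)) t {0..1}"
    using hc by (auto simp: horizontal_curve_def)
  let ?\<eta> = "\<lambda>t v. blinfun_apply \<xi> (Ad G A (\<gamma> t) v)"
  have lin: "linear (?\<eta> t)" for t
    using linear_compose[OF linear_Ad bounded_linear.linear[OF blinfun.bounded_linear_right]] by (simp add: comp_def)
  let ?good = "\<lambda>t. u t \<in> V \<and> has_velocity A \<gamma> (dL G A (\<gamma> t) (u t)) t {0..1} \<and> ?\<eta> t \<in> energy_subdifferential V \<nu> (u t)"
  have "AE t in lebesgue_on {0..1}. ?good t"
    using AEu cov unfolding is_covector_def by eventually_elim auto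
  then obtain Z where Z: "negligible Z" "\<And>t. t \<in> {0..1} - Z \<Longrightarrow> ?good t"
    by (rule AE_lebesgue_on_obtain_negligible) auto
  have "P \<noteq> {}" using P(2) subspace_0[OF V] norm_onD(2)[OF \<nu>, of 0] by fastforce
  have PK: "p \<in> V" "\<nu> p \<le> 1" if "p \<in> P" for p
    using P(2) hull_inc[of p P convex] that by auto
  have zero_hull: "0 \<in> V" "\<nu> 0 = 0" using subspace_0[OF V] norm_onD(2)[OF \<nu>, of 0] by auto
  \<comment> \<open>By compactness, the adjoint operators along the curve are uniformly bounded.\<close>
  have "\<exists>M. \<forall>t\<in>{0..1}. norm (Ad G A (\<gamma> t) b) \<le> M" for b
    using compact_imp_bounded[OF compact_continuous_image[OF
        locally_abs_continuous_on_imp_continuous_on[OF Ad_along_curve_abs_continuous[OF ac, of b]] compact_Icc]]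
    by (auto simp: bounded_iff)
  then obtain M where M: "\<And>b t. t \<in> {0..1} \<Longrightarrow> norm (Ad G A (\<gamma> t) b) \<le> M b" by metis
  define B where "B = max 0 (\<Sum>b\<in>Basis. M b)"
  have B: "norm (Ad G A (\<gamma> t) v) \<le> B * norm v" if "t \<in> {0..1}" for t v
  proof -
    have "(\<Sum>b\<in>Basis. norm (Ad G A (\<gamma> t) b)) \<le> B" unfolding B_def using M[OF that] by (simp add: sum_mono max.coboundedI2)
    then show ?thesis using Ad_norm_le_basis[of "\<gamma> t" v] by (meson mult_right_mono norm_ge_zero order_trans)
  qed
  have \<eta>_le: "\<bar>?\<eta> t v\<bar> \<le> norm \<xi> * B * norm v" if "t \<in> {0..1}" for t v
  proof -
    have "\<bar>?\<eta> t v\<bar> \<le> norm \<xi> * norm (Ad G A (\<gamma> t) v)" using norm_blinfun[of \<xi>] by simp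
    also have "\<dots> \<le> norm \<xi> * (B * norm v)" using B[OF that] by (intro mult_left_mono) auto
    finally show ?thesis by (simp add: mult.assoc)
  qed
  obtain c where c: "c > 0" "\<And>v. v \<in> V \<Longrightarrow> norm v \<le> c * \<nu> v"
    using norm_le_norm_on[OF \<nu> V] by blast
  obtain C where C: "C \<ge> 0" "\<And>X Y. norm (ad G A X Y) \<le> C * norm X * norm Y"
    using ad_bounded by blast
  have B0: "B \<ge> 0" by (simp add: B_def)
  define R where "R = norm \<xi> * B * c"
  have R0: "R \<ge> 0" using B0 c(1) by (simp add: R_def)
  have speed_le: "\<nu> (u t) \<le> R" if t: "t \<in> {0..1} - Z" for t
  proof -
    have g: "u t \<in> V" "?\<eta> t \<in> energy_subdifferential V \<nu> (u t)" using Z(2)[OF t] by auto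
    have "(\<nu> (u t))\<^sup>2 = ?\<eta> t (u t)" using energy_subdifferential_max(1)[OF \<nu> V g(2,1)] by simp
    also have "\<dots> \<le> norm \<xi> * B * norm (u t)" using \<eta>_le[of t "u t"] t by auto
    also have "\<dots> \<le> norm \<xi> * B * (c * \<nu> (u t))" using c(2)[OF g(1)] B0 by (intro mult_left_mono) auto
    finally have "\<nu> (u t) * \<nu> (u t) \<le> R * \<nu> (u t)" by (simp add: R_def power2_eq_square mult.assoc)
    then show ?thesis using norm_onD(1)[OF \<nu> g(1)] R0 by (cases "\<nu> (u t) = 0") auto
  qed
  define D where "D = norm \<xi> * B * (C * (c * R) * c)"
  have D0: "D \<ge> 0" using B0 C(1) c(1) R0 by (simp add: D_def)
  have D: "\<bar>?\<eta> t (ad G A (u t) p)\<bar> \<le> D" if t: "t \<in> {0..1} - Z" and p: "p \<in> P" for t p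
  proof -
    have "norm (u t) \<le> c * \<nu> (u t)" using c(2) Z(2)[OF t] by blast
    also have "\<dots> \<le> c * R" using speed_le[OF t] c(1) by simp
    finally have 1: "norm (u t) \<le> c * R" .
    have "norm p \<le> c * \<nu> p" using c(2) PK(1)[OF p] by blast
    also have "\<dots> \<le> c * 1" using PK(2)[OF p] c(1) by (intro mult_left_mono) auto
    finally have 2: "norm p \<le> c" by simp
    have "norm (ad G A (u t) p) \<le> C * norm (u t) * norm p" by (rule C(2))
    also have "\<dots> \<le> C * (c * R) * c" using 1 2 C(1) c(1) R0 by (intro mult_mono) auto
    finally have "norm \<xi> * B * norm (ad G A (u t) p) \<le> D" unfolding D_def using B0 by (intro mult_left_mono) auto
    then show ?thesis using \<eta>_le[of t "ad G A (u t) p"] t by auto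
  qed
  define h where "h t = Max (?\<eta> t ` P)" for t
  have \<eta>_le_h: "?\<eta> t v \<le> h t * \<nu> v" if "v \<in> V" for t v
    unfolding h_def by (rule linear_le_Max_vertices[OF \<nu> V P lin that])
  have h0: "0 \<le> h t" for t
  proof -
    have "convex {x. ?\<eta> t x \<le> h t}"
      unfolding convex_def using linear_add[OF lin] linear_scale[OF lin] by (auto intro: convex_bound_le)
    then have "convex hull P \<subseteq> {x. ?\<eta> t x \<le> h t}"
      using P(1) by (intro hull_minimal) (auto simp: h_def)
    moreover have "0 \<in> convex hull P" using zero_hull P(2)[symmetric] by auto
    ultimately show ?thesis using linear_0[OF lin, of t] by force
  qed
  have h_speed: "h t = \<nu> (u t)" if t: "t \<in> {0..1} - Z" for t
  proof (rule antisym)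
    have g: "u t \<in> V" "?\<eta> t \<in> energy_subdifferential V \<nu> (u t)" using Z(2)[OF t] by auto
    have u0: "\<nu> (u t) \<ge> 0" using norm_onD(1)[OF \<nu> g(1)] .
    show "h t \<le> \<nu> (u t)"
      unfolding h_def
    proof (rule Max.boundedI)
      fix y assume "y \<in> ?\<eta> t ` P"
      then obtain p where p: "p \<in> P" "y = ?\<eta> t p" by blast
      have "y \<le> \<nu> (u t) * \<nu> p" using energy_subdifferential_max(2)[OF \<nu> V g(2,1) PK(1)[OF p(1)]] p(2) by simp
      also have "\<dots> \<le> \<nu> (u t) * 1" using PK(2)[OF p(1)] u0 by (intro mult_left_mono) auto
      finally show "y \<le> \<nu> (u t)" by simp
    qed (use P(1) \<open>P \<noteq> {}\<close> in auto)
    have "(\<nu> (u t))\<^sup>2 \<le> h t * \<nu> (u t)"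
      using energy_subdifferential_max(1)[OF \<nu> V g(2,1)] \<eta>_le_h[OF g(1), of t] by simp
    then show "\<nu> (u t) \<le> h t" using u0 h0[of t] by (cases "\<nu> (u t) = 0") (auto simp: power2_eq_square)
  qed
  have h_step: "h s \<le> h t + D * \<bar>s - t\<bar>" if "s \<in> {0..1}" "t \<in> {0..1}" for s t
  proof -
    have "h s \<in> ?\<eta> s ` P" unfolding h_def using P(1) \<open>P \<noteq> {}\<close> by (intro Max_in) auto
    then obtain p where p: "p \<in> P" "h s = ?\<eta> s p" by blast
    have "?\<eta> t p \<le> h t" unfolding h_def using P(1) p by (intro Max_ge) auto
    moreover have "\<bar>?\<eta> s p - ?\<eta> t p\<bar> \<le> D * \<bar>s - t\<bar>"
      using Z(2) D[OF _ p(1)] that by (intro covector_along_curve_lipschitz[OF ac Z(1) D0]) auto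
    ultimately show ?thesis using p(2) by linarith
  qed
  have h_lip: "D-lipschitz_on {0..1} h"
  proof (rule lipschitz_onI[OF _ D0])
    fix s t :: real assume "s \<in> {0..1}" "t \<in> {0..1}"
    then show "dist (h s) (h t) \<le> D * dist s t"
      using h_step[of s t] h_step[of t s] by (simp add: dist_real_def abs_le_iff abs_minus_commute)
  qed
  have const: "h s = h t" if "0 \<le> s" "s \<le> t" "t \<le> 1" for s t
  proof (rule lipschitz_constant_if_almost_minimal[OF h_lip Z(1) _ that])
    fix \<tau> e :: real assume \<tau>: "\<tau> \<in> {0..1} - Z" and "e > 0"
    have g: "u \<tau> \<in> V" "?\<eta> \<tau> \<in> energy_subdifferential V \<nu> (u \<tau>)" using Z(2)[OF \<tau>] by auto
    show "\<exists>d>0. \<forall>s\<in>{0..1}. \<bar>s - \<tau>\<bar> < d \<longrightarrow> h \<tau> - e * \<bar>s - \<tau>\<bar> \<le> h s"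
    proof (cases "\<nu> (u \<tau>) = 0")
      case True
      have "h \<tau> - e * \<bar>s - \<tau>\<bar> \<le> h s" for s
      proof -
        have "0 \<le> e * \<bar>s - \<tau>\<bar>" using \<open>e > 0\<close> by simp
        then show ?thesis using h_speed[OF \<tau>] True h0[of s] by linarith
      qed
      then show ?thesis using zero_less_one by blast
    next
      case False
      then have pos: "\<nu> (u \<tau>) > 0" using norm_onD(1)[OF \<nu> g(1)] by simp
      have "((\<lambda>t. ?\<eta> t (u \<tau>)) has_vector_derivative ?\<eta> \<tau> (ad G A (u \<tau>) (u \<tau>))) (at \<tau> within {0..1})"
        using Z(2)[OF \<tau>] \<tau> by (intro covector_along_curve(2)[OF ac]) auto
      then have "((\<lambda>t. ?\<eta> t (u \<tau>)) has_vector_derivative 0) (at \<tau> within {0..1})"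
        using linear_0[OF lin] by (simp add: ad_self)
      moreover have "e * \<nu> (u \<tau>) > 0" using \<open>e > 0\<close> pos by simp
      ultimately obtain d where d: "d > 0" "\<And>s. s \<in> {0..1} \<Longrightarrow> \<bar>s - \<tau>\<bar> < d \<Longrightarrow>
          \<bar>?\<eta> s (u \<tau>) - ?\<eta> \<tau> (u \<tau>)\<bar> \<le> e * \<nu> (u \<tau>) * \<bar>s - \<tau>\<bar>"
        unfolding has_vector_derivative_def has_derivative_within_alt by auto
      have "h \<tau> - e * \<bar>s - \<tau>\<bar> \<le> h s" if s: "s \<in> {0..1}" "\<bar>s - \<tau>\<bar> < d" for s
      proof -
        have "?\<eta> \<tau> (u \<tau>) = \<nu> (u \<tau>) * \<nu> (u \<tau>)"
          using energy_subdifferential_max(1)[OF \<nu> V g(2,1)] by (simp add: power2_eq_square)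
        then have "(\<nu> (u \<tau>) - e * \<bar>s - \<tau>\<bar>) * \<nu> (u \<tau>) \<le> ?\<eta> s (u \<tau>)"
          using d(2)[OF s] by (simp add: algebra_simps abs_le_iff)
        also have "\<dots> \<le> h s * \<nu> (u \<tau>)" by (rule \<eta>_le_h[OF g(1)])
        finally show ?thesis using pos h_speed[OF \<tau>] by simp
      qed
      then show ?thesis using d(1) by blast
    qed
  qed
  show thesis
  proof (rule that[OF _ D0])
    show "has_speed \<nu> {0..1} u (h 0)"
      unfolding has_speed_def
    proof (rule AE_lebesgue_onI[OF Z(1)])
      show "\<nu> (u t) = h 0" if "t \<in> {0..1} - Z" for t
        using h_speed[OF that] const[of 0 t] that by simp
    qed simp
    show "AE t in lebesgue_on {0..1}. \<forall>p\<in>P. \<bar>?\<eta> t (ad G A (u t) p)\<bar> \<le> D"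
      using D by (intro AE_lebesgue_onI[OF Z(1)]) auto
  qed
qed

end

lemma (in lie_group) normal_curve_locally_in_face:
  assumes \<nu>: "norm_on V \<nu>" and V: "subspace V" and poly: "polyhedral V \<nu>"
    and normal: "normal_curve G A V \<nu> {0..1} \<gamma> u" and nonconst: "\<not> \<gamma> constant_on {0..1}"
  shows "\<exists>\<delta>'>0. \<forall>a b I. interval_with_endpoints a b I \<and> I \<subseteq> {0..1} \<and> \<bar>a - b\<bar> \<le> \<delta>' \<longrightarrow>
           takes_values_in_face V \<nu> I u"
proof -
  obtain \<epsilon> P where \<epsilon>: "\<epsilon> > 0" "finite P" "{v \<in> V. \<nu> v \<le> 1} = convex hull P" "common_face_gap V \<nu> P \<epsilon>"
    by (rule polyhedral_common_face_gap[OF \<nu> V poly])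
  obtain \<xi> where hc: "horizontal_curve G A V {0..1} \<gamma> u" and cov: "is_covector G A V \<nu> {0..1} \<gamma> u \<xi>"
    using normal by (auto simp: normal_curve_def)
  obtain r D where sp: "has_speed \<nu> {0..1} u r" and D: "D \<ge> 0"
    "AE t in lebesgue_on {0..1}. \<forall>p\<in>P. \<bar>blinfun_apply \<xi> (Ad G A (\<gamma> t) (ad G A (u t) p))\<bar> \<le> D"
    using normal_curve_constant_speed[OF \<nu> V \<epsilon>(2,3) hc cov] by blast
  have AEu: "AE t in lebesgue_on {0..1}. u t \<in> V \<and> has_velocity A \<gamma> (dL G A (\<gamma> t) (u t)) t {0..1} \<and> \<nu> (u t) = r"
    using hc sp unfolding horizontal_curve_def has_speed_def by (auto elim: eventually_elim2)
  then obtain Z where Z: "negligible Z"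
    "\<And>t. t \<in> {0..1} - Z \<Longrightarrow> u t \<in> V \<and> has_velocity A \<gamma> (dL G A (\<gamma> t) (u t)) t {0..1} \<and> \<nu> (u t) = r"
    by (rule AE_lebesgue_on_obtain_negligible) auto
  have "r \<noteq> 0"
  proof
    assume "r = 0"
    then have "has_velocity A \<gamma> (dL G A (\<gamma> t) 0) t {0..1}" if "t \<in> {0..1} - Z" for t
      using Z(2)[OF that] norm_onD(2)[OF \<nu>, of "u t"] by auto
    then have "\<gamma> 0 = \<gamma> t" if "t \<in> {0..1}" for t
      using curve_constant_if_control_zero[OF _ Z(1), of 0 1 \<gamma> 0 t] hc that by (auto simp: horizontal_curve_def)
    then show False using nonconst unfolding constant_on_def by metis
  qed
  obtain t0 where "t0 \<in> {0..1} - Z" by (rule unit_interval_obtain_outside_negligible[OF Z(1)])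
  then have "r > 0" using \<open>r \<noteq> 0\<close> Z(2)[of t0] norm_onD(1)[OF \<nu>, of "u t0"] by auto
  define \<delta> where "\<delta> = \<epsilon> * r / (D + 1)"
  have "\<delta> > 0" using \<epsilon>(1) \<open>r > 0\<close> D(1) by (simp add: \<delta>_def)
  moreover have "takes_values_in_face V \<nu> I u"
    if I: "interval_with_endpoints a b I" "I \<subseteq> {0..1}" "\<bar>a - b\<bar> \<le> \<delta>" for a b I
  proof (rule control_in_face_if_covector_slow[OF hc cov sp \<open>r > 0\<close> \<epsilon>(4,1) D(2,1) I(1,2)])
    have "\<bar>a - b\<bar> * D \<le> \<delta> * (D + 1)" using I(3) D(1) by (intro mult_mono) auto
    then show "\<bar>a - b\<bar> * D \<le> \<epsilon> * r" using D(1) by (simp add: \<delta>_def)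
  qed
  ultimately show ?thesis by blast
qed

lemma (in lie_group) normal_curve_uniformly_in_face:
  fixes N :: "'e \<Rightarrow> real" and N' :: "('e \<Rightarrow>\<^sub>L real) \<Rightarrow> real"
  assumes \<nu>: "norm_on V \<nu>" and V: "subspace V" and poly: "polyhedral V \<nu>"
    and N: "norm_on UNIV N" and N': "norm_on UNIV N'"
  shows "\<exists>\<delta>>0. \<forall>r>0. \<forall>\<gamma> u \<xi>.
           normal_curve G A V \<nu> {0..1} \<gamma> u \<and> \<gamma> 0 = \<one> \<and> has_speed \<nu> {0..1} u r \<and>
           is_covector G A V \<nu> {0..1} \<gamma> u \<xi> \<longrightarrow>
           (\<forall>a b I. interval_with_endpoints a b I \<and> I \<subseteq> {0..1} \<and>
              (M_bound G A V \<nu> N r = 0 \<or> \<bar>a - b\<bar> \<le> \<delta> / (N' \<xi> * M_bound G A V \<nu> N r)) \<longrightarrow>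
              takes_values_in_face V \<nu> I u)"
proof -
  obtain \<epsilon> P where \<epsilon>: "\<epsilon> > 0" "finite P" "{v \<in> V. \<nu> v \<le> 1} = convex hull P" "common_face_gap V \<nu> P \<epsilon>"
    by (rule polyhedral_common_face_gap[OF \<nu> V poly])
  have PK: "p \<in> V" "\<nu> p \<le> 1" if "p \<in> P" for p
    using \<epsilon>(3) hull_inc[of p P convex] that by auto
  obtain k where k: "k > 0" "\<And>\<xi>. norm \<xi> \<le> k * N' \<xi>" using blinfun_norm_on_bound[OF N'] by blast
  obtain c where c: "c > 0" "\<And>v. norm v \<le> c * N v" using norm_le_norm_on[OF N subspace_UNIV] by auto
  obtain c' where c': "c' > 0" "\<And>v. N v \<le> c' * norm v" using norm_on_le_norm[OF N subspace_UNIV] by auto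
  obtain c'' where c'': "c'' > 0" "\<And>v. v \<in> V \<Longrightarrow> norm v \<le> c'' * \<nu> v" using norm_le_norm_on[OF \<nu> V] by blast
  define q where "q = c' * c''"
  have q: "q > 0" using c'(1) c''(1) by (simp add: q_def)
  have Nq: "N v \<le> q * \<nu> v" if "v \<in> V" for v
    using order_trans[OF c'(2) mult_left_mono[OF c''(2)[OF that]]] c'(1) by (simp add: q_def mult.assoc)
  \<comment> \<open>The factor \<open>k * c\<close> compares \<open>\<bar>\<xi> v\<bar>\<close> with \<open>N' \<xi> * N v\<close>; each argument of the bracket
    contributes a factor \<open>q\<close>, which compares \<open>N\<close> with \<open>\<nu>\<close>.\<close>
  define \<kappa> where "\<kappa> = k * c * (q * q)"
  have \<kappa>: "\<kappa> > 0" using k(1) c(1) q by (simp add: \<kappa>_def)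
  have N0: "N v \<ge> 0" "N' \<xi> \<ge> 0" for v \<xi> using norm_onD(1)[OF N] norm_onD(1)[OF N'] by auto
  have main: "takes_values_in_face V \<nu> I u"
    if "r > 0" and normal: "normal_curve G A V \<nu> {0..1} \<gamma> u" and \<gamma>0: "\<gamma> 0 = \<one>" and sp: "has_speed \<nu> {0..1} u r"
      and cov: "is_covector G A V \<nu> {0..1} \<gamma> u \<xi>" and I: "interval_with_endpoints a b I" "I \<subseteq> {0..1}"
      and small: "M_bound G A V \<nu> N r = 0 \<or> \<bar>a - b\<bar> \<le> (\<epsilon> / \<kappa>) / (N' \<xi> * M_bound G A V \<nu> N r)"
    for r \<gamma> u \<xi> a b I
  proof -
    let ?M = "M_bound G A V \<nu> N r"
    have hc: "horizontal_curve G A V {0..1} \<gamma> u" using normal by (simp add: normal_curve_def)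
    have ball: "\<gamma> t \<in> sf_cball G A V \<nu> \<one> r" if "t \<in> {0..1}" for t
      using constant_speed_curve_in_sf_cball[OF V \<nu> hc sp _ that] \<open>r > 0\<close> \<gamma>0 by simp
    have M: "?M \<ge> 0" "\<And>t X Y. t \<in> {0..1} \<Longrightarrow> N (Ad G A (\<gamma> t) (ad G A X Y)) \<le> ?M * N X * N Y"
      using M_bound_bounds(2)[OF V \<nu> N \<open>r > 0\<close> ball[of 0]] M_bound_bounds(1)[OF V \<nu> N \<open>r > 0\<close> ball] by auto
    define D where "D = \<kappa> * N' \<xi> * ?M * r"
    have D0: "D \<ge> 0" using \<kappa> N0(2) M(1) \<open>r > 0\<close> by (simp add: D_def)
    have D_bound: "\<bar>blinfun_apply \<xi> (Ad G A (\<gamma> t) (ad G A X p))\<bar> \<le> D"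
      if t: "t \<in> {0..1}" and X: "X \<in> V" "\<nu> X = r" and p: "p \<in> P" for t X p
    proof -
      have NX: "N X \<le> q * r" using Nq[OF X(1)] X(2) by simp
      have "N p \<le> q * \<nu> p" using Nq PK(1)[OF p] by blast
      also have "\<dots> \<le> q * 1" using PK(2)[OF p] q by (intro mult_left_mono) auto
      finally have Np: "N p \<le> q" by simp
      have "N (Ad G A (\<gamma> t) (ad G A X p)) \<le> ?M * N X * N p" by (rule M(2)[OF t])
      also have "\<dots> \<le> ?M * (q * r) * q"
        using NX Np M(1) N0(1) q \<open>r > 0\<close> by (intro mult_mono) auto
      finally have NA: "N (Ad G A (\<gamma> t) (ad G A X p)) \<le> ?M * (q * r) * q" .
      have "\<bar>blinfun_apply \<xi> (Ad G A (\<gamma> t) (ad G A X p))\<bar> \<le> norm \<xi> * norm (Ad G A (\<gamma> t) (ad G A X p))"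
        using norm_blinfun[of \<xi>] by simp
      also have "\<dots> \<le> (k * N' \<xi>) * (c * (?M * (q * r) * q))"
        using k(2) order_trans[OF c(2) mult_left_mono[OF NA]] c(1) k(1) N0(2) by (intro mult_mono) auto
      also have "\<dots> = D" by (simp add: D_def \<kappa>_def mult_ac)
      finally show ?thesis .
    qed
    have AE_V: "AE t in lebesgue_on {0..1}. t \<in> {0..1} \<and> u t \<in> V \<and> \<nu> (u t) = r \<and>
        (\<lambda>v. blinfun_apply \<xi> (Ad G A (\<gamma> t) v)) \<in> energy_subdifferential V \<nu> (u t)"
    proof -
      have "AE t in lebesgue_on {0..1::real}. t \<in> {0..1}" by (rule AE_lebesgue_onI[of "{}"]) auto
      moreover have "AE t in lebesgue_on {0..1}. u t \<in> V \<and> has_velocity A \<gamma> (dL G A (\<gamma> t) (u t)) t {0..1}"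
        using hc by (simp only: horizontal_curve_def)
      moreover note sp[unfolded has_speed_def] cov[unfolded is_covector_def]
      ultimately show ?thesis by eventually_elim blast
    qed
    have AE_D: "AE t in lebesgue_on {0..1}. \<forall>p\<in>P. \<bar>blinfun_apply \<xi> (Ad G A (\<gamma> t) (ad G A (u t) p))\<bar> \<le> D"
      using AE_V by eventually_elim (use D_bound in blast)
    \<comment> \<open>For \<open>\<xi> = 0\<close> the bound on the length of \<open>I\<close> would be a division by 0, but the zero covector belongs to controls of speed 0 only.\<close>
    have "N' \<xi> \<noteq> 0"
    proof
      assume "N' \<xi> = 0"
      then have "\<xi> = 0" using norm_onD(2)[OF N'] by simp
      from AE_V obtain Z where Z: "negligible Z" "\<And>t. t \<in> {0..1} - Z \<Longrightarrow> u t \<in> V \<and> \<nu> (u t) = r \<and>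
        (\<lambda>v. blinfun_apply \<xi> (Ad G A (\<gamma> t) v)) \<in> energy_subdifferential V \<nu> (u t)"
        by (rule AE_lebesgue_on_obtain_negligible) auto
      obtain t where "t \<in> {0..1} - Z" by (rule unit_interval_obtain_outside_negligible[OF Z(1)])
      then have "(\<nu> (u t))\<^sup>2 = 0" and "\<nu> (u t) = r"
        using Z(2) energy_subdifferential_max(1)[OF \<nu> V] \<open>\<xi> = 0\<close> by fastforce+
      then show False using \<open>r > 0\<close> by simp
    qed
    then have N'pos: "N' \<xi> > 0" using N0(2)[of \<xi>] by simp
    have "\<bar>a - b\<bar> * (N' \<xi> * ?M) \<le> \<epsilon> / \<kappa>"
    proof (cases "?M = 0")
      case True
      then show ?thesis using \<epsilon>(1) \<kappa> by simp
    next
      case False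
      then have p: "N' \<xi> * ?M > 0" using N'pos M(1) by simp
      have "\<bar>a - b\<bar> \<le> (\<epsilon> / \<kappa>) / (N' \<xi> * ?M)" using small False by blast
      then show ?thesis by (simp only: pos_le_divide_eq[OF p])
    qed
    then have "\<bar>a - b\<bar> * (N' \<xi> * ?M) * \<kappa> \<le> \<epsilon>" using \<kappa> by (simp add: pos_le_divide_eq)
    then have "\<bar>a - b\<bar> * (N' \<xi> * ?M) * \<kappa> * r \<le> \<epsilon> * r" using \<open>r > 0\<close> by (intro mult_right_mono) auto
    then have "\<bar>a - b\<bar> * D \<le> \<epsilon> * r" by (simp add: D_def mult_ac)
    then show ?thesis
      by (rule control_in_face_if_covector_slow[OF hc cov sp \<open>r > 0\<close> \<epsilon>(4,1) AE_D D0 I])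
  qed
  then show ?thesis using \<epsilon>(1) \<kappa> by (intro exI[of _ "\<epsilon> / \<kappa>"]) auto
qed

theorem theorem1p2:
  fixes G :: "('g::{t2_space, second_countable_topology}, 'b) monoid_scheme"
    and A :: "('g, 'e::euclidean_space) chart set"
    and V :: "'e set" and \<nu> :: "'e \<Rightarrow> real"
  assumes "sub_finsler_lie_group G A V \<nu>" and "polyhedral V \<nu>"
  shows
    "(\<forall>\<gamma> u. normal_curve G A V \<nu> {0..1} \<gamma> u \<and> \<not> \<gamma> constant_on {0..1} \<longrightarrow>
        (\<exists>\<delta>'>0. \<forall>a b I. interval_with_endpoints a b I \<and> I \<subseteq> {0..1} \<and> \<bar>a - b\<bar> \<le> \<delta>' \<longrightarrow>
           takes_values_in_face V \<nu> I u)) \<and>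
     (\<forall>(N :: 'e \<Rightarrow> real) (N' :: ('e \<Rightarrow>\<^sub>L real) \<Rightarrow> real). norm_on UNIV N \<and> norm_on UNIV N' \<longrightarrow>
        (\<exists>\<delta>>0. \<forall>r>0. \<forall>\<gamma> u \<xi>.
           normal_curve G A V \<nu> {0..1} \<gamma> u \<and> \<gamma> 0 = \<one>\<^bsub>G\<^esub> \<and> has_speed \<nu> {0..1} u r \<and>
           is_covector G A V \<nu> {0..1} \<gamma> u \<xi> \<longrightarrow>
           (\<forall>a b I. interval_with_endpoints a b I \<and> I \<subseteq> {0..1} \<and>
              (M_bound G A V \<nu> N r = 0 \<or> \<bar>a - b\<bar> \<le> \<delta> / (N' \<xi> * M_bound G A V \<nu> N r)) \<longrightarrow>
              takes_values_in_face V \<nu> I u)))"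
proof -
  interpret lie_group G A using assms(1) by (simp add: sub_finsler_lie_group_def)
  have V: "subspace V" and \<nu>: "norm_on V \<nu>" using assms(1) by (simp_all add: sub_finsler_lie_group_def)
  show ?thesis
    using normal_curve_locally_in_face[OF \<nu> V assms(2)] normal_curve_uniformly_in_face[OF \<nu> V assms(2)]
    by blast
qed

end
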